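(* The category $\mathbf{2HL}_\infty$ (objects: 2-term $HL_\infty$-algebras; morphisms: $HL_\infty$-morphisms) and the category $\mathbf{HLie2}$ (objects: hom-Lie 2-algebras; morphisms: hom-Lie 2-algebra morphisms) are equivalent.
   Context: All vector spaces are over a fixed ground field of characteristic zero (e.g. $\mathbb R$). **2-vector spaces.** A 2-vector space $L$ is a category internal to the category of vector spaces: a vector space $L_0$ of objects, a vector space $L_1$ of morphisms, and linear source, target, identity maps $s,t:L_1\to L_0$, $i:L_0\to L_1$ and linear composition. Composition is written $f\cdot_{\mathrm v} g$, meaning first $f$, then $g$ (so $t(f)=s(g)$). A linear functor $F=(F_0,F_1)$ between 2-vector spaces is a functor that is linear on objects and on morphisms; a bilinear functor $L\times L\to L$ is a functor that is bilinear on objects and on morphisms. In formulas, "$1$" denotes the identity morphism of the relevant object, and an object occurring inside a bracket with a morphism stands for its identity morphism. **Hom-Lie 2-algebras.** A hom-Lie 2-algebra $(L,[\cdot,\cdot],J,\Phi)$ is a 2-vector space $L$ with: - a skew-symmetric bilinear functor $[\cdot,\cdot]:L\times L\to L$; - a linear functor $\Phi=(\Phi_0,\Phi_1):L\to L$ with $\Phi[\xi,\eta]=[\Phi(\xi),\Phi(\eta)]$ for all $\xi,\eta$ (objects or morphisms); - a skew-symmetric trilinear natural isomorphism (hom-Jacobiator) $J_{x,y,z}:[[x,y],\Phi_0(z)]\to[\Phi_0(x),[y,z]]+[[x,z],\Phi_0(y)]$ with $J_{\Phi_0(x),\Phi_0(y),\Phi_0(z)}=\Phi_1J_{x,y,z}$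 (skew-symmetry means that the arrow part $J_{x,y,z}-i(s(J_{x,y,z}))$ is skew-symmetric in $x,y,z$); such that for all objects $w,x,y,z$ $$J_{[w,x],\Phi_0(y),\Phi_0(z)}\cdot_{\mathrm v}([J_{w,x,z},\Phi_0^2(y)]+1)\cdot_{\mathrm v}(J_{\Phi_0(w),[x,z],\Phi_0(y)}+J_{[w,z],\Phi_0(x),\Phi_0(y)}+1)$$ $$=[J_{w,x,y},\Phi_0^2(z)]\cdot_{\mathrm v}(J_{[w,y],\Phi_0(x),\Phi_0(z)}+J_{\Phi_0(w),[x,y],\Phi_0(z)})\cdot_{\mathrm v}([\Phi_0^2(w),J_{x,y,z}]+[J_{w,y,z},\Phi_0^2(x)]+1)\cdot_{\mathrm v}(1+J_{\Phi_0(w),[y,z],\Phi_0(x)}).$$ **Hom-Lie 2-algebra morphisms.** A morphism $F:(L,[\cdot,\cdot],J,\Phi)\to(L',[\cdot,\cdot]',J',\Phi')$ consists of a linear functor $(F_0,F_1):L\to L'$ with $\Phi'\circ(F_0,F_1)=(F_0,F_1)\circ\Phi$ and a skew-symmetric bilinear natural transformation $F_2(x,y):[F_0(x),F_0(y)]'\to F_0([x,y])$ with $F_2(\Phi_0(x),\Phi_0(y))=\Phi_1'F_2(x,y)$, such that for all objects $x,y,z$ $$[F_2(x,y),1]'\cdot_{\mathrm v}F_2([x,y],\Phi_0(z))\cdot_{\mathrm v}F_1J_{x,y,z}$$ $$=J'_{F_0(x),F_0(y),F_0(z)}\cdot_{\mathrm v}\big([1,F_2(y,z)]'+[F_2(x,z),1]'\big)\cdot_{\mathrm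 v}\big(F_2(\Phi_0(x),[y,z])+F_2([x,z],\Phi_0(y))\big)$$ as morphisms from $[[F_0(x),F_0(y)]',\Phi_0'(F_0(z))]'$ to $F_0[\Phi_0(x),[y,z]]+F_0[[x,z],\Phi_0(y)]$. The identity morphism has the identity functor and the identity natural transformation. The composite $G\circ F$ has underlying functor the composite functor and $(G\circ F)_2(x,y)=G_2(F_0(x),F_0(y))\cdot_{\mathrm v}G_1(F_2(x,y))$. **2-term $HL_\infty$-algebras.** A 2-term $HL_\infty$-algebra $(V_1\xrightarrow{d}V_0,l_2,l_3,\phi_0,\phi_1)$ consists of a linear map $d:V_1\to V_0$; bilinear maps $l_2:V_i\times V_j\to V_{i+j}$ ($i,j\in\{0,1\}$, $V_2=0$); linear maps $\phi_0:V_0\to V_0$, $\phi_1:V_1\to V_1$ with $\phi_0\circ d=d\circ\phi_1$; and a skew-symmetric trilinear map $l_3:V_0\times V_0\times V_0\to V_1$ with $l_3(\phi_0(x),\phi_0(y),\phi_0(z))=\phi_1(l_3(x,y,z))$, such that for all $w,x,y,z\in V_0$, $m,n\in V_1$: (a) $l_2(x,y)=-l_2(y,x)$; (b) $l_2(x,m)=-l_2(m,x)$; (c) $l_2(m,n)=0$; (d) $d\,l_2(x,m)=l_2(x,dm)$; (e) $l_2(dm,n)=l_2(m,dn)$; (f) $\phi_0(l_2(x,y))=l_2(\phi_0(x),\phi_0(y))$; (g) $\phi_1(l_2(x,m))=l_2(\phi_0(x),\phi_1(m))$; (h) $d\,l_3(x,y,z)=l_2(\phi_0(x),l_2(y,z))+l_2(\phi_0(y),l_2(z,x))+l_2(\phi_0(z),l_2(x,y))$;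 (i) $l_3(x,y,dm)=l_2(\phi_0(x),l_2(y,m))+l_2(\phi_0(y),l_2(m,x))+l_2(\phi_1(m),l_2(x,y))$; (j) $l_3(l_2(w,x),\phi_0(y),\phi_0(z))+l_2(l_3(w,x,z),\phi_0^2(y))+l_3(\phi_0(w),l_2(x,z),\phi_0(y))+l_3(l_2(w,z),\phi_0(x),\phi_0(y))=l_2(l_3(w,x,y),\phi_0^2(z))+l_3(l_2(w,y),\phi_0(x),\phi_0(z))+l_3(\phi_0(w),l_2(x,y),\phi_0(z))+l_2(\phi_0^2(w),l_3(x,y,z))+l_2(l_3(w,y,z),\phi_0^2(x))+l_3(\phi_0(w),l_2(y,z),\phi_0(x))$. **$HL_\infty$-morphisms.** A morphism $f=(f_0,f_1,f_2)$ from $(V_1\xrightarrow{d}V_0,l_2,l_3,\phi_0,\phi_1)$ to $(V'_1\xrightarrow{d'}V'_0,l'_2,l'_3,\phi'_0,\phi'_1)$ consists of linear maps $f_0:V_0\to V_0'$, $f_1:V_1\to V_1'$ with $f_0\circ d=d'\circ f_1$, $f_0\circ\phi_0=\phi_0'\circ f_0$, $f_1\circ\phi_1=\phi_1'\circ f_1$, and a skew-symmetric bilinear map $f_2:V_0\times V_0\to V_1'$ with $f_2(\phi_0(x),\phi_0(y))=\phi_1'f_2(x,y)$, such that for all $x,y,z\in V_0$, $m\in V_1$: $d'f_2(x,y)=f_0(l_2(x,y))-l_2'(f_0(x),f_0(y))$; $f_2(x,dm)=f_1(l_2(x,m))-l_2'(f_0(x),f_1(m))$; $l_2'(f_2(x,y),f_0(\phi_0(z)))+f_2(l_2(x,y),\phi_0(z))+f_1(l_3(x,y,z))=l_3'(f_0(x),f_0(y),f_0(z))+l_2'(f_0(\phi_0(x)),f_2(y,z))+l_2'(f_2(x,z),f_0(\phi_0(y)))+f_2(\phi_0(x),l_2(y,z))+f_2(l_2(x,z),\phi_0(y))$.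 The identity is $(\mathrm{Id}_{V_0},\mathrm{Id}_{V_1},0)$; the composite $f'\circ f$ has components $f_0'\circ f_0$, $f_1'\circ f_1$ and $(f'\circ f)_2(x,y)=f_2'(f_0(x),f_0(y))+f_1'(f_2(x,y))$. *)

theory Defs
  imports "HOL-Algebra.Algebra"
begin

section \<open>Categories and their equivalence\<close>

text \<open>
  Hom-sets of different pairs of objects need not be disjoint, so composition takes the three
  objects as arguments: \<open>Comp C A B D g f\<close> is the composite of \<open>f : A \<rightarrow> B\<close> followed by
  \<open>g : B \<rightarrow> D\<close>.
\<close>

record ('o, 'a) category =
  Obj :: "'o set"
  Hom :: "'o \<Rightarrow> 'o \<Rightarrow> 'a set"
  Ident :: "'o \<Rightarrow> 'a"
  Comp :: "'o \<Rightarrow> 'o \<Rightarrow> 'o \<Rightarrow> 'a \<Rightarrow> 'a \<Rightarrow> 'a"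

locale category =
  fixes C :: "('o, 'a) category"
  assumes ident_closed: "A \<in> Obj C \<Longrightarrow> Ident C A \<in> Hom C A A"
    and comp_closed:
      "\<lbrakk>A \<in> Obj C; B \<in> Obj C; D \<in> Obj C; f \<in> Hom C A B; g \<in> Hom C B D\<rbrakk>
        \<Longrightarrow> Comp C A B D g f \<in> Hom C A D"
    and ident_left:
      "\<lbrakk>A \<in> Obj C; B \<in> Obj C; f \<in> Hom C A B\<rbrakk> \<Longrightarrow> Comp C A B B (Ident C B) f = f"
    and ident_right:
      "\<lbrakk>A \<in> Obj C; B \<in> Obj C; f \<in> Hom C A B\<rbrakk> \<Longrightarrow> Comp C A A B f (Ident C A) = f"
    and comp_assoc:
      "\<lbrakk>A \<in> Obj C; B \<in> Obj C; D \<in> Obj C; E \<in> Obj C;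
        f \<in> Hom C A B; g \<in> Hom C B D; h \<in> Hom C D E\<rbrakk>
        \<Longrightarrow> Comp C A D E h (Comp C A B D g f) = Comp C A B E (Comp C B D E h g) f"

definition is_iso :: "('o, 'a) category \<Rightarrow> 'o \<Rightarrow> 'o \<Rightarrow> 'a \<Rightarrow> bool" where
  "is_iso C A B f \<longleftrightarrow> f \<in> Hom C A B \<and>
    (\<exists>g \<in> Hom C B A. Comp C A B A g f = Ident C A \<and> Comp C B A B f g = Ident C B)"

definition is_functor ::
  "('o, 'a) category \<Rightarrow> ('p, 'b) category \<Rightarrow> ('o \<Rightarrow> 'p) \<Rightarrow> ('o \<Rightarrow> 'o \<Rightarrow> 'a \<Rightarrow> 'b) \<Rightarrow> bool" where
  "is_functor C D Fo Fa \<longleftrightarrow>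
    (\<forall>A \<in> Obj C. Fo A \<in> Obj D) \<and>
    (\<forall>A \<in> Obj C. \<forall>B \<in> Obj C. \<forall>f \<in> Hom C A B. Fa A B f \<in> Hom D (Fo A) (Fo B)) \<and>
    (\<forall>A \<in> Obj C. Fa A A (Ident C A) = Ident D (Fo A)) \<and>
    (\<forall>A \<in> Obj C. \<forall>B \<in> Obj C. \<forall>E \<in> Obj C. \<forall>f \<in> Hom C A B. \<forall>g \<in> Hom C B E.
      Fa A E (Comp C A B E g f) = Comp D (Fo A) (Fo B) (Fo E) (Fa B E g) (Fa A B f))"

definition is_natural_iso ::
  "('o, 'a) category \<Rightarrow> ('p, 'b) category \<Rightarrow>
   ('o \<Rightarrow> 'p) \<Rightarrow> ('o \<Rightarrow> 'o \<Rightarrow> 'a \<Rightarrow> 'b) \<Rightarrow> ('o \<Rightarrow> 'p) \<Rightarrow> ('o \<Rightarrow> 'o \<Rightarrow> 'a \<Rightarrow> 'b) \<Rightarrow>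
   ('o \<Rightarrow> 'b) \<Rightarrow> bool" where
  "is_natural_iso C D Fo Fa Go Ga \<eta> \<longleftrightarrow>
    (\<forall>A \<in> Obj C. is_iso D (Fo A) (Go A) (\<eta> A)) \<and>
    (\<forall>A \<in> Obj C. \<forall>B \<in> Obj C. \<forall>f \<in> Hom C A B.
      Comp D (Fo A) (Fo B) (Go B) (\<eta> B) (Fa A B f) =
      Comp D (Fo A) (Go A) (Go B) (Ga A B f) (\<eta> A))"

definition equivalent_categories :: "('o, 'a) category \<Rightarrow> ('p, 'b) category \<Rightarrow> bool" where
  "equivalent_categories C D \<longleftrightarrow> category C \<and> category D \<and>
    (\<exists>Fo Fa Go Ga \<eta> \<epsilon>.
      is_functor C D Fo Fa \<and> is_functor D C Go Ga \<and>
      is_natural_iso C C (\<lambda>A. A) (\<lambda>A B f. f)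
        (\<lambda>A. Go (Fo A)) (\<lambda>A B f. Ga (Fo A) (Fo B) (Fa A B f)) \<eta> \<and>
      is_natural_iso D D (\<lambda>A. Fo (Go A)) (\<lambda>A B f. Fa (Go A) (Go B) (Ga A B f))
        (\<lambda>A. A) (\<lambda>A B f. f) \<epsilon>)"


section \<open>Linear and multilinear maps\<close>

text \<open>
  Vector spaces are modules over a field \<open>R\<close>. The ring multiplication and unit that
  the record type \<^typ>\<open>('k, 'u) module\<close> inherits from rings play no role. Carriers are subsets
  of a type, and the categories below consist of the algebras all of whose
  underlying vector spaces have carriers in one type \<open>'u\<close>, which acts as a universe.
  It may be arbitrary: over a field of characteristic zero a nontrivial vector space is infinite, so
  a direct sum of two vector spaces with carriers in \<open>'u\<close> again has a copy in \<open>'u\<close>.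
\<close>

definition linear_maps ::
  "('k, 'r) ring_scheme \<Rightarrow> ('k, 'u) module \<Rightarrow> ('k, 'v) module \<Rightarrow> ('u \<Rightarrow> 'v) set" where
  "linear_maps R M N = {f \<in> hom (add_monoid M) (add_monoid N).
    \<forall>a \<in> carrier R. \<forall>x \<in> carrier M. f (a \<odot>\<^bsub>M\<^esub> x) = a \<odot>\<^bsub>N\<^esub> f x}"

definition bilinear_maps ::
  "('k, 'r) ring_scheme \<Rightarrow> ('k, 'u) module \<Rightarrow> ('k, 'v) module \<Rightarrow> ('k, 'w) module \<Rightarrow>
   ('u \<Rightarrow> 'v \<Rightarrow> 'w) set" where
  "bilinear_maps R M N P = {b.
    (\<forall>x \<in> carrier M. b x \<in> linear_maps R N P) \<and>
    (\<forall>y \<in> carrier N. (\<lambda>x. b x y) \<in> linear_maps R M P)}"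

definition trilinear_maps ::
  "('k, 'r) ring_scheme \<Rightarrow> ('k, 'u) module \<Rightarrow> ('k, 'v) module \<Rightarrow> ('u \<Rightarrow> 'u \<Rightarrow> 'u \<Rightarrow> 'v) set" where
  "trilinear_maps R M P = {b.
    (\<forall>x \<in> carrier M. \<forall>y \<in> carrier M.
      (\<lambda>z. b x y z) \<in> linear_maps R M P \<and>
      (\<lambda>z. b x z y) \<in> linear_maps R M P \<and>
      (\<lambda>z. b z x y) \<in> linear_maps R M P)}"

definition skew2 :: "('k, 'u) module \<Rightarrow> ('k, 'v) module \<Rightarrow> ('u \<Rightarrow> 'u \<Rightarrow> 'v) \<Rightarrow> bool" where
  "skew2 M P b \<longleftrightarrow> (\<forall>x \<in> carrier M. \<forall>y \<in> carrier M. b x y = \<ominus>\<^bsub>P\<^esub> b y x)"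

text \<open>The two adjacent transpositions generate the symmetric group on the three arguments.\<close>

definition skew3 :: "('k, 'u) module \<Rightarrow> ('k, 'v) module \<Rightarrow> ('u \<Rightarrow> 'u \<Rightarrow> 'u \<Rightarrow> 'v) \<Rightarrow> bool" where
  "skew3 M P b \<longleftrightarrow> (\<forall>x \<in> carrier M. \<forall>y \<in> carrier M. \<forall>z \<in> carrier M.
    b x y z = \<ominus>\<^bsub>P\<^esub> b y x z \<and> b x y z = \<ominus>\<^bsub>P\<^esub> b x z y)"


section \<open>2-vector spaces\<close>

text \<open>\<open>f \<star>\<^bsub>L\<^esub> g\<close> is the composite "first \<open>f\<close>, then \<open>g\<close>"; it is meaningful if \<open>tgt L f = src L g\<close>.\<close>

record ('k, 'u) two_vect =
  Ob :: "('k, 'u) module"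
  Mor :: "('k, 'u) module"
  src :: "'u \<Rightarrow> 'u"
  tgt :: "'u \<Rightarrow> 'u"
  idt :: "'u \<Rightarrow> 'u"
  vcomp :: "'u \<Rightarrow> 'u \<Rightarrow> 'u"  (infixl \<open>\<star>\<index>\<close> 60)

locale two_vector_space =
  fixes R :: "('k, 'r) ring_scheme" and L :: "('k, 'u, 'z) two_vect_scheme" (structure)
  assumes ground_field: "field R"
    and Ob_module: "module R (Ob L)"
    and Mor_module: "module R (Mor L)"
    and src_linear: "src L \<in> linear_maps R (Mor L) (Ob L)"
    and tgt_linear: "tgt L \<in> linear_maps R (Mor L) (Ob L)"
    and idt_linear: "idt L \<in> linear_maps R (Ob L) (Mor L)"
    and src_idt: "x \<in> carrier (Ob L) \<Longrightarrow> src L (idt L x) = x"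
    and tgt_idt: "x \<in> carrier (Ob L) \<Longrightarrow> tgt L (idt L x) = x"
    and vcomp_closed:
      "\<lbrakk>f \<in> carrier (Mor L); g \<in> carrier (Mor L); tgt L f = src L g\<rbrakk>
        \<Longrightarrow> f \<star> g \<in> carrier (Mor L)"
    and src_vcomp:
      "\<lbrakk>f \<in> carrier (Mor L); g \<in> carrier (Mor L); tgt L f = src L g\<rbrakk>
        \<Longrightarrow> src L (f \<star> g) = src L f"
    and tgt_vcomp:
      "\<lbrakk>f \<in> carrier (Mor L); g \<in> carrier (Mor L); tgt L f = src L g\<rbrakk>
        \<Longrightarrow> tgt L (f \<star> g) = tgt L g"
    and vcomp_add:
      "\<lbrakk>f \<in> carrier (Mor L); g \<in> carrier (Mor L); tgt L f = src L g;
        f' \<in> carrier (Mor L); g' \<in> carrier (Mor L); tgt L f' = src L g'\<rbrakk>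
        \<Longrightarrow> (f \<oplus>\<^bsub>Mor L\<^esub> f') \<star> (g \<oplus>\<^bsub>Mor L\<^esub> g') = (f \<star> g) \<oplus>\<^bsub>Mor L\<^esub> (f' \<star> g')"
    and vcomp_smult:
      "\<lbrakk>a \<in> carrier R; f \<in> carrier (Mor L); g \<in> carrier (Mor L); tgt L f = src L g\<rbrakk>
        \<Longrightarrow> (a \<odot>\<^bsub>Mor L\<^esub> f) \<star> (a \<odot>\<^bsub>Mor L\<^esub> g) = a \<odot>\<^bsub>Mor L\<^esub> (f \<star> g)"
    and idt_vcomp: "f \<in> carrier (Mor L) \<Longrightarrow> idt L (src L f) \<star> f = f"
    and vcomp_idt: "f \<in> carrier (Mor L) \<Longrightarrow> f \<star> idt L (tgt L f) = f"
    and vcomp_assoc: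
      "\<lbrakk>f \<in> carrier (Mor L); g \<in> carrier (Mor L); h \<in> carrier (Mor L);
        tgt L f = src L g; tgt L g = src L h\<rbrakk>
        \<Longrightarrow> (f \<star> g) \<star> h = f \<star> (g \<star> h)"

definition linear_functor ::
  "('k, 'r) ring_scheme \<Rightarrow> ('k, 'u, 'y) two_vect_scheme \<Rightarrow> ('k, 'u, 'z) two_vect_scheme \<Rightarrow>
   ('u \<Rightarrow> 'u) \<Rightarrow> ('u \<Rightarrow> 'u) \<Rightarrow> bool" where
  "linear_functor R L L' F0 F1 \<longleftrightarrow>
    F0 \<in> linear_maps R (Ob L) (Ob L') \<and>
    F1 \<in> linear_maps R (Mor L) (Mor L') \<and>
    (\<forall>f \<in> carrier (Mor L). src L' (F1 f) = F0 (src L f) \<and> tgt L' (F1 f) = F0 (tgt L f)) \<and>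
    (\<forall>x \<in> carrier (Ob L). F1 (idt L x) = idt L' (F0 x)) \<and>
    (\<forall>f \<in> carrier (Mor L). \<forall>g \<in> carrier (Mor L). tgt L f = src L g \<longrightarrow>
      F1 (f \<star>\<^bsub>L\<^esub> g) = F1 f \<star>\<^bsub>L'\<^esub> F1 g)"

definition bilinear_functor ::
  "('k, 'r) ring_scheme \<Rightarrow> ('k, 'u, 'z) two_vect_scheme \<Rightarrow>
   ('u \<Rightarrow> 'u \<Rightarrow> 'u) \<Rightarrow> ('u \<Rightarrow> 'u \<Rightarrow> 'u) \<Rightarrow> bool" where
  "bilinear_functor R L b0 b1 \<longleftrightarrow>
    b0 \<in> bilinear_maps R (Ob L) (Ob L) (Ob L) \<and>
    b1 \<in> bilinear_maps R (Mor L) (Mor L) (Mor L) \<and>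
    (\<forall>f \<in> carrier (Mor L). \<forall>g \<in> carrier (Mor L).
      src L (b1 f g) = b0 (src L f) (src L g) \<and> tgt L (b1 f g) = b0 (tgt L f) (tgt L g)) \<and>
    (\<forall>x \<in> carrier (Ob L). \<forall>y \<in> carrier (Ob L). b1 (idt L x) (idt L y) = idt L (b0 x y)) \<and>
    (\<forall>f \<in> carrier (Mor L). \<forall>f' \<in> carrier (Mor L). \<forall>g \<in> carrier (Mor L). \<forall>g' \<in> carrier (Mor L).
      tgt L f = src L f' \<longrightarrow> tgt L g = src L g' \<longrightarrow>
      b1 (f \<star>\<^bsub>L\<^esub> f') (g \<star>\<^bsub>L\<^esub> g') = b1 f g \<star>\<^bsub>L\<^esub> b1 f' g')"

definition arrow_part :: "('k, 'u, 'z) two_vect_scheme \<Rightarrow> 'u \<Rightarrow> 'u" where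
  "arrow_part L f = f \<ominus>\<^bsub>Mor L\<^esub> idt L (src L f)"

definition vinvertible :: "('k, 'u, 'z) two_vect_scheme \<Rightarrow> 'u \<Rightarrow> bool" where
  "vinvertible L f \<longleftrightarrow> f \<in> carrier (Mor L) \<and>
    (\<exists>g \<in> carrier (Mor L). src L g = tgt L f \<and> tgt L g = src L f \<and>
      f \<star>\<^bsub>L\<^esub> g = idt L (src L f) \<and> g \<star>\<^bsub>L\<^esub> f = idt L (tgt L f))"


section \<open>Hom-Lie 2-algebras\<close>

text \<open>
  \<open>\<langle>x, y\<rangle>\<close> is the bracket on objects and \<open>\<llangle>f, g\<rrangle>\<close> the bracket on morphisms.
\<close>

record ('k, 'u) hom_lie2 = "('k, 'u) two_vect" +
  br0 :: "'u \<Rightarrow> 'u \<Rightarrow> 'u"  (\<open>\<langle>_, _\<rangle>\<index>\<close>)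
  br1 :: "'u \<Rightarrow> 'u \<Rightarrow> 'u"  (\<open>\<llangle>_, _\<rrangle>\<index>\<close>)
  jac :: "'u \<Rightarrow> 'u \<Rightarrow> 'u \<Rightarrow> 'u"
  Phi0 :: "'u \<Rightarrow> 'u"
  Phi1 :: "'u \<Rightarrow> 'u"

locale hom_lie2_data =
  fixes R :: "('k, 'r) ring_scheme" and L :: "('k, 'u) hom_lie2" (structure)
begin

abbreviation "L0 \<equiv> carrier (Ob L)"
abbreviation "L1 \<equiv> carrier (Mor L)"
abbreviation add0 (infixl \<open>+\<^sub>0\<close> 65) where "x +\<^sub>0 y \<equiv> x \<oplus>\<^bsub>Ob L\<^esub> y"
abbreviation add1 (infixl \<open>+\<^sub>1\<close> 65) where "f +\<^sub>1 g \<equiv> f \<oplus>\<^bsub>Mor L\<^esub> g"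
abbreviation "\<iota> \<equiv> idt L"
abbreviation "J \<equiv> jac L"
abbreviation "\<Phi>\<^sub>0 \<equiv> Phi0 L"
abbreviation "\<Phi>\<^sub>1 \<equiv> Phi1 L"

end

text \<open>
  In \<open>jacobiator_identity\<close> the identity morphisms written "1" in the usual form of the equation
  are spelled out. They are determined by composability, as are the identities standing for objects
  inside brackets.
\<close>

locale hom_lie_2_algebra = hom_lie2_data R L + two_vector_space R L
  for R :: "('k, 'r) ring_scheme" and L :: "('k, 'u) hom_lie2" (structure) +
  assumes br_functor: "bilinear_functor R L (br0 L) (br1 L)"
    and br0_skew: "skew2 (Ob L) (Ob L) (br0 L)"
    and br1_skew: "skew2 (Mor L) (Mor L) (br1 L)"
    and Phi_functor: "linear_functor R L L \<Phi>\<^sub>0 \<Phi>\<^sub>1"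
    and Phi0_br: "\<lbrakk>x \<in> L0; y \<in> L0\<rbrakk> \<Longrightarrow> \<Phi>\<^sub>0 \<langle>x, y\<rangle> = \<langle>\<Phi>\<^sub>0 x, \<Phi>\<^sub>0 y\<rangle>"
    and Phi1_br: "\<lbrakk>f \<in> L1; g \<in> L1\<rbrakk> \<Longrightarrow> \<Phi>\<^sub>1 \<llangle>f, g\<rrangle> = \<llangle>\<Phi>\<^sub>1 f, \<Phi>\<^sub>1 g\<rrangle>"
    and jac_trilinear: "J \<in> trilinear_maps R (Ob L) (Mor L)"
    and jac_skew: "skew3 (Ob L) (Mor L) (\<lambda>x y z. arrow_part L (J x y z))"
    and src_jac: "\<lbrakk>x \<in> L0; y \<in> L0; z \<in> L0\<rbrakk> \<Longrightarrow> src L (J x y z) = \<langle>\<langle>x, y\<rangle>, \<Phi>\<^sub>0 z\<rangle>"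
    and tgt_jac: "\<lbrakk>x \<in> L0; y \<in> L0; z \<in> L0\<rbrakk>
      \<Longrightarrow> tgt L (J x y z) = \<langle>\<Phi>\<^sub>0 x, \<langle>y, z\<rangle>\<rangle> +\<^sub>0 \<langle>\<langle>x, z\<rangle>, \<Phi>\<^sub>0 y\<rangle>"
    and jac_natural: "\<lbrakk>f \<in> L1; g \<in> L1; h \<in> L1\<rbrakk>
      \<Longrightarrow> \<llangle>\<llangle>f, g\<rrangle>, \<Phi>\<^sub>1 h\<rrangle> \<star> J (tgt L f) (tgt L g) (tgt L h) =
          J (src L f) (src L g) (src L h) \<star> (\<llangle>\<Phi>\<^sub>1 f, \<llangle>g, h\<rrangle>\<rrangle> +\<^sub>1 \<llangle>\<llangle>f, h\<rrangle>, \<Phi>\<^sub>1 g\<rrangle>)"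
    and jac_invertible: "\<lbrakk>x \<in> L0; y \<in> L0; z \<in> L0\<rbrakk> \<Longrightarrow> vinvertible L (J x y z)"
    and jac_Phi: "\<lbrakk>x \<in> L0; y \<in> L0; z \<in> L0\<rbrakk>
      \<Longrightarrow> J (\<Phi>\<^sub>0 x) (\<Phi>\<^sub>0 y) (\<Phi>\<^sub>0 z) = \<Phi>\<^sub>1 (J x y z)"
    and jacobiator_identity: "\<lbrakk>w \<in> L0; x \<in> L0; y \<in> L0; z \<in> L0\<rbrakk> \<Longrightarrow>
        J \<langle>w, x\<rangle> (\<Phi>\<^sub>0 y) (\<Phi>\<^sub>0 z)
        \<star> (\<llangle>J w x z, \<iota> (\<Phi>\<^sub>0 (\<Phi>\<^sub>0 y))\<rrangle> +\<^sub>1 \<iota> \<langle>\<Phi>\<^sub>0 \<langle>w, x\<rangle>, \<langle>\<Phi>\<^sub>0 y, \<Phi>\<^sub>0 z\<rangle>\<rangle>)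
        \<star> (J (\<Phi>\<^sub>0 w) \<langle>x, z\<rangle> (\<Phi>\<^sub>0 y) +\<^sub>1 J \<langle>w, z\<rangle> (\<Phi>\<^sub>0 x) (\<Phi>\<^sub>0 y)
            +\<^sub>1 \<iota> \<langle>\<Phi>\<^sub>0 \<langle>w, x\<rangle>, \<langle>\<Phi>\<^sub>0 y, \<Phi>\<^sub>0 z\<rangle>\<rangle>)
      = \<llangle>J w x y, \<iota> (\<Phi>\<^sub>0 (\<Phi>\<^sub>0 z))\<rrangle>
        \<star> (J \<langle>w, y\<rangle> (\<Phi>\<^sub>0 x) (\<Phi>\<^sub>0 z) +\<^sub>1 J (\<Phi>\<^sub>0 w) \<langle>x, y\<rangle> (\<Phi>\<^sub>0 z))
        \<star> (\<llangle>\<iota> (\<Phi>\<^sub>0 (\<Phi>\<^sub>0 w)), J x y z\<rrangle> +\<^sub>1 \<llangle>J w y z, \<iota> (\<Phi>\<^sub>0 (\<Phi>\<^sub>0 x))\<rrangle>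
            +\<^sub>1 \<iota> (\<langle>\<Phi>\<^sub>0 \<langle>w, y\<rangle>, \<langle>\<Phi>\<^sub>0 x, \<Phi>\<^sub>0 z\<rangle>\<rangle> +\<^sub>0 \<langle>\<langle>\<Phi>\<^sub>0 w, \<Phi>\<^sub>0 z\<rangle>, \<Phi>\<^sub>0 \<langle>x, y\<rangle>\<rangle>))
        \<star> (\<iota> (\<langle>\<Phi>\<^sub>0 (\<Phi>\<^sub>0 w), \<langle>\<Phi>\<^sub>0 x, \<langle>y, z\<rangle>\<rangle>\<rangle> +\<^sub>0 \<langle>\<Phi>\<^sub>0 (\<Phi>\<^sub>0 w), \<langle>\<langle>x, z\<rangle>, \<Phi>\<^sub>0 y\<rangle>\<rangle>
                +\<^sub>0 \<langle>\<langle>\<langle>w, z\<rangle>, \<Phi>\<^sub>0 y\<rangle>, \<Phi>\<^sub>0 (\<Phi>\<^sub>0 x)\<rangle>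
                +\<^sub>0 \<langle>\<Phi>\<^sub>0 \<langle>w, y\<rangle>, \<langle>\<Phi>\<^sub>0 x, \<Phi>\<^sub>0 z\<rangle>\<rangle> +\<^sub>0 \<langle>\<langle>\<Phi>\<^sub>0 w, \<Phi>\<^sub>0 z\<rangle>, \<Phi>\<^sub>0 \<langle>x, y\<rangle>\<rangle>)
            +\<^sub>1 J (\<Phi>\<^sub>0 w) \<langle>y, z\<rangle> (\<Phi>\<^sub>0 x))"

text \<open>
  Morphisms of both kinds of algebras are triples of maps. They are required to be
  extensional, i.e. to have the value \<^const>\<open>undefined\<close> outside the relevant carriers, so that
  equality of morphisms is equality of the maps on the carriers.
\<close>

record 'u mor2 =
  map0 :: "'u \<Rightarrow> 'u"
  map1 :: "'u \<Rightarrow> 'u"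
  map2 :: "'u \<Rightarrow> 'u \<Rightarrow> 'u"

definition extensional_mor2 :: "'u set \<Rightarrow> 'u set \<Rightarrow> 'u mor2 \<Rightarrow> bool" where
  "extensional_mor2 A B f \<longleftrightarrow> map0 f \<in> extensional A \<and> map1 f \<in> extensional B \<and>
    map2 f \<in> extensional A \<and> (\<forall>x \<in> A. map2 f x \<in> extensional A)"

locale hom_lie_2_morphism =
  fixes R :: "('k, 'r) ring_scheme" and L L' :: "('k, 'u) hom_lie2" and F :: "'u mor2"
  assumes mor2_extensional: "extensional_mor2 (carrier (Ob L)) (carrier (Mor L)) F"
    and underlying_functor: "linear_functor R L L' (map0 F) (map1 F)"
    and Phi0_map0: "x \<in> carrier (Ob L) \<Longrightarrow> Phi0 L' (map0 F x) = map0 F (Phi0 L x)"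
    and Phi1_map1: "f \<in> carrier (Mor L) \<Longrightarrow> Phi1 L' (map1 F f) = map1 F (Phi1 L f)"
    and map2_bilinear: "map2 F \<in> bilinear_maps R (Ob L) (Ob L) (Mor L')"
    and map2_skew: "skew2 (Ob L) (Mor L') (map2 F)"
    and src_map2: "\<lbrakk>x \<in> carrier (Ob L); y \<in> carrier (Ob L)\<rbrakk>
      \<Longrightarrow> src L' (map2 F x y) = \<langle>map0 F x, map0 F y\<rangle>\<^bsub>L'\<^esub>"
    and tgt_map2: "\<lbrakk>x \<in> carrier (Ob L); y \<in> carrier (Ob L)\<rbrakk>
      \<Longrightarrow> tgt L' (map2 F x y) = map0 F \<langle>x, y\<rangle>\<^bsub>L\<^esub>"
    and map2_natural: "\<lbrakk>f \<in> carrier (Mor L); g \<in> carrier (Mor L)\<rbrakk>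
      \<Longrightarrow> \<llangle>map1 F f, map1 F g\<rrangle>\<^bsub>L'\<^esub> \<star>\<^bsub>L'\<^esub> map2 F (tgt L f) (tgt L g) =
          map2 F (src L f) (src L g) \<star>\<^bsub>L'\<^esub> map1 F \<llangle>f, g\<rrangle>\<^bsub>L\<^esub>"
    and map2_Phi: "\<lbrakk>x \<in> carrier (Ob L); y \<in> carrier (Ob L)\<rbrakk>
      \<Longrightarrow> map2 F (Phi0 L x) (Phi0 L y) = Phi1 L' (map2 F x y)"
    and coherence:
      "\<lbrakk>x \<in> carrier (Ob L); y \<in> carrier (Ob L); z \<in> carrier (Ob L)\<rbrakk> \<Longrightarrow>
        \<llangle>map2 F x y, idt L' (map0 F (Phi0 L z))\<rrangle>\<^bsub>L'\<^esub>
        \<star>\<^bsub>L'\<^esub> map2 F \<langle>x, y\<rangle>\<^bsub>L\<^esub> (Phi0 L z)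
        \<star>\<^bsub>L'\<^esub> map1 F (jac L x y z)
      = jac L' (map0 F x) (map0 F y) (map0 F z)
        \<star>\<^bsub>L'\<^esub> (\<llangle>idt L' (map0 F (Phi0 L x)), map2 F y z\<rrangle>\<^bsub>L'\<^esub> \<oplus>\<^bsub>Mor L'\<^esub>
               \<llangle>map2 F x z, idt L' (map0 F (Phi0 L y))\<rrangle>\<^bsub>L'\<^esub>)
        \<star>\<^bsub>L'\<^esub> (map2 F (Phi0 L x) \<langle>y, z\<rangle>\<^bsub>L\<^esub> \<oplus>\<^bsub>Mor L'\<^esub> map2 F \<langle>x, z\<rangle>\<^bsub>L\<^esub> (Phi0 L y))"

definition hom_lie_2_ident :: "('k, 'u) hom_lie2 \<Rightarrow> 'u mor2" where
  "hom_lie_2_ident L =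
    \<lparr>map0 = (\<lambda>x \<in> carrier (Ob L). x),
     map1 = (\<lambda>f \<in> carrier (Mor L). f),
     map2 = (\<lambda>x \<in> carrier (Ob L). \<lambda>y \<in> carrier (Ob L). idt L \<langle>x, y\<rangle>\<^bsub>L\<^esub>)\<rparr>"

definition hom_lie_2_comp ::
  "('k, 'u) hom_lie2 \<Rightarrow> ('k, 'u) hom_lie2 \<Rightarrow> ('k, 'u) hom_lie2 \<Rightarrow> 'u mor2 \<Rightarrow> 'u mor2 \<Rightarrow> 'u mor2" where
  "hom_lie_2_comp L L' L'' G F =
    \<lparr>map0 = (\<lambda>x \<in> carrier (Ob L). map0 G (map0 F x)),
     map1 = (\<lambda>f \<in> carrier (Mor L). map1 G (map1 F f)),
     map2 = (\<lambda>x \<in> carrier (Ob L). \<lambda>y \<in> carrier (Ob L).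
       map2 G (map0 F x) (map0 F y) \<star>\<^bsub>L''\<^esub> map1 G (map2 F x y))\<rparr>"

definition HLie2 :: "('k, 'r) ring_scheme \<Rightarrow> (('k, 'u) hom_lie2, 'u mor2) category" where
  "HLie2 R =
    \<lparr>Obj = {L. hom_lie_2_algebra R L},
     Hom = (\<lambda>L L'. {F. hom_lie_2_morphism R L L' F}),
     Ident = hom_lie_2_ident,
     Comp = hom_lie_2_comp\<rparr>"


section \<open>2-term \<open>HL\<^sub>\<infinity>\<close>-algebras\<close>

text \<open>
  The components of \<open>l\<^sub>2\<close> are \<open>l00 : V\<^sub>0 \<times> V\<^sub>0 \<rightarrow> V\<^sub>0\<close>, \<open>l01 : V\<^sub>0 \<times> V\<^sub>1 \<rightarrow> V\<^sub>1\<close> and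
  \<open>l10 : V\<^sub>1 \<times> V\<^sub>0 \<rightarrow> V\<^sub>1\<close>. The remaining component \<open>V\<^sub>1 \<times> V\<^sub>1 \<rightarrow> V\<^sub>2 = 0\<close> is the zero map and
  carries no data, so the axiom \<open>l\<^sub>2(m, n) = 0\<close> is built into the encoding.
\<close>

record ('k, 'u) hl_alg =
  V0 :: "('k, 'u) module"
  V1 :: "('k, 'u) module"
  diff :: "'u \<Rightarrow> 'u"
  l00 :: "'u \<Rightarrow> 'u \<Rightarrow> 'u"
  l01 :: "'u \<Rightarrow> 'u \<Rightarrow> 'u"
  l10 :: "'u \<Rightarrow> 'u \<Rightarrow> 'u"
  l3 :: "'u \<Rightarrow> 'u \<Rightarrow> 'u \<Rightarrow> 'u"
  phi0 :: "'u \<Rightarrow> 'u"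
  phi1 :: "'u \<Rightarrow> 'u"

locale hl_alg_data =
  fixes R :: "('k, 'r) ring_scheme" and V :: "('k, 'u) hl_alg"
begin

abbreviation "C0 \<equiv> carrier (V0 V)"
abbreviation "C1 \<equiv> carrier (V1 V)"
abbreviation add0 (infixl \<open>+\<^sub>0\<close> 65) where "x +\<^sub>0 y \<equiv> x \<oplus>\<^bsub>V0 V\<^esub> y"
abbreviation add1 (infixl \<open>+\<^sub>1\<close> 65) where "m +\<^sub>1 n \<equiv> m \<oplus>\<^bsub>V1 V\<^esub> n"
abbreviation "d \<equiv> diff V"
abbreviation "l\<^sub>0\<^sub>0 \<equiv> l00 V"
abbreviation "l\<^sub>0\<^sub>1 \<equiv> l01 V"
abbreviation "l\<^sub>1\<^sub>0 \<equiv> l10 V"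
abbreviation "l\<^sub>3 \<equiv> l3 V"
abbreviation "\<phi>\<^sub>0 \<equiv> phi0 V"
abbreviation "\<phi>\<^sub>1 \<equiv> phi1 V"

end

locale hl_algebra = hl_alg_data R V
  for R :: "('k, 'r) ring_scheme" and V :: "('k, 'u) hl_alg" +
  assumes ground_field: "field R"
    and V0_module: "module R (V0 V)"
    and V1_module: "module R (V1 V)"
    and d_linear: "d \<in> linear_maps R (V1 V) (V0 V)"
    and l00_bilinear: "l\<^sub>0\<^sub>0 \<in> bilinear_maps R (V0 V) (V0 V) (V0 V)"
    and l01_bilinear: "l\<^sub>0\<^sub>1 \<in> bilinear_maps R (V0 V) (V1 V) (V1 V)"
    and l10_bilinear: "l\<^sub>1\<^sub>0 \<in> bilinear_maps R (V1 V) (V0 V) (V1 V)"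
    and phi0_linear: "\<phi>\<^sub>0 \<in> linear_maps R (V0 V) (V0 V)"
    and phi1_linear: "\<phi>\<^sub>1 \<in> linear_maps R (V1 V) (V1 V)"
    and phi_d: "m \<in> C1 \<Longrightarrow> \<phi>\<^sub>0 (d m) = d (\<phi>\<^sub>1 m)"
    and l3_trilinear: "l\<^sub>3 \<in> trilinear_maps R (V0 V) (V1 V)"
    and l3_skew: "skew3 (V0 V) (V1 V) l\<^sub>3"
    and l3_phi: "\<lbrakk>x \<in> C0; y \<in> C0; z \<in> C0\<rbrakk> \<Longrightarrow> l\<^sub>3 (\<phi>\<^sub>0 x) (\<phi>\<^sub>0 y) (\<phi>\<^sub>0 z) = \<phi>\<^sub>1 (l\<^sub>3 x y z)"
    and l00_skew: "\<lbrakk>x \<in> C0; y \<in> C0\<rbrakk> \<Longrightarrow> l\<^sub>0\<^sub>0 x y = \<ominus>\<^bsub>V0 V\<^esub> l\<^sub>0\<^sub>0 y x"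
    and l01_skew: "\<lbrakk>x \<in> C0; m \<in> C1\<rbrakk> \<Longrightarrow> l\<^sub>0\<^sub>1 x m = \<ominus>\<^bsub>V1 V\<^esub> l\<^sub>1\<^sub>0 m x"
    and d_l01: "\<lbrakk>x \<in> C0; m \<in> C1\<rbrakk> \<Longrightarrow> d (l\<^sub>0\<^sub>1 x m) = l\<^sub>0\<^sub>0 x (d m)"
    and l01_d: "\<lbrakk>m \<in> C1; n \<in> C1\<rbrakk> \<Longrightarrow> l\<^sub>0\<^sub>1 (d m) n = l\<^sub>1\<^sub>0 m (d n)"
    and phi0_l00: "\<lbrakk>x \<in> C0; y \<in> C0\<rbrakk> \<Longrightarrow> \<phi>\<^sub>0 (l\<^sub>0\<^sub>0 x y) = l\<^sub>0\<^sub>0 (\<phi>\<^sub>0 x) (\<phi>\<^sub>0 y)"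
    and phi1_l01: "\<lbrakk>x \<in> C0; m \<in> C1\<rbrakk> \<Longrightarrow> \<phi>\<^sub>1 (l\<^sub>0\<^sub>1 x m) = l\<^sub>0\<^sub>1 (\<phi>\<^sub>0 x) (\<phi>\<^sub>1 m)"
    and d_l3: "\<lbrakk>x \<in> C0; y \<in> C0; z \<in> C0\<rbrakk> \<Longrightarrow>
      d (l\<^sub>3 x y z) =
        l\<^sub>0\<^sub>0 (\<phi>\<^sub>0 x) (l\<^sub>0\<^sub>0 y z) +\<^sub>0 l\<^sub>0\<^sub>0 (\<phi>\<^sub>0 y) (l\<^sub>0\<^sub>0 z x) +\<^sub>0 l\<^sub>0\<^sub>0 (\<phi>\<^sub>0 z) (l\<^sub>0\<^sub>0 x y)"
    and l3_d: "\<lbrakk>x \<in> C0; y \<in> C0; m \<in> C1\<rbrakk> \<Longrightarrow>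
      l\<^sub>3 x y (d m) =
        l\<^sub>0\<^sub>1 (\<phi>\<^sub>0 x) (l\<^sub>0\<^sub>1 y m) +\<^sub>1 l\<^sub>0\<^sub>1 (\<phi>\<^sub>0 y) (l\<^sub>1\<^sub>0 m x) +\<^sub>1 l\<^sub>1\<^sub>0 (\<phi>\<^sub>1 m) (l\<^sub>0\<^sub>0 x y)"
    and l3_identity: "\<lbrakk>w \<in> C0; x \<in> C0; y \<in> C0; z \<in> C0\<rbrakk> \<Longrightarrow>
        l\<^sub>3 (l\<^sub>0\<^sub>0 w x) (\<phi>\<^sub>0 y) (\<phi>\<^sub>0 z) +\<^sub>1 l\<^sub>1\<^sub>0 (l\<^sub>3 w x z) (\<phi>\<^sub>0 (\<phi>\<^sub>0 y))
        +\<^sub>1 l\<^sub>3 (\<phi>\<^sub>0 w) (l\<^sub>0\<^sub>0 x z) (\<phi>\<^sub>0 y) +\<^sub>1 l\<^sub>3 (l\<^sub>0\<^sub>0 w z) (\<phi>\<^sub>0 x) (\<phi>\<^sub>0 y)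
      = l\<^sub>1\<^sub>0 (l\<^sub>3 w x y) (\<phi>\<^sub>0 (\<phi>\<^sub>0 z)) +\<^sub>1 l\<^sub>3 (l\<^sub>0\<^sub>0 w y) (\<phi>\<^sub>0 x) (\<phi>\<^sub>0 z)
        +\<^sub>1 l\<^sub>3 (\<phi>\<^sub>0 w) (l\<^sub>0\<^sub>0 x y) (\<phi>\<^sub>0 z) +\<^sub>1 l\<^sub>0\<^sub>1 (\<phi>\<^sub>0 (\<phi>\<^sub>0 w)) (l\<^sub>3 x y z)
        +\<^sub>1 l\<^sub>1\<^sub>0 (l\<^sub>3 w y z) (\<phi>\<^sub>0 (\<phi>\<^sub>0 x)) +\<^sub>1 l\<^sub>3 (\<phi>\<^sub>0 w) (l\<^sub>0\<^sub>0 y z) (\<phi>\<^sub>0 x)"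

locale hl_morphism =
  fixes R :: "('k, 'r) ring_scheme" and V V' :: "('k, 'u) hl_alg" and f :: "'u mor2"
  assumes mor2_extensional: "extensional_mor2 (carrier (V0 V)) (carrier (V1 V)) f"
    and map0_linear: "map0 f \<in> linear_maps R (V0 V) (V0 V')"
    and map1_linear: "map1 f \<in> linear_maps R (V1 V) (V1 V')"
    and map0_d: "m \<in> carrier (V1 V) \<Longrightarrow> map0 f (diff V m) = diff V' (map1 f m)"
    and map0_phi0: "x \<in> carrier (V0 V) \<Longrightarrow> map0 f (phi0 V x) = phi0 V' (map0 f x)"
    and map1_phi1: "m \<in> carrier (V1 V) \<Longrightarrow> map1 f (phi1 V m) = phi1 V' (map1 f m)"
    and map2_bilinear: "map2 f \<in> bilinear_maps R (V0 V) (V0 V) (V1 V')"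
    and map2_skew: "skew2 (V0 V) (V1 V') (map2 f)"
    and map2_phi: "\<lbrakk>x \<in> carrier (V0 V); y \<in> carrier (V0 V)\<rbrakk>
      \<Longrightarrow> map2 f (phi0 V x) (phi0 V y) = phi1 V' (map2 f x y)"
    and d_map2: "\<lbrakk>x \<in> carrier (V0 V); y \<in> carrier (V0 V)\<rbrakk>
      \<Longrightarrow> diff V' (map2 f x y) = map0 f (l00 V x y) \<ominus>\<^bsub>V0 V'\<^esub> l00 V' (map0 f x) (map0 f y)"
    and map2_d: "\<lbrakk>x \<in> carrier (V0 V); m \<in> carrier (V1 V)\<rbrakk>
      \<Longrightarrow> map2 f x (diff V m) = map1 f (l01 V x m) \<ominus>\<^bsub>V1 V'\<^esub> l01 V' (map0 f x) (map1 f m)"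
    and coherence:
      "\<lbrakk>x \<in> carrier (V0 V); y \<in> carrier (V0 V); z \<in> carrier (V0 V)\<rbrakk> \<Longrightarrow>
        l10 V' (map2 f x y) (map0 f (phi0 V z))
        \<oplus>\<^bsub>V1 V'\<^esub> map2 f (l00 V x y) (phi0 V z)
        \<oplus>\<^bsub>V1 V'\<^esub> map1 f (l3 V x y z)
      = l3 V' (map0 f x) (map0 f y) (map0 f z)
        \<oplus>\<^bsub>V1 V'\<^esub> l01 V' (map0 f (phi0 V x)) (map2 f y z)
        \<oplus>\<^bsub>V1 V'\<^esub> l10 V' (map2 f x z) (map0 f (phi0 V y))
        \<oplus>\<^bsub>V1 V'\<^esub> map2 f (phi0 V x) (l00 V y z)
        \<oplus>\<^bsub>V1 V'\<^esub> map2 f (l00 V x z) (phi0 V y)"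

definition hl_ident :: "('k, 'u) hl_alg \<Rightarrow> 'u mor2" where
  "hl_ident V =
    \<lparr>map0 = (\<lambda>x \<in> carrier (V0 V). x),
     map1 = (\<lambda>m \<in> carrier (V1 V). m),
     map2 = (\<lambda>x \<in> carrier (V0 V). \<lambda>y \<in> carrier (V0 V). \<zero>\<^bsub>V1 V\<^esub>)\<rparr>"

definition hl_comp ::
  "('k, 'u) hl_alg \<Rightarrow> ('k, 'u) hl_alg \<Rightarrow> ('k, 'u) hl_alg \<Rightarrow> 'u mor2 \<Rightarrow> 'u mor2 \<Rightarrow> 'u mor2" where
  "hl_comp V V' V'' g f =
    \<lparr>map0 = (\<lambda>x \<in> carrier (V0 V). map0 g (map0 f x)),
     map1 = (\<lambda>m \<in> carrier (V1 V). map1 g (map1 f m)),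
     map2 = (\<lambda>x \<in> carrier (V0 V). \<lambda>y \<in> carrier (V0 V).
       map2 g (map0 f x) (map0 f y) \<oplus>\<^bsub>V1 V''\<^esub> map1 g (map2 f x y))\<rparr>"

definition TwoHL :: "('k, 'r) ring_scheme \<Rightarrow> (('k, 'u) hl_alg, 'u mor2) category" where
  "TwoHL R =
    \<lparr>Obj = {V. hl_algebra R V},
     Hom = (\<lambda>V V'. {f. hl_morphism R V V' f}),
     Ident = hl_ident,
     Comp = hl_comp\<rparr>"

end

theory Submission
  imports Defs
begin

text \<open>
  A morphism \<open>f\<close> of a 2-vector space is determined by its source and its arrow part
  \<open>f - i(s(f))\<close>, and arrow parts add up under composition. Hence all structure on a
  hom-Lie 2-algebra \<open>L\<close> restricts to the complex \<open>t : ker s \<rightarrow> L\<^sub>0\<close>, with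
  \<open>l\<^sub>3\<close> the arrow part of the Jacobiator, and taking arrow parts turns each coherence law into the
  corresponding \<open>HL\<^sub>\<infinity>\<close>-identity. The resulting functor is bijective on hom-sets, because a
  morphism can be rebuilt from its sources and arrow parts. It is essentially surjective because
  \<open>V\<^sub>0 \<oplus> V\<^sub>1\<close> carries a hom-Lie 2-algebra for every \<open>V\<close>; a copy of it with carrier in
  the given universe exists as nonzero vector spaces in characteristic zero are infinite.
  The category axioms for hom-Lie 2-algebras are pulled back along the bijections of hom-sets.
\<close>

section \<open>Equivalences from fully faithful essentially surjective functors\<close>

text \<open>The functor given by formulas goes from hom-Lie 2-algebras to 2-term algebras; the one
  in the other direction is only chosen. The obstacle is that carriers are subsets of a fixed type:
  the product of \<open>V0\<close> and \<open>V1\<close> must be coded inside it, and the coding is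
  chosen anew for every \<open>V\<close>, with no compatibility between the choices. Working with
  full faithfulness and essential surjectivity avoids any functoriality of the coding. The formulas
  for arrow parts come from whiskering. A bracket of arrows factors as [f,1] followed by [1,g], and
  also as [1,g] followed by [f,1]. The first order yields the formula used for the bracket of
  arrows; agreement of both on arrows out of 0 is the axiom l2(dm,n) = l2(m,dn). Naturality of the
  Jacobiator and of F_2 at identities and a single arrow out of 0 yields the axioms about l3(x,y,dm)
  and f2(x,dm). Conversely, general naturality follows from these axioms by moving the arguments
  from source to target one at a time.\<close>

locale ff_ess_surj = category C for C :: "('o, 'a) category" +
  fixes D :: "('p, 'b) category" and T Ta Ti
  assumes T_Obj: "A \<in> Obj D \<Longrightarrow> T A \<in> Obj C"
    and Ta_Hom: "\<lbrakk>A \<in> Obj D; B \<in> Obj D; F \<in> Hom D A B\<rbrakk> \<Longrightarrow> Ta A B F \<in> Hom C (T A) (T B)"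
    and Ti_Hom: "\<lbrakk>A \<in> Obj D; B \<in> Obj D; f \<in> Hom C (T A) (T B)\<rbrakk> \<Longrightarrow> Ti A B f \<in> Hom D A B"
    and Ti_Ta: "\<lbrakk>A \<in> Obj D; B \<in> Obj D; F \<in> Hom D A B\<rbrakk> \<Longrightarrow> Ti A B (Ta A B F) = F"
    and Ta_Ti: "\<lbrakk>A \<in> Obj D; B \<in> Obj D; f \<in> Hom C (T A) (T B)\<rbrakk> \<Longrightarrow> Ta A B (Ti A B f) = f"
    and Ident_D: "A \<in> Obj D \<Longrightarrow> Ident D A = Ti A A (Ident C (T A))"
    and Comp_D: "\<lbrakk>A \<in> Obj D; B \<in> Obj D; E \<in> Obj D; F \<in> Hom D A B; G \<in> Hom D B E\<rbrakk>
      \<Longrightarrow> Comp D A B E G F = Ti A E (Comp C (T A) (T B) (T E) (Ta B E G) (Ta A B F))"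
    and ess_surj: "V \<in> Obj C \<Longrightarrow> \<exists>A \<in> Obj D. \<exists>f. is_iso C (T A) V f"
begin

lemma comp_closed_D:
  "\<lbrakk>A \<in> Obj D; B \<in> Obj D; E \<in> Obj D; F \<in> Hom D A B; G \<in> Hom D B E\<rbrakk>
    \<Longrightarrow> Comp D A B E G F \<in> Hom D A E"
  by (simp add: Comp_D Ti_Hom comp_closed T_Obj Ta_Hom)

lemma Ta_Comp:
  "\<lbrakk>A \<in> Obj D; B \<in> Obj D; E \<in> Obj D; F \<in> Hom D A B; G \<in> Hom D B E\<rbrakk>
    \<Longrightarrow> Ta A E (Comp D A B E G F) = Comp C (T A) (T B) (T E) (Ta B E G) (Ta A B F)"
  by (simp add: Comp_D Ta_Ti comp_closed T_Obj Ta_Hom)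

lemma ident_closed_D: "A \<in> Obj D \<Longrightarrow> Ident D A \<in> Hom D A A"
  by (simp add: Ident_D Ti_Hom ident_closed T_Obj)

lemma Ta_Ident: "A \<in> Obj D \<Longrightarrow> Ta A A (Ident D A) = Ident C (T A)"
  by (simp add: Ident_D Ta_Ti ident_closed T_Obj)

lemma Ta_inject:
  "\<lbrakk>A \<in> Obj D; B \<in> Obj D; F \<in> Hom D A B; G \<in> Hom D A B; Ta A B F = Ta A B G\<rbrakk> \<Longrightarrow> F = G"
  by (metis Ti_Ta)

text \<open>Associativity is tested after applying \<open>Ta\<close>, which is injective on
  hom-sets. The unit laws follow directly, since by \<open>Comp_D\<close> a composite in
  \<open>D\<close> is the \<open>Ti\<close>-image of a composite in \<open>C\<close>.\<close>

lemma category_D: "category D"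
proof
  fix A B E K F G H
  assume o: "A \<in> Obj D" "B \<in> Obj D" "E \<in> Obj D" "K \<in> Obj D"
    and h: "F \<in> Hom D A B" "G \<in> Hom D B E" "H \<in> Hom D E K"
  show "Comp D A E K H (Comp D A B E G F) = Comp D A B K (Comp D B E K H G) F"
    by (rule Ta_inject[of A K])
      (use o h in \<open>simp_all add: comp_closed_D Ta_Comp comp_assoc[of "T A" "T B" "T E" "T K"] T_Obj Ta_Hom\<close>)
next
  fix A B F assume "A \<in> Obj D" "B \<in> Obj D" "F \<in> Hom D A B"
  then show "Comp D A B B (Ident D B) F = F" "Comp D A A B F (Ident D A) = F"
    by (simp_all add: Comp_D ident_closed_D Ta_Ident ident_left ident_right T_Obj Ta_Hom Ti_Ta)
qed (simp_all add: ident_closed_D comp_closed_D)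

lemma is_iso_Ti:
  assumes A: "A \<in> Obj D" "B \<in> Obj D" and "is_iso C (T A) (T B) f"
  shows "is_iso D A B (Ti A B f)"
proof -
  obtain g where g: "f \<in> Hom C (T A) (T B)" "g \<in> Hom C (T B) (T A)"
      "Comp C (T A) (T B) (T A) g f = Ident C (T A)" "Comp C (T B) (T A) (T B) f g = Ident C (T B)"
    using assms unfolding is_iso_def by blast
  show ?thesis
    unfolding is_iso_def
    by (intro conjI bexI[of _ "Ti B A g"])
      (use A g in \<open>simp_all add: Ti_Hom Comp_D Ta_Ti Ident_D\<close>)
qed

text \<open>The quasi-inverse of \<open>T\<close> picks a preimage \<open>S V\<close> up to
  isomorphism for each \<open>V\<close>; on morphisms it conjugates with the chosen isomorphisms
  \<open>e\<close> and lifts the result through \<open>Ti\<close>.\<close>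

lemma equivalence: "equivalent_categories C D"
proof -
  define S where "S V = (SOME A. A \<in> Obj D \<and> (\<exists>f. is_iso C (T A) V f))" for V
  have S: "S V \<in> Obj D" "\<exists>f. is_iso C (T (S V)) V f" if "V \<in> Obj C" for V
    using someI_ex[of "\<lambda>A. A \<in> Obj D \<and> (\<exists>f. is_iso C (T A) V f)"] ess_surj[OF that]
    unfolding S_def by blast+
  obtain e where e: "\<And>V. V \<in> Obj C \<Longrightarrow> is_iso C (T (S V)) V (e V)"
    using S(2) by metis
  have "\<exists>g. g \<in> Hom C V (T (S V)) \<and> Comp C (T (S V)) V (T (S V)) g (e V) = Ident C (T (S V)) \<and>
      Comp C V (T (S V)) V (e V) g = Ident C V" if "V \<in> Obj C" for V
    using e[OF that] unfolding is_iso_def by blast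
  then obtain e' where e': "\<And>V. V \<in> Obj C \<Longrightarrow> e' V \<in> Hom C V (T (S V))"
      "\<And>V. V \<in> Obj C \<Longrightarrow> Comp C (T (S V)) V (T (S V)) (e' V) (e V) = Ident C (T (S V))"
      "\<And>V. V \<in> Obj C \<Longrightarrow> Comp C V (T (S V)) V (e V) (e' V) = Ident C V"
    by metis
  have eH: "e V \<in> Hom C (T (S V)) V" if "V \<in> Obj C" for V
    using e[OF that] unfolding is_iso_def by blast
  have iso_e': "is_iso C V (T (S V)) (e' V)" if "V \<in> Obj C" for V
    unfolding is_iso_def using e' eH that by blast
  \<comment> \<open>The conjugate of \<open>f\<close> by the chosen isomorphisms: along
    \<open>e V\<close>, then \<open>f\<close>, then back along \<open>e' W\<close>.\<close>
  define U where "U V W f = Comp C (T (S V)) W (T (S W)) (e' W) (Comp C (T (S V)) V W f (e V))" for V W f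
  note T = S(1) T_Obj
  have U: "U V W f \<in> Hom C (T (S V)) (T (S W))" if "V \<in> Obj C" "W \<in> Obj C" "f \<in> Hom C V W" for V W f
    unfolding U_def using that by (intro comp_closed) (auto intro: T e' eH comp_closed)
  \<comment> \<open>This equation and the next are the naturality squares of \<open>e'\<close> and
    \<open>e\<close>; they later become those of the unit and the counit.\<close>
  have U_e': "Comp C V (T (S V)) (T (S W)) (U V W f) (e' V) = Comp C V W (T (S W)) (e' W) f"
    if "V \<in> Obj C" "W \<in> Obj C" "f \<in> Hom C V W" for V W f
    unfolding U_def using that
    by (simp add: T e' eH comp_closed ident_right
        comp_assoc[of V "T (S V)" W "T (S W)", symmetric] comp_assoc[of V "T (S V)" V W, symmetric])
  have e_U: "Comp C (T (S V)) (T (S W)) W (e W) (U V W f) = Comp C (T (S V)) V W f (e V)"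
    if "V \<in> Obj C" "W \<in> Obj C" "f \<in> Hom C V W" for V W f
    unfolding U_def using that
    by (simp add: T e' eH comp_closed ident_left comp_assoc[of "T (S V)" W "T (S W)" W])
  \<comment> \<open>Composition with the isomorphism \<open>e W\<close> is cancelled by
    \<open>e' W\<close>. Functoriality of \<open>U\<close> can therefore be checked after composing
    with \<open>e\<close>, where \<open>e_U\<close> removes \<open>U\<close>.\<close>
  have e_inject: "f = g" if "V \<in> Obj C" "W \<in> Obj C" "f \<in> Hom C V (T (S W))" "g \<in> Hom C V (T (S W))"
    "Comp C V (T (S W)) W (e W) f = Comp C V (T (S W)) W (e W) g" for V W f g
  proof -
    have "Comp C V W (T (S W)) (e' W) (Comp C V (T (S W)) W (e W) h) = h" if "h \<in> Hom C V (T (S W))" for h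
      using \<open>V \<in> Obj C\<close> \<open>W \<in> Obj C\<close> that
      by (simp add: T e' eH ident_left comp_assoc[of V "T (S W)" W "T (S W)"])
    then show ?thesis using that by metis
  qed
  have U_ident: "U V V (Ident C V) = Ident C (T (S V))" if "V \<in> Obj C" for V
    by (rule e_inject[of "T (S V)" V])
      (use that in \<open>simp_all add: T U ident_closed e_U eH ident_left ident_right\<close>)
  have U_comp: "U V K (Comp C V W K g f) = Comp C (T (S V)) (T (S W)) (T (S K)) (U W K g) (U V W f)"
    if "V \<in> Obj C" "W \<in> Obj C" "K \<in> Obj C" "f \<in> Hom C V W" "g \<in> Hom C W K" for V W K f g
  proof (rule e_inject[of _ K])
    show "Comp C (T (S V)) (T (S K)) K (e K) (U V K (Comp C V W K g f)) =
      Comp C (T (S V)) (T (S K)) K (e K) (Comp C (T (S V)) (T (S W)) (T (S K)) (U W K g) (U V W f))"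
      using that
      by (simp add: T U comp_closed e_U eH comp_assoc[of "T (S V)" "T (S W)" "T (S K)" K]
          comp_assoc[of "T (S V)" V W K, symmetric] comp_assoc[of "T (S V)" "T (S W)" W K, symmetric])
  qed (use that in \<open>simp_all add: T U comp_closed\<close>)
  have 1: "is_functor C D S (\<lambda>V W f. Ti (S V) (S W) (U V W f))"
    unfolding is_functor_def
    by (simp add: T U Ti_Hom U_ident Ident_D U_comp Comp_D Ta_Ti)
  have 2: "is_functor D C T Ta"
    unfolding is_functor_def by (simp add: T_Obj Ta_Hom Ta_Ident Ta_Comp)
  have 3: "is_natural_iso C C (\<lambda>A. A) (\<lambda>A B f. f) (\<lambda>V. T (S V))
      (\<lambda>V W f. Ta (S V) (S W) (Ti (S V) (S W) (U V W f))) e'"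
    unfolding is_natural_iso_def by (simp add: iso_e' Ta_Ti U U_e' T)
  \<comment> \<open>The arrow \<open>e (T A)\<close> runs from \<open>T (S (T A))\<close> to
    \<open>T A\<close>, so it lifts to the counit component from \<open>S (T A)\<close> to
    \<open>A\<close>.\<close>
  have 4: "is_natural_iso D D (\<lambda>A. S (T A)) (\<lambda>A B F. Ti (S (T A)) (S (T B)) (U (T A) (T B) (Ta A B F)))
      (\<lambda>A. A) (\<lambda>A B f. f) (\<lambda>A. Ti (S (T A)) A (e (T A)))"
    unfolding is_natural_iso_def
    by (simp add: is_iso_Ti e Ti_Hom U Ta_Hom Comp_D Ta_Ti T eH e_U)
  show ?thesis
    unfolding equivalent_categories_def using category_axioms category_D 1 2 3 4 by blast
qed

end

section \<open>Linear and multilinear maps\<close>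

lemma linear_mapsI:
  assumes "\<And>x. x \<in> carrier M \<Longrightarrow> f x \<in> carrier N"
    and "\<And>x y. \<lbrakk>x \<in> carrier M; y \<in> carrier M\<rbrakk> \<Longrightarrow> f (x \<oplus>\<^bsub>M\<^esub> y) = f x \<oplus>\<^bsub>N\<^esub> f y"
    and "\<And>a x. \<lbrakk>a \<in> carrier R; x \<in> carrier M\<rbrakk> \<Longrightarrow> f (a \<odot>\<^bsub>M\<^esub> x) = a \<odot>\<^bsub>N\<^esub> f x"
  shows "f \<in> linear_maps R M N"
  using assms unfolding linear_maps_def hom_def by auto

lemma bilinear_mapsI:
  assumes "\<And>x y. \<lbrakk>x \<in> carrier M; y \<in> carrier N\<rbrakk> \<Longrightarrow> b x y \<in> carrier P"
    and "\<And>x y z. \<lbrakk>x \<in> carrier M; y \<in> carrier M; z \<in> carrier N\<rbrakk>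
      \<Longrightarrow> b (x \<oplus>\<^bsub>M\<^esub> y) z = b x z \<oplus>\<^bsub>P\<^esub> b y z"
    and "\<And>a x y. \<lbrakk>a \<in> carrier R; x \<in> carrier M; y \<in> carrier N\<rbrakk> \<Longrightarrow> b (a \<odot>\<^bsub>M\<^esub> x) y = a \<odot>\<^bsub>P\<^esub> b x y"
    and "\<And>x y z. \<lbrakk>x \<in> carrier M; y \<in> carrier N; z \<in> carrier N\<rbrakk>
      \<Longrightarrow> b x (y \<oplus>\<^bsub>N\<^esub> z) = b x y \<oplus>\<^bsub>P\<^esub> b x z"
    and "\<And>a x y. \<lbrakk>a \<in> carrier R; x \<in> carrier M; y \<in> carrier N\<rbrakk> \<Longrightarrow> b x (a \<odot>\<^bsub>N\<^esub> y) = a \<odot>\<^bsub>P\<^esub> b x y"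
  shows "b \<in> bilinear_maps R M N P"
  using assms unfolding bilinear_maps_def by (auto intro!: linear_mapsI)

lemma trilinear_mapsI:
  assumes "\<And>x y z. \<lbrakk>x \<in> carrier M; y \<in> carrier M; z \<in> carrier M\<rbrakk> \<Longrightarrow> b x y z \<in> carrier P"
    and "\<And>x x' y z. \<lbrakk>x \<in> carrier M; x' \<in> carrier M; y \<in> carrier M; z \<in> carrier M\<rbrakk>
      \<Longrightarrow> b (x \<oplus>\<^bsub>M\<^esub> x') y z = b x y z \<oplus>\<^bsub>P\<^esub> b x' y z"
    and "\<And>x x' y z. \<lbrakk>x \<in> carrier M; x' \<in> carrier M; y \<in> carrier M; z \<in> carrier M\<rbrakk>
      \<Longrightarrow> b y (x \<oplus>\<^bsub>M\<^esub> x') z = b y x z \<oplus>\<^bsub>P\<^esub> b y x' z"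
    and "\<And>x x' y z. \<lbrakk>x \<in> carrier M; x' \<in> carrier M; y \<in> carrier M; z \<in> carrier M\<rbrakk>
      \<Longrightarrow> b y z (x \<oplus>\<^bsub>M\<^esub> x') = b y z x \<oplus>\<^bsub>P\<^esub> b y z x'"
    and "\<And>a x y z. \<lbrakk>a \<in> carrier R; x \<in> carrier M; y \<in> carrier M; z \<in> carrier M\<rbrakk>
      \<Longrightarrow> b (a \<odot>\<^bsub>M\<^esub> x) y z = a \<odot>\<^bsub>P\<^esub> b x y z"
    and "\<And>a x y z. \<lbrakk>a \<in> carrier R; x \<in> carrier M; y \<in> carrier M; z \<in> carrier M\<rbrakk>
      \<Longrightarrow> b y (a \<odot>\<^bsub>M\<^esub> x) z = a \<odot>\<^bsub>P\<^esub> b y x z"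
    and "\<And>a x y z. \<lbrakk>a \<in> carrier R; x \<in> carrier M; y \<in> carrier M; z \<in> carrier M\<rbrakk>
      \<Longrightarrow> b y z (a \<odot>\<^bsub>M\<^esub> x) = a \<odot>\<^bsub>P\<^esub> b y z x"
  shows "b \<in> trilinear_maps R M P"
  using assms unfolding trilinear_maps_def by (auto intro!: linear_mapsI)

text \<open>Bundling the map with both modules turns linearity, compatibility with zero and closure
  into simplification rules as soon as the locale is interpreted.\<close>

locale linmap = M: module R M + N: module R N
  for R :: "('k, 'r) ring_scheme" and M :: "('k, 'u) module" and N :: "('k, 'v) module" +
  fixes f :: "'u \<Rightarrow> 'v"
  assumes linear: "f \<in> linear_maps R M N"
begin

lemma closed [simp]: "x \<in> carrier M \<Longrightarrow> f x \<in> carrier N"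
  and add [simp]: "\<lbrakk>x \<in> carrier M; y \<in> carrier M\<rbrakk> \<Longrightarrow> f (x \<oplus>\<^bsub>M\<^esub> y) = f x \<oplus>\<^bsub>N\<^esub> f y"
  and smult [simp]: "\<lbrakk>a \<in> carrier R; x \<in> carrier M\<rbrakk> \<Longrightarrow> f (a \<odot>\<^bsub>M\<^esub> x) = a \<odot>\<^bsub>N\<^esub> f x"
  using linear unfolding linear_maps_def hom_def by auto

lemma zero [simp]: "f \<zero>\<^bsub>M\<^esub> = \<zero>\<^bsub>N\<^esub>"
proof -
  have "f \<zero>\<^bsub>M\<^esub> \<oplus>\<^bsub>N\<^esub> f \<zero>\<^bsub>M\<^esub> = f \<zero>\<^bsub>M\<^esub>"
    by (simp flip: add)
  then show ?thesis
    using N.add.l_cancel_one closed M.zero_closed by blast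
qed

lemma neg [simp]: "x \<in> carrier M \<Longrightarrow> f (\<ominus>\<^bsub>M\<^esub> x) = \<ominus>\<^bsub>N\<^esub> f x"
  by (rule N.minus_equality[symmetric]) (simp_all add: M.l_neg flip: add)

lemma diff [simp]: "\<lbrakk>x \<in> carrier M; y \<in> carrier M\<rbrakk> \<Longrightarrow> f (x \<ominus>\<^bsub>M\<^esub> y) = f x \<ominus>\<^bsub>N\<^esub> f y"
  by (simp add: M.minus_eq N.minus_eq)

end

locale bilinmap = M: module R M + N: module R N + P: module R P
  for R :: "('k, 'r) ring_scheme" and M :: "('k, 'u) module" and N :: "('k, 'v) module"
    and P :: "('k, 'w) module" +
  fixes b :: "'u \<Rightarrow> 'v \<Rightarrow> 'w"
  assumes bilinear: "b \<in> bilinear_maps R M N P"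
begin

lemma linmap_right: "x \<in> carrier M \<Longrightarrow> linmap R N P (b x)"
  and linmap_left: "y \<in> carrier N \<Longrightarrow> linmap R M P (\<lambda>x. b x y)"
  using bilinear
  by (auto simp: linmap_def linmap_axioms_def bilinear_maps_def
      M.module_axioms N.module_axioms P.module_axioms)

lemmas closed [simp] = linmap.closed[OF linmap_right]
lemmas add_right [simp] = linmap.add[OF linmap_right]
lemmas smult_right [simp] = linmap.smult[OF linmap_right]
lemmas zero_right [simp] = linmap.zero[OF linmap_right]
lemmas neg_right [simp] = linmap.neg[OF linmap_right]
lemmas add_left [simp] = linmap.add[OF linmap_left]
lemmas smult_left [simp] = linmap.smult[OF linmap_left]
lemmas zero_left [simp] = linmap.zero[OF linmap_left]
lemmas neg_left [simp] = linmap.neg[OF linmap_left]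

end

locale trilinmap = M: module R M + P: module R P
  for R :: "('k, 'r) ring_scheme" and M :: "('k, 'u) module" and P :: "('k, 'v) module" +
  fixes b :: "'u \<Rightarrow> 'u \<Rightarrow> 'u \<Rightarrow> 'v"
  assumes trilinear: "b \<in> trilinear_maps R M P"
begin

lemma linmap_1: "\<lbrakk>x \<in> carrier M; y \<in> carrier M\<rbrakk> \<Longrightarrow> linmap R M P (\<lambda>z. b z x y)"
  and linmap_2: "\<lbrakk>x \<in> carrier M; y \<in> carrier M\<rbrakk> \<Longrightarrow> linmap R M P (\<lambda>z. b x z y)"
  and linmap_3: "\<lbrakk>x \<in> carrier M; y \<in> carrier M\<rbrakk> \<Longrightarrow> linmap R M P (\<lambda>z. b x y z)"
  using trilinear
  by (auto simp: linmap_def linmap_axioms_def trilinear_maps_def M.module_axioms P.module_axioms)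

lemmas closed [simp] = linmap.closed[OF linmap_3]
lemmas add_1 [simp] = linmap.add[OF linmap_1]
lemmas smult_1 [simp] = linmap.smult[OF linmap_1]
lemmas add_2 [simp] = linmap.add[OF linmap_2]
lemmas smult_2 [simp] = linmap.smult[OF linmap_2]
lemmas add_3 [simp] = linmap.add[OF linmap_3]
lemmas smult_3 [simp] = linmap.smult[OF linmap_3]
lemmas zero_3 [simp] = linmap.zero[OF linmap_3]

end

section \<open>Subtraction-free equations and cancellation in abelian groups\<close>

context abelian_group
begin

lemma neg_zero [simp]: "\<ominus> \<zero> = \<zero>"
  by (simp add: minus_equality)

text \<open>Serves to restate the axioms for morphisms that contain a difference as equations of
  sums, which AC rewriting can compare.\<close>

lemma eq_diff_iff: "\<lbrakk>x \<in> carrier G; y \<in> carrier G; z \<in> carrier G\<rbrakk> \<Longrightarrow> x = y \<ominus> z \<longleftrightarrow> x \<oplus> z = y"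
  by (metis a_assoc l_neg minus_eq r_neg r_zero a_inv_closed)

text \<open>AC rewriting need not make an element and its negative adjacent. These two shapes
  supplement the cancellation rules when Jacobi-type identities are normalized.\<close>

lemma neg_cancel:
  assumes "x \<in> carrier G" "y \<in> carrier G"
  shows "x \<oplus> (y \<oplus> \<ominus> x) = y"
    and "z \<in> carrier G \<Longrightarrow> x \<oplus> (y \<oplus> (z \<oplus> \<ominus> x)) = y \<oplus> z"
proof -
  have 1: "x \<oplus> (y \<oplus> \<ominus> x) = y" if "y \<in> carrier G" for y
    using assms(1) that by (simp add: a_lcomm[of x y] r_neg)
  then show "x \<oplus> (y \<oplus> \<ominus> x) = y"
    using assms(2) .
  show "x \<oplus> (y \<oplus> (z \<oplus> \<ominus> x)) = y \<oplus> z" if "z \<in> carrier G"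
    using assms that 1[of "y \<oplus> z"] by (simp add: a_assoc)
qed

end

section \<open>Pairing functions for vector spaces over a field of characteristic zero\<close>

text \<open>The multiples n x are pairwise distinct: equality for m < n gives (n - m) x = 0, and the
  nonzero scalar (n - m) 1 is invertible, so x would be 0.\<close>

lemma infinite_carrier_char_0:
  fixes R :: "('k, 'r) ring_scheme" and M :: "('k, 'u) module"
  assumes "field R" and char0: "\<And>n :: nat. n > 0 \<Longrightarrow> [n] \<cdot>\<^bsub>R\<^esub> \<one>\<^bsub>R\<^esub> \<noteq> \<zero>\<^bsub>R\<^esub>"
    and "module R M" and x: "x \<in> carrier M" "x \<noteq> \<zero>\<^bsub>M\<^esub>"
  shows "infinite (carrier M)"
proof -
  interpret R: field R by fact
  interpret M: module R M by fact
  define g where "g n = ([n] \<cdot>\<^bsub>R\<^esub> \<one>\<^bsub>R\<^esub>) \<odot>\<^bsub>M\<^esub> x" for n :: nat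
  have one_closed: "[n] \<cdot>\<^bsub>R\<^esub> \<one>\<^bsub>R\<^esub> \<in> carrier R" for n :: nat
    by simp
  have g_closed: "g n \<in> carrier M" for n
    unfolding g_def using x one_closed by simp
  have g_nonzero: "g n \<noteq> \<zero>\<^bsub>M\<^esub>" if "n > 0" for n
  proof
    let ?a = "[n] \<cdot>\<^bsub>R\<^esub> \<one>\<^bsub>R\<^esub>"
    assume g0: "g n = \<zero>\<^bsub>M\<^esub>"
    have a: "?a \<in> Units R"
      using char0[OF that] one_closed by (simp add: R.field_Units)
    have "x = (inv\<^bsub>R\<^esub> ?a \<otimes>\<^bsub>R\<^esub> ?a) \<odot>\<^bsub>M\<^esub> x"
      using a x by (metis R.Units_l_inv M.smult_one)
    also have "\<dots> = inv\<^bsub>R\<^esub> ?a \<odot>\<^bsub>M\<^esub> g n"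
      unfolding g_def using a x one_closed by (metis M.smult_assoc1 R.Units_inv_closed)
    also have "\<dots> = \<zero>\<^bsub>M\<^esub>"
      using a by (simp add: g0)
    finally show False
      using x by simp
  qed
  have g_add: "g (m + n) = g m \<oplus>\<^bsub>M\<^esub> g n" for m n
    unfolding g_def using x one_closed
    by (simp add: M.smult_l_distr flip: R.add.nat_pow_mult)
  have less: "g m \<noteq> g n" if "m < n" for m n
  proof
    assume "g m = g n"
    then have "g m \<oplus>\<^bsub>M\<^esub> g (n - m) = g m"
      using that g_add[of m "n - m"] by simp
    then have "g (n - m) = \<zero>\<^bsub>M\<^esub>"
      using g_closed M.add.l_cancel_one by metis
    then show False
      using g_nonzero that by simp
  qed
  have "inj g"
    by (rule injI) (metis less linorder_neq_iff)
  moreover have "range g \<subseteq> carrier M"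
    using g_closed by blast
  ultimately show ?thesis
    using infinite_iff_countable_subset by blast
qed

text \<open>An infinite set S is equipotent with S x S, so pairs of its elements can be coded
  injectively in the type; the decoders \<open>p0\<close> and \<open>p1\<close> are the components
  of the inverse.\<close>

lemma pairing_exists:
  fixes R :: "('k, 'r) ring_scheme" and M N :: "('k, 'u) module"
  assumes "field R" "\<And>n :: nat. n > 0 \<Longrightarrow> [n] \<cdot>\<^bsub>R\<^esub> \<one>\<^bsub>R\<^esub> \<noteq> \<zero>\<^bsub>R\<^esub>"
    and "module R M" "module R N"
  obtains pair :: "'u \<Rightarrow> 'u \<Rightarrow> 'u" and p0 p1 where
    "\<And>x m. \<lbrakk>x \<in> carrier M; m \<in> carrier N\<rbrakk> \<Longrightarrow> p0 (pair x m) = x"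
    "\<And>x m. \<lbrakk>x \<in> carrier M; m \<in> carrier N\<rbrakk> \<Longrightarrow> p1 (pair x m) = m"
proof -
  have "\<exists>g :: 'u \<times> 'u \<Rightarrow> 'u. inj_on g (carrier M \<times> carrier N)"
  proof (cases "carrier M = {\<zero>\<^bsub>M\<^esub>} \<and> carrier N = {\<zero>\<^bsub>N\<^esub>}")
    case True
    \<comment> \<open>The product of two zero spaces is a single point, on which any function is
      injective.\<close>
    then show ?thesis by (auto simp: inj_on_def)
  next
    case False
    \<comment> \<open>One set containing both carriers; it is infinite as soon as one of the two
      spaces is nonzero.\<close>
    let ?S = "carrier M \<union> carrier N"
    have "\<zero>\<^bsub>M\<^esub> \<in> carrier M" "\<zero>\<^bsub>N\<^esub> \<in> carrier N"
      using assms(3,4) by (simp_all add: module_def abelian_group_def abelian_monoid.zero_closed)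
    with False have "infinite ?S"
      using infinite_carrier_char_0[OF assms(1,2,3)] infinite_carrier_char_0[OF assms(1,2,4)]
      by blast
    then have "|?S \<times> ?S| =o |?S|"
      by (rule card_of_Times_same_infinite)
    then obtain g where "bij_betw g (?S \<times> ?S) ?S"
      using card_of_ordIso by blast
    then have "inj_on g (carrier M \<times> carrier N)"
      by (auto simp: bij_betw_def intro: inj_on_subset)
    then show ?thesis by blast
  qed
  then obtain g :: "'u \<times> 'u \<Rightarrow> 'u" where g: "inj_on g (carrier M \<times> carrier N)" ..
  let ?h = "the_inv_into (carrier M \<times> carrier N) g"
  show thesis
    by (rule that[of "\<lambda>u. fst (?h u)" "\<lambda>x m. g (x, m)" "\<lambda>u. snd (?h u)"])
      (simp_all add: the_inv_into_f_f[OF g])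
qed

section \<open>The category of 2-term \<open>HL\<^sub>\<infinity>\<close>-algebras\<close>

context hl_algebra
begin

sublocale A0: module R "V0 V" by (rule V0_module)
sublocale A1: module R "V1 V" by (rule V1_module)
sublocale df: linmap R "V1 V" "V0 V" d by unfold_locales (rule d_linear)
sublocale ph0: linmap R "V0 V" "V0 V" \<phi>\<^sub>0 by unfold_locales (rule phi0_linear)
sublocale ph1: linmap R "V1 V" "V1 V" \<phi>\<^sub>1 by unfold_locales (rule phi1_linear)
sublocale b00: bilinmap R "V0 V" "V0 V" "V0 V" l\<^sub>0\<^sub>0 by unfold_locales (rule l00_bilinear)
sublocale b01: bilinmap R "V0 V" "V1 V" "V1 V" l\<^sub>0\<^sub>1 by unfold_locales (rule l01_bilinear)
sublocale b10: bilinmap R "V1 V" "V0 V" "V1 V" l\<^sub>1\<^sub>0 by unfold_locales (rule l10_bilinear)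
sublocale tr: trilinmap R "V0 V" "V1 V" l\<^sub>3 by unfold_locales (rule l3_trilinear)

lemma l10_skew: "\<lbrakk>x \<in> C0; m \<in> C1\<rbrakk> \<Longrightarrow> l\<^sub>1\<^sub>0 m x = \<ominus>\<^bsub>V1 V\<^esub> l\<^sub>0\<^sub>1 x m"
  by (simp add: l01_skew)

end

locale hl_mor = V: hl_algebra R V + V': hl_algebra R V' + hl_morphism R V V' f
  for R :: "('k, 'r) ring_scheme" and V V' :: "('k, 'u) hl_alg" and f :: "'u mor2"
begin

sublocale f0: linmap R "V0 V" "V0 V'" "map0 f" by unfold_locales (rule map0_linear)
sublocale f1: linmap R "V1 V" "V1 V'" "map1 f" by unfold_locales (rule map1_linear)
sublocale f2: bilinmap R "V0 V" "V0 V" "V1 V'" "map2 f" by unfold_locales (rule map2_bilinear)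

text \<open>Here and in \<open>map1_l01\<close> a morphism axiom is solved for the image of a
  bracket, so that it becomes a rewrite rule without subtraction.\<close>

lemma map0_l00:
  "\<lbrakk>x \<in> carrier (V0 V); y \<in> carrier (V0 V)\<rbrakk> \<Longrightarrow>
    map0 f (l00 V x y) = diff V' (map2 f x y) \<oplus>\<^bsub>V0 V'\<^esub> l00 V' (map0 f x) (map0 f y)"
  using d_map2[of x y] by (simp add: V'.A0.eq_diff_iff)

lemma map1_l01:
  "\<lbrakk>x \<in> carrier (V0 V); m \<in> carrier (V1 V)\<rbrakk> \<Longrightarrow>
    map1 f (l01 V x m) = map2 f x (diff V m) \<oplus>\<^bsub>V1 V'\<^esub> l01 V' (map0 f x) (map1 f m)"
  using map2_d[of x m] by (simp add: V'.A1.eq_diff_iff)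

lemma map2_neg_swap:
  "\<lbrakk>x \<in> carrier (V0 V); y \<in> carrier (V0 V)\<rbrakk> \<Longrightarrow> map2 f x y = \<ominus>\<^bsub>V1 V'\<^esub> map2 f y x"
  using map2_skew unfolding skew2_def by blast

lemma map1_l10:
  assumes "x \<in> carrier (V0 V)" "m \<in> carrier (V1 V)"
  shows "map1 f (l10 V m x) = map2 f (diff V m) x \<oplus>\<^bsub>V1 V'\<^esub> l10 V' (map1 f m) (map0 f x)"
  using assms
  by (simp add: V.l10_skew V'.l10_skew map1_l01 V'.A1.minus_add map2_neg_swap[of "diff V m" x])

end

text \<open>The group-theoretic core of the coherence law for a composite. \<open>coh_g\<close> is
  the coherence of g at the images under f, and \<open>coh_f\<close> is g_1 applied to the coherence
  of f. The element \<open>k\<close>, which is g_1 of l3' at the images, lies on opposite sides of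
  the two, so it cancels on adding them. The equations \<open>e\<close> expand g_1 of a bracket
  containing f_2; the terms \<open>t1\<close>, \<open>t2\<close>, \<open>t3\<close> are values of
  g_2 at d' of f_2, and they combine with \<open>u1\<close>, \<open>u2\<close>, \<open>u3\<close> to
  values of g_2 at f_0 of a bracket.\<close>

lemma (in abelian_group) coherence_comp_aux:
  assumes "a1 \<in> carrier G" "a2 \<in> carrier G" "u1 \<in> carrier G" "u2 \<in> carrier G" "u3 \<in> carrier G"
    "k \<in> carrier G" "k'' \<in> carrier G" "b1 \<in> carrier G" "b1' \<in> carrier G" "b2 \<in> carrier G" "b2' \<in> carrier G"
    "v1 \<in> carrier G" "v2 \<in> carrier G" "v3 \<in> carrier G" "w \<in> carrier G"
    "e1 \<in> carrier G" "e2 \<in> carrier G" "e3 \<in> carrier G" "t1 \<in> carrier G" "t2 \<in> carrier G" "t3 \<in> carrier G"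
    and coh_g: "a1 \<oplus> u1 \<oplus> k = k'' \<oplus> b1 \<oplus> b2 \<oplus> u2 \<oplus> u3"
    and coh_f: "e1 \<oplus> v1 \<oplus> w = k \<oplus> e2 \<oplus> e3 \<oplus> v2 \<oplus> v3"
    and e: "e1 = t1 \<oplus> a2" "e2 = t2 \<oplus> b1'" "e3 = t3 \<oplus> b2'"
  shows "(a1 \<oplus> a2) \<oplus> ((t1 \<oplus> u1) \<oplus> v1) \<oplus> w =
    k'' \<oplus> (b1 \<oplus> b1') \<oplus> (b2 \<oplus> b2') \<oplus> ((t2 \<oplus> u2) \<oplus> v2) \<oplus> ((t3 \<oplus> u3) \<oplus> v3)"
proof -
  have "(a1 \<oplus> a2) \<oplus> ((t1 \<oplus> u1) \<oplus> v1) \<oplus> w \<oplus> k = (a1 \<oplus> u1 \<oplus> k) \<oplus> (e1 \<oplus> v1 \<oplus> w)"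
    unfolding e using assms(1-21) by (simp add: a_ac)
  also have "\<dots> = k'' \<oplus> (b1 \<oplus> b1') \<oplus> (b2 \<oplus> b2') \<oplus> ((t2 \<oplus> u2) \<oplus> v2) \<oplus> ((t3 \<oplus> u3) \<oplus> v3) \<oplus> k"
    unfolding coh_f unfolding coh_g e using assms(1-21) by (simp add: a_ac)
  finally show ?thesis
    using assms(1-21) by simp
qed

lemma hl_comp_morphism:
  fixes R :: "('k, 'r) ring_scheme"
  assumes "hl_mor R V V' f" "hl_mor R V' V'' g"
  shows "hl_morphism R V V'' (hl_comp V V' V'' g f)"
proof -
  interpret f: hl_mor R V V' f by fact
  interpret g: hl_mor R V' V'' g by fact
  show ?thesis
  proof
    show "extensional_mor2 (carrier (V0 V)) (carrier (V1 V)) (hl_comp V V' V'' g f)"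
      unfolding extensional_mor2_def hl_comp_def by simp
    show "map0 (hl_comp V V' V'' g f) \<in> linear_maps R (V0 V) (V0 V'')"
      by (rule linear_mapsI) (simp_all add: hl_comp_def)
    show "map1 (hl_comp V V' V'' g f) \<in> linear_maps R (V1 V) (V1 V'')"
      by (rule linear_mapsI) (simp_all add: hl_comp_def)
    show "map2 (hl_comp V V' V'' g f) \<in> bilinear_maps R (V0 V) (V0 V) (V1 V'')"
      by (rule bilinear_mapsI)
        (simp_all add: hl_comp_def g.V'.A1.a_ac g.V'.A1.smult_r_distr)
    show "skew2 (V0 V) (V1 V'') (map2 (hl_comp V V' V'' g f))"
      unfolding skew2_def
    proof (intro ballI)
      fix x y assume xy: "x \<in> carrier (V0 V)" "y \<in> carrier (V0 V)"
      have "map2 g (map0 f x) (map0 f y) = \<ominus>\<^bsub>V1 V''\<^esub> map2 g (map0 f y) (map0 f x)"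
        "map1 g (map2 f x y) = \<ominus>\<^bsub>V1 V''\<^esub> map1 g (map2 f y x)"
        using xy g.map2_neg_swap[of "map0 f x" "map0 f y"] f.map2_neg_swap[of x y] by simp_all
      then show "map2 (hl_comp V V' V'' g f) x y = \<ominus>\<^bsub>V1 V''\<^esub> map2 (hl_comp V V' V'' g f) y x"
        using xy by (simp add: hl_comp_def g.V'.A1.minus_add)
    qed
  next
    fix x y z
    assume xyz: "x \<in> carrier (V0 V)" "y \<in> carrier (V0 V)" "z \<in> carrier (V0 V)"
    have cf: "map1 g (l10 V' (map2 f x y) (map0 f (phi0 V z))) \<oplus>\<^bsub>V1 V''\<^esub>
        map1 g (map2 f (l00 V x y) (phi0 V z)) \<oplus>\<^bsub>V1 V''\<^esub> map1 g (map1 f (l3 V x y z)) =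
      map1 g (l3 V' (map0 f x) (map0 f y) (map0 f z)) \<oplus>\<^bsub>V1 V''\<^esub>
        map1 g (l01 V' (map0 f (phi0 V x)) (map2 f y z)) \<oplus>\<^bsub>V1 V''\<^esub>
        map1 g (l10 V' (map2 f x z) (map0 f (phi0 V y))) \<oplus>\<^bsub>V1 V''\<^esub>
        map1 g (map2 f (phi0 V x) (l00 V y z)) \<oplus>\<^bsub>V1 V''\<^esub>
        map1 g (map2 f (l00 V x z) (phi0 V y))"
      using arg_cong[OF f.coherence[OF xyz], of "map1 g"] xyz by simp
    \<comment> \<open>Folding replaces phi0' (f_0 x) by f_0 (phi0 x), the form in which these terms
      occur in \<open>cf\<close>.\<close>
    note cg = g.coherence[of "map0 f x" "map0 f y" "map0 f z", folded f.map0_phi0[OF xyz(1)]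
        f.map0_phi0[OF xyz(2)] f.map0_phi0[OF xyz(3)]]
    have cg': "l10 V'' (map2 g (map0 f x) (map0 f y)) (map0 g (map0 f (phi0 V z))) \<oplus>\<^bsub>V1 V''\<^esub>
        map2 g (l00 V' (map0 f x) (map0 f y)) (map0 f (phi0 V z)) \<oplus>\<^bsub>V1 V''\<^esub>
        map1 g (l3 V' (map0 f x) (map0 f y) (map0 f z)) =
      l3 V'' (map0 g (map0 f x)) (map0 g (map0 f y)) (map0 g (map0 f z)) \<oplus>\<^bsub>V1 V''\<^esub>
        l01 V'' (map0 g (map0 f (phi0 V x))) (map2 g (map0 f y) (map0 f z)) \<oplus>\<^bsub>V1 V''\<^esub>
        l10 V'' (map2 g (map0 f x) (map0 f z)) (map0 g (map0 f (phi0 V y))) \<oplus>\<^bsub>V1 V''\<^esub>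
        map2 g (map0 f (phi0 V x)) (l00 V' (map0 f y) (map0 f z)) \<oplus>\<^bsub>V1 V''\<^esub>
        map2 g (l00 V' (map0 f x) (map0 f z)) (map0 f (phi0 V y))"
      by (rule cg) (use xyz in simp_all)
    \<comment> \<open>The underscores leave the 21 membership premises open; the simplifier
      discharges them once \<open>xyz\<close> is available.\<close>
    note aux = g.V'.A1.coherence_comp_aux[OF _ _ _ _ _ _ _ _ _ _ _ _ _ _ _ _ _ _ _ _ _ cg' cf
        g.map1_l10 g.map1_l01 g.map1_l10]
    show "l10 V'' (map2 (hl_comp V V' V'' g f) x y) (map0 (hl_comp V V' V'' g f) (phi0 V z))
        \<oplus>\<^bsub>V1 V''\<^esub> map2 (hl_comp V V' V'' g f) (l00 V x y) (phi0 V z)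
        \<oplus>\<^bsub>V1 V''\<^esub> map1 (hl_comp V V' V'' g f) (l3 V x y z)
      = l3 V'' (map0 (hl_comp V V' V'' g f) x) (map0 (hl_comp V V' V'' g f) y)
            (map0 (hl_comp V V' V'' g f) z)
        \<oplus>\<^bsub>V1 V''\<^esub> l01 V'' (map0 (hl_comp V V' V'' g f) (phi0 V x)) (map2 (hl_comp V V' V'' g f) y z)
        \<oplus>\<^bsub>V1 V''\<^esub> l10 V'' (map2 (hl_comp V V' V'' g f) x z) (map0 (hl_comp V V' V'' g f) (phi0 V y))
        \<oplus>\<^bsub>V1 V''\<^esub> map2 (hl_comp V V' V'' g f) (phi0 V x) (l00 V y z)
        \<oplus>\<^bsub>V1 V''\<^esub> map2 (hl_comp V V' V'' g f) (l00 V x z) (phi0 V y)"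
      using xyz aux by (simp add: hl_comp_def f.map0_l00)
  qed (simp_all add: hl_comp_def f.map0_d g.map0_d f.map0_phi0 g.map0_phi0 f.map1_phi1 g.map1_phi1
      f.map2_phi g.map2_phi f.map0_l00 g.map0_l00 f.map1_l01 g.map1_l01
      g.V'.A0.eq_diff_iff g.V'.A1.eq_diff_iff g.V'.A0.a_ac g.V'.A1.a_ac)
qed

lemma mor2_eqI:
  assumes "extensional_mor2 A B f" "extensional_mor2 A B g"
    and "\<And>x. x \<in> A \<Longrightarrow> map0 f x = map0 g x" "\<And>m. m \<in> B \<Longrightarrow> map1 f m = map1 g m"
    and "\<And>x y. \<lbrakk>x \<in> A; y \<in> A\<rbrakk> \<Longrightarrow> map2 f x y = map2 g x y"
  shows "f = g"
proof (rule mor2.equality)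
  show "map0 f = map0 g" "map1 f = map1 g"
    using assms unfolding extensional_mor2_def by (auto intro: extensionalityI)
  show "map2 f = map2 g"
    using assms unfolding extensional_mor2_def by (intro extensionalityI[of _ A]) (auto intro: extensionalityI)
qed simp

lemma hl_ident_morphism: "hl_algebra R V \<Longrightarrow> hl_morphism R V V (hl_ident V)"
proof -
  assume "hl_algebra R V"
  then interpret hl_algebra R V .
  show ?thesis
  proof
    show "extensional_mor2 C0 C1 (hl_ident V)"
      unfolding extensional_mor2_def hl_ident_def by simp
    show "map0 (hl_ident V) \<in> linear_maps R (V0 V) (V0 V)"
      by (rule linear_mapsI) (simp_all add: hl_ident_def)
    show "map1 (hl_ident V) \<in> linear_maps R (V1 V) (V1 V)"
      by (rule linear_mapsI) (simp_all add: hl_ident_def)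
    show "map2 (hl_ident V) \<in> bilinear_maps R (V0 V) (V0 V) (V1 V)"
      by (rule bilinear_mapsI) (simp_all add: hl_ident_def)
  qed (simp_all add: hl_ident_def skew2_def A0.eq_diff_iff A1.eq_diff_iff)
qed

lemma category_TwoHL:
  "category (TwoHL R :: (('k, 'u) hl_alg, 'u mor2) category)"
proof
  \<comment> \<open>All axioms are proved in one growing context: each is shown as soon as the
    objects and morphisms that it mentions have been introduced.\<close>
  fix A B D E :: "('k, 'u) hl_alg" and f g h
  assume o: "A \<in> Obj (TwoHL R)" "B \<in> Obj (TwoHL R)"
  then interpret A: hl_algebra R A + B: hl_algebra R B
    by (simp_all add: TwoHL_def)
  show "Ident (TwoHL R) A \<in> Hom (TwoHL R) A A"
    using hl_ident_morphism[OF A.hl_algebra_axioms] by (simp add: TwoHL_def)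
  assume f: "f \<in> Hom (TwoHL R) A B"
  interpret f: hl_mor R A B f
    using f by (simp add: TwoHL_def hl_mor_def A.hl_algebra_axioms B.hl_algebra_axioms)
  have ext: "extensional_mor2 (carrier (V0 A)) (carrier (V1 A)) (hl_comp A B' C' g' f')" for B' C' g' f'
    by (simp add: extensional_mor2_def hl_comp_def)
  show "Comp (TwoHL R) A B B (Ident (TwoHL R) B) f = f"
    by (rule mor2_eqI[OF _ f.mor2_extensional])
      (simp_all add: TwoHL_def ext, simp_all add: hl_comp_def hl_ident_def)
  show "Comp (TwoHL R) A A B f (Ident (TwoHL R) A) = f"
    by (rule mor2_eqI[OF _ f.mor2_extensional])
      (simp_all add: TwoHL_def ext, simp_all add: hl_comp_def hl_ident_def)
  assume D: "D \<in> Obj (TwoHL R)" and g: "g \<in> Hom (TwoHL R) B D"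
  interpret g: hl_mor R B D g
    using D g by (simp add: TwoHL_def hl_mor_def B.hl_algebra_axioms)
  show "Comp (TwoHL R) A B D g f \<in> Hom (TwoHL R) A D"
    using hl_comp_morphism[OF f.hl_mor_axioms g.hl_mor_axioms] by (simp add: TwoHL_def)
  assume E: "E \<in> Obj (TwoHL R)" and h: "h \<in> Hom (TwoHL R) D E"
  interpret h: hl_mor R D E h
    using D E h by (simp add: TwoHL_def hl_mor_def)
  show "Comp (TwoHL R) A D E h (Comp (TwoHL R) A B D g f) =
      Comp (TwoHL R) A B E (Comp (TwoHL R) B D E h g) f"
    by (rule mor2_eqI[of "carrier (V0 A)" "carrier (V1 A)"])
      (simp_all add: TwoHL_def ext, simp_all add: hl_comp_def h.V'.A1.a_ac)
qed

section \<open>The 2-term \<open>HL\<^sub>\<infinity>\<close>-algebra of a hom-Lie 2-algebra\<close>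

text \<open>The degree-one part of the normalized (Moore) complex: the arrows starting at 0. Only
  the carrier shrinks, so formulas in the kernel rewrite to formulas in
  \<open>Mor L\<close>.\<close>

definition src_kernel :: "('k, 'u, 'z) two_vect_scheme \<Rightarrow> ('k, 'u) module" where
  "src_kernel L = (Mor L)\<lparr>carrier := {m \<in> carrier (Mor L). src L m = \<zero>\<^bsub>Ob L\<^esub>}\<rparr>"

section \<open>Calculus of arrow parts in a 2-vector space\<close>

context two_vector_space
begin

sublocale Ob: module R "Ob L" by (rule Ob_module)
sublocale Mor: module R "Mor L" by (rule Mor_module)
sublocale s: linmap R "Mor L" "Ob L" "src L" by unfold_locales (rule src_linear)
sublocale t: linmap R "Mor L" "Ob L" "tgt L" by unfold_locales (rule tgt_linear)
sublocale i: linmap R "Ob L" "Mor L" "idt L" by unfold_locales (rule idt_linear)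

declare src_idt [simp] tgt_idt [simp] vcomp_closed [simp] src_vcomp [simp] tgt_vcomp [simp]

abbreviation ap where "ap \<equiv> arrow_part L"

lemma ap_closed [simp]: "f \<in> carrier (Mor L) \<Longrightarrow> ap f \<in> carrier (Mor L)"
  by (simp add: arrow_part_def)

lemma src_ap [simp]: "f \<in> carrier (Mor L) \<Longrightarrow> src L (ap f) = \<zero>\<^bsub>Ob L\<^esub>"
  by (simp add: arrow_part_def Ob.r_neg Ob.minus_eq)

lemma ap_idt [simp]: "x \<in> carrier (Ob L) \<Longrightarrow> ap (idt L x) = \<zero>\<^bsub>Mor L\<^esub>"
  by (simp add: arrow_part_def Mor.r_neg Mor.minus_eq)

lemma ap_ker: "\<lbrakk>m \<in> carrier (Mor L); src L m = \<zero>\<^bsub>Ob L\<^esub>\<rbrakk> \<Longrightarrow> ap m = m"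
  by (simp add: arrow_part_def Mor.minus_eq)

lemma ap_add [simp]:
  "\<lbrakk>f \<in> carrier (Mor L); g \<in> carrier (Mor L)\<rbrakk> \<Longrightarrow> ap (f \<oplus>\<^bsub>Mor L\<^esub> g) = ap f \<oplus>\<^bsub>Mor L\<^esub> ap g"
  by (simp add: arrow_part_def Mor.minus_eq Mor.minus_add Mor.a_ac)

lemma ap_smult [simp]:
  "\<lbrakk>a \<in> carrier R; f \<in> carrier (Mor L)\<rbrakk> \<Longrightarrow> ap (a \<odot>\<^bsub>Mor L\<^esub> f) = a \<odot>\<^bsub>Mor L\<^esub> ap f"
  by (simp add: arrow_part_def Mor.minus_eq Mor.smult_r_distr Mor.smult_r_minus)

sublocale apl: linmap R "Mor L" "Mor L" ap
  by unfold_locales (simp add: linear_mapsI)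

lemma mor_decomp: "f \<in> carrier (Mor L) \<Longrightarrow> idt L (src L f) \<oplus>\<^bsub>Mor L\<^esub> ap f = f"
  by (simp add: arrow_part_def Mor.minus_eq Mor.a_ac Mor.r_neg1 Mor.r_neg2 Mor.r_neg)

lemma tgt_decomp: "f \<in> carrier (Mor L) \<Longrightarrow> tgt L f = src L f \<oplus>\<^bsub>Ob L\<^esub> tgt L (ap f)"
  using arg_cong[OF mor_decomp, of f "tgt L"] by simp

lemma mor_eqI:
  "\<lbrakk>f \<in> carrier (Mor L); g \<in> carrier (Mor L); src L f = src L g; ap f = ap g\<rbrakk> \<Longrightarrow> f = g"
  by (metis mor_decomp)

text \<open>The interchange of composition and addition makes composition the addition of arrow parts.\<close>

lemma vcomp_eq:
  assumes "f \<in> carrier (Mor L)" "g \<in> carrier (Mor L)" "tgt L f = src L g"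
  shows "f \<star> g = f \<oplus>\<^bsub>Mor L\<^esub> ap g"
proof -
  \<comment> \<open>Write f as f + i(0) and g as i(t f) + \<open>ap g\<close>. Interchange splits
    the composite into f followed by an identity and an identity followed by
    \<open>ap g\<close>.\<close>
  have "(f \<oplus>\<^bsub>Mor L\<^esub> idt L \<zero>\<^bsub>Ob L\<^esub>) \<star> (idt L (tgt L f) \<oplus>\<^bsub>Mor L\<^esub> ap g) =
      (f \<star> idt L (tgt L f)) \<oplus>\<^bsub>Mor L\<^esub> (idt L (src L (ap g)) \<star> ap g)"
    using assms by (subst vcomp_add) simp_all
  then show ?thesis
    using assms vcomp_idt[of f] idt_vcomp[of "ap g"] mor_decomp[of g] by simp
qed

lemma ap_vcomp [simp]:
  "\<lbrakk>f \<in> carrier (Mor L); g \<in> carrier (Mor L); tgt L f = src L g\<rbrakk>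
    \<Longrightarrow> ap (f \<star> g) = ap f \<oplus>\<^bsub>Mor L\<^esub> ap g"
  by (simp add: vcomp_eq ap_ker)

text \<open>The inverse starts at the target and has the negated arrow part. This supplies the
  inverses of the Jacobiators of the coded algebra.\<close>

lemma vinvertible_mor:
  assumes f: "f \<in> carrier (Mor L)"
  shows "vinvertible L f"
proof -
  let ?g = "idt L (tgt L f) \<oplus>\<^bsub>Mor L\<^esub> (\<ominus>\<^bsub>Mor L\<^esub> ap f)"
  have t: "tgt L ?g = src L f"
    using f tgt_decomp[OF f] by (simp add: Ob.a_assoc Ob.r_neg)
  have "f \<star> ?g = idt L (src L f)" "?g \<star> f = idt L (tgt L f)"
    by (rule mor_eqI; use f t in \<open>simp add: ap_ker Mor.r_neg Mor.l_neg\<close>)+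
  then show ?thesis
    unfolding vinvertible_def using f t by (intro conjI bexI[of _ ?g]) simp_all
qed

text \<open>By interchange b(f,g) is b(f,1) followed by b(1,g), and also b(1,g) followed by b(f,1),
  with the identities fixed by composability. Since b of two identities is an identity, whiskering
  commutes with taking arrow parts, and each factorization gives one formula.\<close>

lemma ap_bilinear_functor:
  assumes b: "bilinear_functor R L b0 b1" and fg: "f \<in> carrier (Mor L)" "g \<in> carrier (Mor L)"
  shows "ap (b1 f g) = b1 (idt L (tgt L f)) (ap g) \<oplus>\<^bsub>Mor L\<^esub> b1 (ap f) (idt L (src L g))"
    and "ap (b1 f g) = b1 (idt L (src L f)) (ap g) \<oplus>\<^bsub>Mor L\<^esub> b1 (ap f) (idt L (tgt L g))"
proof -
  interpret b0: bilinmap R "Ob L" "Ob L" "Ob L" b0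
    using b by unfold_locales (simp add: bilinear_functor_def)
  interpret b1: bilinmap R "Mor L" "Mor L" "Mor L" b1
    using b by unfold_locales (simp add: bilinear_functor_def)
  have st [simp]: "src L (b1 f g) = b0 (src L f) (src L g)" "tgt L (b1 f g) = b0 (tgt L f) (tgt L g)"
    if "f \<in> carrier (Mor L)" "g \<in> carrier (Mor L)" for f g
    using b that by (simp_all add: bilinear_functor_def)
  have idt: "b1 (idt L x) (idt L y) = idt L (b0 x y)" if "x \<in> carrier (Ob L)" "y \<in> carrier (Ob L)" for x y
    using b that by (simp add: bilinear_functor_def)
  have vcomp: "b1 (f \<star> f') (g \<star> g') = b1 f g \<star> b1 f' g'"
    if "f \<in> carrier (Mor L)" "g \<in> carrier (Mor L)" "f' \<in> carrier (Mor L)" "g' \<in> carrier (Mor L)"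
      "tgt L f = src L f'" "tgt L g = src L g'" for f f' g g'
    using b that by (simp add: bilinear_functor_def)
  have left: "ap (b1 f (idt L y)) = b1 (ap f) (idt L y)"
    if "f \<in> carrier (Mor L)" "y \<in> carrier (Ob L)" for f y
  proof -
    have "b1 f (idt L y) = b1 (idt L (src L f) \<oplus>\<^bsub>Mor L\<^esub> ap f) (idt L y)"
      using that by (simp only: mor_decomp)
    then show ?thesis using that by (simp add: idt ap_ker)
  qed
  have right: "ap (b1 (idt L x) g) = b1 (idt L x) (ap g)"
    if "g \<in> carrier (Mor L)" "x \<in> carrier (Ob L)" for g x
  proof -
    have "b1 (idt L x) g = b1 (idt L x) (idt L (src L g) \<oplus>\<^bsub>Mor L\<^esub> ap g)"
      using that by (simp only: mor_decomp)
    then show ?thesis using that by (simp add: idt ap_ker)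
  qed
  have "b1 f g = b1 f (idt L (src L g)) \<star> b1 (idt L (tgt L f)) g"
    using fg vcomp[of f "idt L (src L g)" "idt L (tgt L f)" g] by (simp add: vcomp_idt idt_vcomp)
  then show "ap (b1 f g) = b1 (idt L (tgt L f)) (ap g) \<oplus>\<^bsub>Mor L\<^esub> b1 (ap f) (idt L (src L g))"
    using fg by (simp add: left right Mor.a_ac)
  have "b1 f g = b1 (idt L (src L f)) g \<star> b1 f (idt L (tgt L g))"
    using fg vcomp[of "idt L (src L f)" g f "idt L (tgt L g)"] by (simp add: vcomp_idt idt_vcomp)
  then show "ap (b1 f g) = b1 (idt L (src L f)) (ap g) \<oplus>\<^bsub>Mor L\<^esub> b1 (ap f) (idt L (tgt L g))"
    using fg by (simp add: left right Mor.a_ac)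
qed

abbreviation ker where "ker \<equiv> src_kernel L"

lemma ker_simps [simp]:
  "m \<in> carrier ker \<longleftrightarrow> m \<in> carrier (Mor L) \<and> src L m = \<zero>\<^bsub>Ob L\<^esub>"
  "m \<oplus>\<^bsub>ker\<^esub> n = m \<oplus>\<^bsub>Mor L\<^esub> n" "\<zero>\<^bsub>ker\<^esub> = \<zero>\<^bsub>Mor L\<^esub>" "a \<odot>\<^bsub>ker\<^esub> m = a \<odot>\<^bsub>Mor L\<^esub> m"
  by (simp_all add: src_kernel_def)

lemma ker_module: "module R ker"
proof (rule moduleI)
  show "abelian_group ker"
  proof (rule abelian_groupI)
    fix m assume "m \<in> carrier ker"
    then show "\<exists>n \<in> carrier ker. n \<oplus>\<^bsub>ker\<^esub> m = \<zero>\<^bsub>ker\<^esub>"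
      by (intro bexI[of _ "\<ominus>\<^bsub>Mor L\<^esub> m"]) (simp_all add: Mor.l_neg)
  qed (auto simp: Mor.a_ac)
qed (auto simp: Mor.smult_l_distr Mor.smult_r_distr Mor.smult_assoc1 intro: Mor_module[unfolded module_def, THEN conjunct1])

sublocale ker: module R ker by (rule ker_module)

text \<open>Additive inverses are defined by a description over the carrier, so they do not carry
  over to the smaller carrier by mere unfolding.\<close>

lemma ker_neg [simp]: "m \<in> carrier ker \<Longrightarrow> \<ominus>\<^bsub>ker\<^esub> m = \<ominus>\<^bsub>Mor L\<^esub> m"
  by (rule ker.minus_equality) (simp_all add: Mor.l_neg)

end

lemma linear_functor_arrow_part:
  assumes "two_vector_space R L" "two_vector_space R L'" "linear_functor R L L' F0 F1"
    and "f \<in> carrier (Mor L)"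
  shows "arrow_part L' (F1 f) = F1 (arrow_part L f)"
proof -
  interpret L: two_vector_space R L by fact
  interpret L': two_vector_space R L' by fact
  interpret F1: linmap R "Mor L" "Mor L'" F1
    using assms(3) by unfold_locales (simp add: linear_functor_def)
  show ?thesis
    using assms(3,4) unfolding linear_functor_def by (simp add: arrow_part_def)
qed

definition hl_of :: "('k, 'u) hom_lie2 \<Rightarrow> ('k, 'u) hl_alg" where
  "hl_of L =
    \<lparr>V0 = Ob L, V1 = src_kernel L, diff = tgt L,
     l00 = br0 L, l01 = (\<lambda>x m. br1 L (idt L x) m), l10 = (\<lambda>m x. br1 L m (idt L x)),
     l3 = (\<lambda>x y z. arrow_part L (jac L x y z)), phi0 = Phi0 L, phi1 = Phi1 L\<rparr>"

lemma hl_of_simps [simp]: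
  "V0 (hl_of L) = Ob L" "V1 (hl_of L) = src_kernel L" "diff (hl_of L) = tgt L"
  "l00 (hl_of L) = br0 L" "l01 (hl_of L) x m = br1 L (idt L x) m"
  "l10 (hl_of L) m x = br1 L m (idt L x)" "l3 (hl_of L) x y z = arrow_part L (jac L x y z)"
  "phi0 (hl_of L) = Phi0 L" "phi1 (hl_of L) = Phi1 L"
  by (simp_all add: hl_of_def)

section \<open>Bracket and Jacobiator on the kernel of the source map\<close>

context hom_lie_2_algebra
begin

sublocale bo: bilinmap R "Ob L" "Ob L" "Ob L" "br0 L"
  using br_functor by unfold_locales (simp add: bilinear_functor_def)
sublocale bm: bilinmap R "Mor L" "Mor L" "Mor L" "br1 L"
  using br_functor by unfold_locales (simp add: bilinear_functor_def)
sublocale Ph0: linmap R "Ob L" "Ob L" \<Phi>\<^sub>0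
  using Phi_functor by unfold_locales (simp add: linear_functor_def)
sublocale Ph1: linmap R "Mor L" "Mor L" \<Phi>\<^sub>1
  using Phi_functor by unfold_locales (simp add: linear_functor_def)
sublocale Jc: trilinmap R "Ob L" "Mor L" J
  by unfold_locales (rule jac_trilinear)

declare src_jac [simp] tgt_jac [simp] Phi0_br [simp] Phi1_br [simp]

lemma Phi1_simps [simp]:
  "f \<in> L1 \<Longrightarrow> src L (\<Phi>\<^sub>1 f) = \<Phi>\<^sub>0 (src L f)"
  "f \<in> L1 \<Longrightarrow> tgt L (\<Phi>\<^sub>1 f) = \<Phi>\<^sub>0 (tgt L f)"
  "x \<in> L0 \<Longrightarrow> \<Phi>\<^sub>1 (\<iota> x) = \<iota> (\<Phi>\<^sub>0 x)"
  "f \<in> L1 \<Longrightarrow> ap (\<Phi>\<^sub>1 f) = \<Phi>\<^sub>1 (ap f)"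
  using Phi_functor
    linear_functor_arrow_part[OF two_vector_space_axioms two_vector_space_axioms Phi_functor]
  by (simp_all add: linear_functor_def)

lemma br1_simps [simp]:
  "\<lbrakk>f \<in> L1; g \<in> L1\<rbrakk> \<Longrightarrow> src L \<llangle>f, g\<rrangle> = \<langle>src L f, src L g\<rangle>"
  "\<lbrakk>f \<in> L1; g \<in> L1\<rbrakk> \<Longrightarrow> tgt L \<llangle>f, g\<rrangle> = \<langle>tgt L f, tgt L g\<rangle>"
  "\<lbrakk>x \<in> L0; y \<in> L0\<rbrakk> \<Longrightarrow> \<llangle>\<iota> x, \<iota> y\<rrangle> = \<iota> \<langle>x, y\<rangle>"
  using br_functor by (simp_all add: bilinear_functor_def)

lemma ap_br1 [simp]:
  "\<lbrakk>f \<in> L1; g \<in> L1\<rbrakk> \<Longrightarrow> ap \<llangle>f, g\<rrangle> = \<llangle>\<iota> (tgt L f), ap g\<rrangle> +\<^sub>1 \<llangle>ap f, \<iota> (src L g)\<rrangle>"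
  by (rule ap_bilinear_functor(1)[OF br_functor])

lemma br0_swap: "\<lbrakk>x \<in> L0; y \<in> L0\<rbrakk> \<Longrightarrow> \<langle>x, y\<rangle> = \<ominus>\<^bsub>Ob L\<^esub> \<langle>y, x\<rangle>"
  using br0_skew unfolding skew2_def by blast

lemma br1_swap: "\<lbrakk>f \<in> L1; g \<in> L1\<rbrakk> \<Longrightarrow> \<llangle>f, g\<rrangle> = \<ominus>\<^bsub>Mor L\<^esub> \<llangle>g, f\<rrangle>"
  using br1_skew unfolding skew2_def by blast

lemma tgt_ap: "f \<in> L1 \<Longrightarrow> tgt L (ap f) = tgt L f \<ominus>\<^bsub>Ob L\<^esub> src L f"
  by (simp add: arrow_part_def)

text \<open>For arrows out of 0 each of the two factorizations of their bracket keeps a single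
  summand; comparing the two gives axiom (e).\<close>

lemma br_ker:
  assumes "m \<in> L1" "n \<in> L1" "src L m = \<zero>\<^bsub>Ob L\<^esub>" "src L n = \<zero>\<^bsub>Ob L\<^esub>"
  shows "\<llangle>\<iota> (tgt L m), n\<rrangle> = \<llangle>m, \<iota> (tgt L n)\<rrangle>"
  using assms ap_bilinear_functor[OF br_functor, of m n] by (simp add: ap_ker)

text \<open>Naturality of the Jacobiator at two identities and an arrow m out of 0. On the source
  side J(x,y,0) = 0 contributes nothing. Up to skew-symmetry this is axiom (i).\<close>

lemma ap_jac_tgt:
  assumes "x \<in> L0" "y \<in> L0" "m \<in> L1" "src L m = \<zero>\<^bsub>Ob L\<^esub>"
  shows "\<llangle>\<iota> \<langle>x, y\<rangle>, \<Phi>\<^sub>1 m\<rrangle> +\<^sub>1 ap (J x y (tgt L m)) =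
    \<llangle>\<iota> (\<Phi>\<^sub>0 x), \<llangle>\<iota> y, m\<rrangle>\<rrangle> +\<^sub>1 \<llangle>\<llangle>\<iota> x, m\<rrangle>, \<iota> (\<Phi>\<^sub>0 y)\<rrangle>"
  using arg_cong[OF jac_natural[of "\<iota> x" "\<iota> y" m], of ap] assms
  by (simp add: ap_ker[of m])

text \<open>Composites become sums and the identities padding the pasting diagram vanish.
  Commutativity in \<open>Ob\<close> is needed as well, for the composability conditions of
  \<open>ap_vcomp\<close>.\<close>

lemma ap_jacobiator_identity:
  assumes "w \<in> L0" "x \<in> L0" "y \<in> L0" "z \<in> L0"
  shows "ap (J \<langle>w, x\<rangle> (\<Phi>\<^sub>0 y) (\<Phi>\<^sub>0 z)) +\<^sub>1 \<llangle>ap (J w x z), \<iota> (\<Phi>\<^sub>0 (\<Phi>\<^sub>0 y))\<rrangle>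
      +\<^sub>1 ap (J (\<Phi>\<^sub>0 w) \<langle>x, z\<rangle> (\<Phi>\<^sub>0 y)) +\<^sub>1 ap (J \<langle>w, z\<rangle> (\<Phi>\<^sub>0 x) (\<Phi>\<^sub>0 y)) =
    \<llangle>ap (J w x y), \<iota> (\<Phi>\<^sub>0 (\<Phi>\<^sub>0 z))\<rrangle> +\<^sub>1 ap (J \<langle>w, y\<rangle> (\<Phi>\<^sub>0 x) (\<Phi>\<^sub>0 z))
      +\<^sub>1 ap (J (\<Phi>\<^sub>0 w) \<langle>x, y\<rangle> (\<Phi>\<^sub>0 z)) +\<^sub>1 \<llangle>\<iota> (\<Phi>\<^sub>0 (\<Phi>\<^sub>0 w)), ap (J x y z)\<rrangle>
      +\<^sub>1 \<llangle>ap (J w y z), \<iota> (\<Phi>\<^sub>0 (\<Phi>\<^sub>0 x))\<rrangle> +\<^sub>1 ap (J (\<Phi>\<^sub>0 w) \<langle>y, z\<rangle> (\<Phi>\<^sub>0 x))"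
  using arg_cong[OF jacobiator_identity[OF assms], of ap] assms
  by (simp add: Ob.a_ac Mor.a_ac)

lemma hl_algebra_hl_of: "hl_algebra R (hl_of L)"
proof (rule hl_algebra.intro)
  show "module R (V0 (hl_of L))" "module R (V1 (hl_of L))"
    using Ob_module ker_module by simp_all
  show "diff (hl_of L) \<in> linear_maps R (V1 (hl_of L)) (V0 (hl_of L))"
    by (rule linear_mapsI) simp_all
  show "l00 (hl_of L) \<in> bilinear_maps R (V0 (hl_of L)) (V0 (hl_of L)) (V0 (hl_of L))"
    by (rule bilinear_mapsI) simp_all
  show "l01 (hl_of L) \<in> bilinear_maps R (V0 (hl_of L)) (V1 (hl_of L)) (V1 (hl_of L))"
    by (rule bilinear_mapsI) simp_all
  show "l10 (hl_of L) \<in> bilinear_maps R (V1 (hl_of L)) (V0 (hl_of L)) (V1 (hl_of L))"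
    by (rule bilinear_mapsI) simp_all
  show "phi0 (hl_of L) \<in> linear_maps R (V0 (hl_of L)) (V0 (hl_of L))"
    by (rule linear_mapsI) simp_all
  show "phi1 (hl_of L) \<in> linear_maps R (V1 (hl_of L)) (V1 (hl_of L))"
    by (rule linear_mapsI) simp_all
  show "l3 (hl_of L) \<in> trilinear_maps R (V0 (hl_of L)) (V1 (hl_of L))"
    by (rule trilinear_mapsI) simp_all
  show "skew3 (V0 (hl_of L)) (V1 (hl_of L)) (l3 (hl_of L))"
    unfolding skew3_def
  proof (intro ballI)
    fix x y z
    assume "x \<in> carrier (V0 (hl_of L))" "y \<in> carrier (V0 (hl_of L))" "z \<in> carrier (V0 (hl_of L))"
    then have xyz: "x \<in> L0" "y \<in> L0" "z \<in> L0" by simp_all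
    then have "ap (J x y z) = \<ominus>\<^bsub>Mor L\<^esub> ap (J y x z)" "ap (J x y z) = \<ominus>\<^bsub>Mor L\<^esub> ap (J x z y)"
      using jac_skew unfolding skew3_def by blast+
    then show "l3 (hl_of L) x y z = \<ominus>\<^bsub>V1 (hl_of L)\<^esub> l3 (hl_of L) y x z \<and>
        l3 (hl_of L) x y z = \<ominus>\<^bsub>V1 (hl_of L)\<^esub> l3 (hl_of L) x z y"
      using xyz by simp
  qed
next
  fix x y z
  assume "x \<in> carrier (V0 (hl_of L))" "y \<in> carrier (V0 (hl_of L))" "z \<in> carrier (V0 (hl_of L))"
  then have xyz: "x \<in> L0" "y \<in> L0" "z \<in> L0" by simp_all
  \<comment> \<open>The target minus the source of J is matched with the cyclic sum in (h): two
    swaps identify the middle term, one swap produces the negative of the source.\<close>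
  have "\<langle>\<Phi>\<^sub>0 y, \<langle>z, x\<rangle>\<rangle> = \<langle>\<langle>x, z\<rangle>, \<Phi>\<^sub>0 y\<rangle>"
    using br0_swap[of "\<Phi>\<^sub>0 y" "\<langle>z, x\<rangle>"] br0_swap[of z x] xyz by simp
  moreover have "\<langle>\<Phi>\<^sub>0 z, \<langle>x, y\<rangle>\<rangle> = \<ominus>\<^bsub>Ob L\<^esub> \<langle>\<langle>x, y\<rangle>, \<Phi>\<^sub>0 z\<rangle>"
    using br0_swap[of "\<Phi>\<^sub>0 z" "\<langle>x, y\<rangle>"] xyz by simp
  ultimately show "diff (hl_of L) (l3 (hl_of L) x y z) =
      l00 (hl_of L) (phi0 (hl_of L) x) (l00 (hl_of L) y z)
      \<oplus>\<^bsub>V0 (hl_of L)\<^esub> l00 (hl_of L) (phi0 (hl_of L) y) (l00 (hl_of L) z x)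
      \<oplus>\<^bsub>V0 (hl_of L)\<^esub> l00 (hl_of L) (phi0 (hl_of L) z) (l00 (hl_of L) x y)"
    using xyz by (simp add: tgt_ap Ob.minus_eq)
next
  fix x y m
  assume "x \<in> carrier (V0 (hl_of L))" "y \<in> carrier (V0 (hl_of L))" "m \<in> carrier (V1 (hl_of L))"
  then have xym: "x \<in> L0" "y \<in> L0" "m \<in> L1" "src L m = \<zero>\<^bsub>Ob L\<^esub>" by simp_all
  \<comment> \<open>The same swaps, now for a bracket containing the arrow m, turn
    \<open>ap_jac_tgt\<close> into the cyclic form (i).\<close>
  have "\<llangle>\<iota> (\<Phi>\<^sub>0 y), \<llangle>m, \<iota> x\<rrangle>\<rrangle> = \<llangle>\<llangle>\<iota> x, m\<rrangle>, \<iota> (\<Phi>\<^sub>0 y)\<rrangle>"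
    using br1_swap[of "\<iota> (\<Phi>\<^sub>0 y)" "\<llangle>m, \<iota> x\<rrangle>"] br1_swap[of m "\<iota> x"] xym by simp
  moreover have "\<llangle>\<Phi>\<^sub>1 m, \<iota> \<langle>x, y\<rangle>\<rrangle> = \<ominus>\<^bsub>Mor L\<^esub> \<llangle>\<iota> \<langle>x, y\<rangle>, \<Phi>\<^sub>1 m\<rrangle>"
    using br1_swap[of "\<Phi>\<^sub>1 m" "\<iota> \<langle>x, y\<rangle>"] xym by simp
  ultimately show "l3 (hl_of L) x y (diff (hl_of L) m) =
      l01 (hl_of L) (phi0 (hl_of L) x) (l01 (hl_of L) y m)
      \<oplus>\<^bsub>V1 (hl_of L)\<^esub> l01 (hl_of L) (phi0 (hl_of L) y) (l10 (hl_of L) m x)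
      \<oplus>\<^bsub>V1 (hl_of L)\<^esub> l10 (hl_of L) (phi1 (hl_of L) m) (l00 (hl_of L) x y)"
    using xym ap_jac_tgt[OF xym, symmetric] by (simp add: Mor.r_neg1 Mor.r_neg2 Mor.a_ac Mor.r_neg)
next
  fix x m
  assume "x \<in> carrier (V0 (hl_of L))" "m \<in> carrier (V1 (hl_of L))"
  then show "l01 (hl_of L) x m = \<ominus>\<^bsub>V1 (hl_of L)\<^esub> l10 (hl_of L) m x"
    using br1_swap[of "\<iota> x" m] by simp
next
  fix x y
  assume "x \<in> carrier (V0 (hl_of L))" "y \<in> carrier (V0 (hl_of L))"
  then show "l00 (hl_of L) x y = \<ominus>\<^bsub>V0 (hl_of L)\<^esub> l00 (hl_of L) y x"
    using br0_swap[of x y] by simp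
next
  fix x y z
  assume "x \<in> carrier (V0 (hl_of L))" "y \<in> carrier (V0 (hl_of L))" "z \<in> carrier (V0 (hl_of L))"
  then show "l3 (hl_of L) (phi0 (hl_of L) x) (phi0 (hl_of L) y) (phi0 (hl_of L) z) =
      phi1 (hl_of L) (l3 (hl_of L) x y z)"
    by (simp add: jac_Phi)
qed (simp_all add: ground_field br_ker ap_jacobiator_identity)

end

section \<open>The bijection on morphisms\<close>

text \<open>The restriction of \<open>map1\<close> makes the triple extensional for the smaller
  carrier. Passing to the arrow part of F_2 loses nothing, because the source [F_0 x, F_0 y] is
  prescribed.\<close>

definition hl_mor_of :: "('k, 'u) hom_lie2 \<Rightarrow> ('k, 'u) hom_lie2 \<Rightarrow> 'u mor2 \<Rightarrow> 'u mor2" where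
  "hl_mor_of L L' F =
    \<lparr>map0 = map0 F,
     map1 = (\<lambda>m \<in> carrier (src_kernel L). map1 F m),
     map2 = (\<lambda>x \<in> carrier (Ob L). \<lambda>y \<in> carrier (Ob L). arrow_part L' (map2 F x y))\<rparr>"

definition hom_lie_mor_of :: "('k, 'u) hom_lie2 \<Rightarrow> ('k, 'u) hom_lie2 \<Rightarrow> 'u mor2 \<Rightarrow> 'u mor2" where
  "hom_lie_mor_of L L' f =
    \<lparr>map0 = map0 f,
     map1 = (\<lambda>g \<in> carrier (Mor L).
       idt L' (map0 f (src L g)) \<oplus>\<^bsub>Mor L'\<^esub> map1 f (arrow_part L g)),
     map2 = (\<lambda>x \<in> carrier (Ob L). \<lambda>y \<in> carrier (Ob L).
       idt L' \<langle>map0 f x, map0 f y\<rangle>\<^bsub>L'\<^esub> \<oplus>\<^bsub>Mor L'\<^esub> map2 f x y)\<rparr>"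

locale hom_lie_mor = L: hom_lie_2_algebra R L + L': hom_lie_2_algebra R L' +
    hom_lie_2_morphism R L L' F
  for R :: "('k, 'r) ring_scheme" and L L' :: "('k, 'u) hom_lie2" and F :: "'u mor2"
begin

sublocale F0: linmap R "Ob L" "Ob L'" "map0 F"
  using underlying_functor by unfold_locales (simp add: linear_functor_def)
sublocale F1: linmap R "Mor L" "Mor L'" "map1 F"
  using underlying_functor by unfold_locales (simp add: linear_functor_def)
sublocale F2: bilinmap R "Ob L" "Ob L" "Mor L'" "map2 F"
  by unfold_locales (rule map2_bilinear)

declare src_map2 [simp] tgt_map2 [simp] Phi0_map0 [simp] Phi1_map1 [simp]

lemma map1_simps [simp]:
  "f \<in> carrier (Mor L) \<Longrightarrow> src L' (map1 F f) = map0 F (src L f)"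
  "f \<in> carrier (Mor L) \<Longrightarrow> tgt L' (map1 F f) = map0 F (tgt L f)"
  "x \<in> carrier (Ob L) \<Longrightarrow> map1 F (idt L x) = idt L' (map0 F x)"
  "f \<in> carrier (Mor L) \<Longrightarrow> L'.ap (map1 F f) = map1 F (L.ap f)"
  using underlying_functor
    linear_functor_arrow_part[OF L.two_vector_space_axioms L'.two_vector_space_axioms underlying_functor]
  by (simp_all add: linear_functor_def)

text \<open>Naturality of F_2 at an identity and an arrow m out of 0, where F_2(x,0) = 0; this
  becomes the axiom \<open>map2_d\<close>.\<close>

lemma ap_map2_tgt:
  assumes "x \<in> carrier (Ob L)" "m \<in> carrier (Mor L)" "src L m = \<zero>\<^bsub>Ob L\<^esub>"
  shows "\<llangle>idt L' (map0 F x), map1 F m\<rrangle>\<^bsub>L'\<^esub> \<oplus>\<^bsub>Mor L'\<^esub> L'.ap (map2 F x (tgt L m)) =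
    map1 F \<llangle>idt L x, m\<rrangle>\<^bsub>L\<^esub>"
  using arg_cong[OF map2_natural[of "idt L x" m], of L'.ap] assms
  by (simp add: L.ap_ker[of m])

lemma ap_coherence:
  assumes "x \<in> carrier (Ob L)" "y \<in> carrier (Ob L)" "z \<in> carrier (Ob L)"
  shows "\<llangle>L'.ap (map2 F x y), idt L' (map0 F (Phi0 L z))\<rrangle>\<^bsub>L'\<^esub>
      \<oplus>\<^bsub>Mor L'\<^esub> L'.ap (map2 F \<langle>x, y\<rangle>\<^bsub>L\<^esub> (Phi0 L z))
      \<oplus>\<^bsub>Mor L'\<^esub> map1 F (L.ap (jac L x y z))
    = L'.ap (jac L' (map0 F x) (map0 F y) (map0 F z))
      \<oplus>\<^bsub>Mor L'\<^esub> \<llangle>idt L' (map0 F (Phi0 L x)), L'.ap (map2 F y z)\<rrangle>\<^bsub>L'\<^esub>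
      \<oplus>\<^bsub>Mor L'\<^esub> \<llangle>L'.ap (map2 F x z), idt L' (map0 F (Phi0 L y))\<rrangle>\<^bsub>L'\<^esub>
      \<oplus>\<^bsub>Mor L'\<^esub> L'.ap (map2 F (Phi0 L x) \<langle>y, z\<rangle>\<^bsub>L\<^esub>)
      \<oplus>\<^bsub>Mor L'\<^esub> L'.ap (map2 F \<langle>x, z\<rangle>\<^bsub>L\<^esub> (Phi0 L y))"
  using arg_cong[OF coherence[OF assms], of L'.ap] assms
  by (simp add: L'.Ob.a_ac L'.Mor.a_ac)

lemma ap_map2_swap:
  "\<lbrakk>x \<in> carrier (Ob L); y \<in> carrier (Ob L)\<rbrakk>
    \<Longrightarrow> L'.ap (map2 F x y) = \<ominus>\<^bsub>Mor L'\<^esub> L'.ap (map2 F y x)"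
  using map2_skew L'.apl.neg[of "map2 F y x"] F2.closed[of y x] unfolding skew2_def by metis

lemma hl_morphism_hl_mor_of: "hl_morphism R (hl_of L) (hl_of L') (hl_mor_of L L' F)"
proof (rule hl_morphism.intro)
  show "extensional_mor2 (carrier (V0 (hl_of L))) (carrier (V1 (hl_of L))) (hl_mor_of L L' F)"
    using mor2_extensional by (simp add: extensional_mor2_def hl_mor_of_def)
  show "map0 (hl_mor_of L L' F) \<in> linear_maps R (V0 (hl_of L)) (V0 (hl_of L'))"
    by (rule linear_mapsI) (simp_all add: hl_mor_of_def)
  show "map1 (hl_mor_of L L' F) \<in> linear_maps R (V1 (hl_of L)) (V1 (hl_of L'))"
    by (rule linear_mapsI) (simp_all add: hl_mor_of_def)
  show "map2 (hl_mor_of L L' F) \<in> bilinear_maps R (V0 (hl_of L)) (V0 (hl_of L)) (V1 (hl_of L'))"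
    by (rule bilinear_mapsI) (simp_all add: hl_mor_of_def)
  show "skew2 (V0 (hl_of L)) (V1 (hl_of L')) (map2 (hl_mor_of L L' F))"
    unfolding skew2_def
  proof (intro ballI)
    fix x y assume "x \<in> carrier (V0 (hl_of L))" "y \<in> carrier (V0 (hl_of L))"
    then show "map2 (hl_mor_of L L' F) x y = \<ominus>\<^bsub>V1 (hl_of L')\<^esub> map2 (hl_mor_of L L' F) y x"
      using ap_map2_swap[of x y] by (simp add: hl_mor_of_def)
  qed
next
  fix x m assume "x \<in> carrier (V0 (hl_of L))" "m \<in> carrier (V1 (hl_of L))"
  then show "map2 (hl_mor_of L L' F) x (diff (hl_of L) m) =
      map1 (hl_mor_of L L' F) (l01 (hl_of L) x m) \<ominus>\<^bsub>V1 (hl_of L')\<^esub>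
      l01 (hl_of L') (map0 (hl_mor_of L L' F) x) (map1 (hl_mor_of L L' F) m)"
    using ap_map2_tgt[of x m, symmetric]
    by (simp add: hl_mor_of_def L'.ker.eq_diff_iff) (simp add: L'.Ob.a_ac L'.Mor.a_ac)
next
  fix x y assume "x \<in> carrier (V0 (hl_of L))" "y \<in> carrier (V0 (hl_of L))"
  then show "map2 (hl_mor_of L L' F) (phi0 (hl_of L) x) (phi0 (hl_of L) y) =
      phi1 (hl_of L') (map2 (hl_mor_of L L' F) x y)"
    by (simp add: hl_mor_of_def map2_Phi)
qed (simp_all add: hl_mor_of_def L'.tgt_ap ap_coherence)

end

locale hl_mor_hom_lie = L: hom_lie_2_algebra R L + L': hom_lie_2_algebra R L' +
    hl_morphism R "hl_of L" "hl_of L'" f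
  for R :: "('k, 'r) ring_scheme" and L L' :: "('k, 'u) hom_lie2" and f :: "'u mor2"
begin

interpretation hl_mor R "hl_of L" "hl_of L'" f
  by (intro hl_mor.intro L.hl_algebra_hl_of L'.hl_algebra_hl_of hl_morphism_axioms)

text \<open>Here and in the next two lemmas the facts about \<open>f\<close> are restated over
  \<open>Ob\<close> and \<open>Mor\<close>, the form into which \<open>hl_of_simps\<close> and
  \<open>ker_simps\<close> rewrite goals.\<close>

lemma map0_simps [simp]:
  "x \<in> carrier (Ob L) \<Longrightarrow> map0 f x \<in> carrier (Ob L')"
  "\<lbrakk>x \<in> carrier (Ob L); y \<in> carrier (Ob L)\<rbrakk>
    \<Longrightarrow> map0 f (x \<oplus>\<^bsub>Ob L\<^esub> y) = map0 f x \<oplus>\<^bsub>Ob L'\<^esub> map0 f y"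
  "\<lbrakk>a \<in> carrier R; x \<in> carrier (Ob L)\<rbrakk> \<Longrightarrow> map0 f (a \<odot>\<^bsub>Ob L\<^esub> x) = a \<odot>\<^bsub>Ob L'\<^esub> map0 f x"
  "map0 f \<zero>\<^bsub>Ob L\<^esub> = \<zero>\<^bsub>Ob L'\<^esub>"
  using f0.closed f0.add f0.smult f0.zero by simp_all

lemma map1_simps [simp]:
  "\<lbrakk>m \<in> carrier (Mor L); src L m = \<zero>\<^bsub>Ob L\<^esub>\<rbrakk> \<Longrightarrow> map1 f m \<in> carrier (Mor L')"
  "\<lbrakk>m \<in> carrier (Mor L); src L m = \<zero>\<^bsub>Ob L\<^esub>\<rbrakk> \<Longrightarrow> src L' (map1 f m) = \<zero>\<^bsub>Ob L'\<^esub>"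
  "\<lbrakk>m \<in> carrier (Mor L); src L m = \<zero>\<^bsub>Ob L\<^esub>\<rbrakk> \<Longrightarrow> tgt L' (map1 f m) = map0 f (tgt L m)"
  "\<lbrakk>m \<in> carrier (Mor L); src L m = \<zero>\<^bsub>Ob L\<^esub>; n \<in> carrier (Mor L); src L n = \<zero>\<^bsub>Ob L\<^esub>\<rbrakk>
    \<Longrightarrow> map1 f (m \<oplus>\<^bsub>Mor L\<^esub> n) = map1 f m \<oplus>\<^bsub>Mor L'\<^esub> map1 f n"
  "\<lbrakk>a \<in> carrier R; m \<in> carrier (Mor L); src L m = \<zero>\<^bsub>Ob L\<^esub>\<rbrakk>
    \<Longrightarrow> map1 f (a \<odot>\<^bsub>Mor L\<^esub> m) = a \<odot>\<^bsub>Mor L'\<^esub> map1 f m"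
  "map1 f \<zero>\<^bsub>Mor L\<^esub> = \<zero>\<^bsub>Mor L'\<^esub>"
  using f1.closed f1.add f1.smult f1.zero map0_d by simp_all

lemma map2_simps [simp]:
  "\<lbrakk>x \<in> carrier (Ob L); y \<in> carrier (Ob L)\<rbrakk> \<Longrightarrow> map2 f x y \<in> carrier (Mor L')"
  "\<lbrakk>x \<in> carrier (Ob L); y \<in> carrier (Ob L)\<rbrakk> \<Longrightarrow> src L' (map2 f x y) = \<zero>\<^bsub>Ob L'\<^esub>"
  "\<lbrakk>x \<in> carrier (Ob L); y \<in> carrier (Ob L); z \<in> carrier (Ob L)\<rbrakk>
    \<Longrightarrow> map2 f (x \<oplus>\<^bsub>Ob L\<^esub> y) z = map2 f x z \<oplus>\<^bsub>Mor L'\<^esub> map2 f y z"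
  "\<lbrakk>x \<in> carrier (Ob L); y \<in> carrier (Ob L); z \<in> carrier (Ob L)\<rbrakk>
    \<Longrightarrow> map2 f z (x \<oplus>\<^bsub>Ob L\<^esub> y) = map2 f z x \<oplus>\<^bsub>Mor L'\<^esub> map2 f z y"
  "\<lbrakk>a \<in> carrier R; x \<in> carrier (Ob L); z \<in> carrier (Ob L)\<rbrakk>
    \<Longrightarrow> map2 f (a \<odot>\<^bsub>Ob L\<^esub> x) z = a \<odot>\<^bsub>Mor L'\<^esub> map2 f x z"
  "\<lbrakk>a \<in> carrier R; x \<in> carrier (Ob L); z \<in> carrier (Ob L)\<rbrakk>
    \<Longrightarrow> map2 f z (a \<odot>\<^bsub>Ob L\<^esub> x) = a \<odot>\<^bsub>Mor L'\<^esub> map2 f z x"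
  using f2.closed f2.add_left f2.add_right f2.smult_left f2.smult_right by simp_all

text \<open>The axiom \<open>d_map2\<close> read geometrically: the arrow starting at [f_0 x, f_0 y]
  with arrow part f_2(x,y) ends at f_0 [x,y].\<close>

lemma tgt_map2_add:
  assumes "x \<in> carrier (Ob L)" "y \<in> carrier (Ob L)"
  shows "\<langle>map0 f x, map0 f y\<rangle>\<^bsub>L'\<^esub> \<oplus>\<^bsub>Ob L'\<^esub> tgt L' (map2 f x y) = map0 f \<langle>x, y\<rangle>\<^bsub>L\<^esub>"
  using map0_l00[of x y] assms by (simp add: L'.Ob.a_ac)

lemma map0_tgt:
  "g \<in> carrier (Mor L)
    \<Longrightarrow> map0 f (tgt L g) = map0 f (src L g) \<oplus>\<^bsub>Ob L'\<^esub> map0 f (tgt L (L.ap g))"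
  using arg_cong[OF L.tgt_decomp[of g], of "map0 f"] by simp

abbreviation (input) F where "F \<equiv> hom_lie_mor_of L L' f"

lemma F_simps:
  "map0 F = map0 f"
  "g \<in> carrier (Mor L) \<Longrightarrow> map1 F g = idt L' (map0 f (src L g)) \<oplus>\<^bsub>Mor L'\<^esub> map1 f (L.ap g)"
  "\<lbrakk>x \<in> carrier (Ob L); y \<in> carrier (Ob L)\<rbrakk>
    \<Longrightarrow> map2 F x y = idt L' \<langle>map0 f x, map0 f y\<rangle>\<^bsub>L'\<^esub> \<oplus>\<^bsub>Mor L'\<^esub> map2 f x y"
  by (simp_all add: hom_lie_mor_of_def)

lemma F_arrow_simps:
  "g \<in> carrier (Mor L) \<Longrightarrow> map1 F g \<in> carrier (Mor L')"
  "g \<in> carrier (Mor L) \<Longrightarrow> src L' (map1 F g) = map0 f (src L g)"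
  "g \<in> carrier (Mor L) \<Longrightarrow> tgt L' (map1 F g) = map0 f (tgt L g)"
  "g \<in> carrier (Mor L) \<Longrightarrow> L'.ap (map1 F g) = map1 f (L.ap g)"
  "\<lbrakk>x \<in> carrier (Ob L); y \<in> carrier (Ob L)\<rbrakk> \<Longrightarrow> map2 F x y \<in> carrier (Mor L')"
  "\<lbrakk>x \<in> carrier (Ob L); y \<in> carrier (Ob L)\<rbrakk>
    \<Longrightarrow> src L' (map2 F x y) = \<langle>map0 f x, map0 f y\<rangle>\<^bsub>L'\<^esub>"
  "\<lbrakk>x \<in> carrier (Ob L); y \<in> carrier (Ob L)\<rbrakk> \<Longrightarrow> tgt L' (map2 F x y) = map0 f \<langle>x, y\<rangle>\<^bsub>L\<^esub>"
  "\<lbrakk>x \<in> carrier (Ob L); y \<in> carrier (Ob L)\<rbrakk> \<Longrightarrow> L'.ap (map2 F x y) = map2 f x y"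
  by (simp_all add: F_simps tgt_map2_add L'.ap_ker map0_tgt[of g])

lemma Phi_map_simps:
  "x \<in> carrier (Ob L) \<Longrightarrow> Phi0 L' (map0 f x) = map0 f (Phi0 L x)"
  "\<lbrakk>m \<in> carrier (Mor L); src L m = \<zero>\<^bsub>Ob L\<^esub>\<rbrakk> \<Longrightarrow> Phi1 L' (map1 f m) = map1 f (Phi1 L m)"
  "\<lbrakk>x \<in> carrier (Ob L); y \<in> carrier (Ob L)\<rbrakk>
    \<Longrightarrow> Phi1 L' (map2 f x y) = map2 f (Phi0 L x) (Phi0 L y)"
  using map0_phi0 map1_phi1 map2_phi by simp_all

lemma map1_br:
  "\<lbrakk>x \<in> carrier (Ob L); m \<in> carrier (Mor L); src L m = \<zero>\<^bsub>Ob L\<^esub>\<rbrakk> \<Longrightarrow>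
    map1 f \<llangle>idt L x, m\<rrangle>\<^bsub>L\<^esub> = map2 f x (tgt L m) \<oplus>\<^bsub>Mor L'\<^esub> \<llangle>idt L' (map0 f x), map1 f m\<rrangle>\<^bsub>L'\<^esub>"
  "\<lbrakk>x \<in> carrier (Ob L); m \<in> carrier (Mor L); src L m = \<zero>\<^bsub>Ob L\<^esub>\<rbrakk> \<Longrightarrow>
    map1 f \<llangle>m, idt L x\<rrangle>\<^bsub>L\<^esub> = map2 f (tgt L m) x \<oplus>\<^bsub>Mor L'\<^esub> \<llangle>map1 f m, idt L' (map0 f x)\<rrangle>\<^bsub>L'\<^esub>"
  using map1_l01[of x m] map1_l10[of x m] by simp_all

lemma hom_lie_2_morphism_hom_lie_mor_of: "hom_lie_2_morphism R L L' F"
proof (rule hom_lie_2_morphism.intro)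
  show "extensional_mor2 (carrier (Ob L)) (carrier (Mor L)) F"
    using mor2_extensional by (simp add: extensional_mor2_def hom_lie_mor_of_def)
  show "linear_functor R L L' (map0 F) (map1 F)"
    unfolding linear_functor_def
  proof (intro conjI ballI impI)
    show "map0 F \<in> linear_maps R (Ob L) (Ob L')"
      by (rule linear_mapsI) (simp_all add: F_simps)
    show "map1 F \<in> linear_maps R (Mor L) (Mor L')"
      by (rule linear_mapsI) (simp_all add: F_simps L'.Mor.a_ac L'.Mor.smult_r_distr)
    show "map1 F (g \<star>\<^bsub>L\<^esub> h) = map1 F g \<star>\<^bsub>L'\<^esub> map1 F h"
      if "g \<in> carrier (Mor L)" "h \<in> carrier (Mor L)" "tgt L g = src L h" for g h
      by (rule L'.mor_eqI) (use that in \<open>simp_all add: F_arrow_simps\<close>)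
  qed (simp_all add: F_arrow_simps F_simps(1), simp add: F_simps)
  show "map2 F \<in> bilinear_maps R (Ob L) (Ob L) (Mor L')"
    by (rule bilinear_mapsI) (simp_all add: F_simps L'.Mor.a_ac L'.Mor.smult_r_distr)
  show "skew2 (Ob L) (Mor L') (map2 F)"
    unfolding skew2_def
  proof (intro ballI)
    fix x y assume xy: "x \<in> carrier (Ob L)" "y \<in> carrier (Ob L)"
    then show "map2 F x y = \<ominus>\<^bsub>Mor L'\<^esub> map2 F y x"
      using L'.br0_swap[of "map0 f x" "map0 f y"] map2_neg_swap[of x y]
      by (simp add: F_simps L'.Mor.minus_add)
  qed
next
  fix g h assume gh: "g \<in> carrier (Mor L)" "h \<in> carrier (Mor L)"
  \<comment> \<open>The arguments move from source to target one after the other, in the order that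
    matches \<open>ap_br1\<close>, so that each increment is an instance of
    \<open>map1_br\<close>.\<close>
  have eq: "map2 f (tgt L g) (tgt L h) =
      map2 f (src L g) (src L h) \<oplus>\<^bsub>Mor L'\<^esub> map2 f (tgt L (L.ap g)) (src L h) \<oplus>\<^bsub>Mor L'\<^esub>
      map2 f (tgt L g) (tgt L (L.ap h))"
    using gh arg_cong[OF L.tgt_decomp[of h], of "map2 f (tgt L g)"]
      arg_cong[OF L.tgt_decomp[of g], of "\<lambda>u. map2 f u (src L h)"] by simp
  show "\<llangle>map1 F g, map1 F h\<rrangle>\<^bsub>L'\<^esub> \<star>\<^bsub>L'\<^esub> map2 F (tgt L g) (tgt L h) =
      map2 F (src L g) (src L h) \<star>\<^bsub>L'\<^esub> map1 F \<llangle>g, h\<rrangle>\<^bsub>L\<^esub>"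
    by (rule L'.mor_eqI) (use gh eq in \<open>simp_all add: F_arrow_simps map1_br L'.Mor.a_ac\<close>)
next
  fix x y z assume xyz: "x \<in> carrier (Ob L)" "y \<in> carrier (Ob L)" "z \<in> carrier (Ob L)"
  have eq: "\<llangle>map2 f x y, idt L' (map0 f (Phi0 L z))\<rrangle>\<^bsub>L'\<^esub>
      \<oplus>\<^bsub>Mor L'\<^esub> map2 f \<langle>x, y\<rangle>\<^bsub>L\<^esub> (Phi0 L z)
      \<oplus>\<^bsub>Mor L'\<^esub> map1 f (L.ap (jac L x y z))
    = L'.ap (jac L' (map0 f x) (map0 f y) (map0 f z))
      \<oplus>\<^bsub>Mor L'\<^esub> \<llangle>idt L' (map0 f (Phi0 L x)), map2 f y z\<rrangle>\<^bsub>L'\<^esub>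
      \<oplus>\<^bsub>Mor L'\<^esub> \<llangle>map2 f x z, idt L' (map0 f (Phi0 L y))\<rrangle>\<^bsub>L'\<^esub>
      \<oplus>\<^bsub>Mor L'\<^esub> map2 f (Phi0 L x) \<langle>y, z\<rangle>\<^bsub>L\<^esub>
      \<oplus>\<^bsub>Mor L'\<^esub> map2 f \<langle>x, z\<rangle>\<^bsub>L\<^esub> (Phi0 L y)"
    using coherence[of x y z] xyz by simp
  show "\<llangle>map2 F x y, idt L' (map0 F (Phi0 L z))\<rrangle>\<^bsub>L'\<^esub>
        \<star>\<^bsub>L'\<^esub> map2 F \<langle>x, y\<rangle>\<^bsub>L\<^esub> (Phi0 L z)
        \<star>\<^bsub>L'\<^esub> map1 F (jac L x y z)
      = jac L' (map0 F x) (map0 F y) (map0 F z)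
        \<star>\<^bsub>L'\<^esub> (\<llangle>idt L' (map0 F (Phi0 L x)), map2 F y z\<rrangle>\<^bsub>L'\<^esub> \<oplus>\<^bsub>Mor L'\<^esub>
               \<llangle>map2 F x z, idt L' (map0 F (Phi0 L y))\<rrangle>\<^bsub>L'\<^esub>)
        \<star>\<^bsub>L'\<^esub> (map2 F (Phi0 L x) \<langle>y, z\<rangle>\<^bsub>L\<^esub> \<oplus>\<^bsub>Mor L'\<^esub> map2 F \<langle>x, z\<rangle>\<^bsub>L\<^esub> (Phi0 L y))"
    by (rule L'.mor_eqI)
      (use xyz eq in \<open>simp_all add: F_arrow_simps F_simps(1) Phi_map_simps
        L'.Ob.a_ac L'.Mor.a_ac\<close>)
qed (simp_all add: F_arrow_simps, simp_all add: F_simps Phi_map_simps)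

end

lemma hom_lie_mor_of_hl_mor_of:
  assumes "hom_lie_mor R L L' F"
  shows "hom_lie_mor_of L L' (hl_mor_of L L' F) = F"
proof -
  interpret hom_lie_mor R L L' F by fact
  show ?thesis
  proof (rule mor2_eqI[OF _ mor2_extensional])
    show "extensional_mor2 (carrier (Ob L)) (carrier (Mor L)) (hom_lie_mor_of L L' (hl_mor_of L L' F))"
      using mor2_extensional by (simp add: extensional_mor2_def hom_lie_mor_of_def hl_mor_of_def)
  next
    fix g assume "g \<in> carrier (Mor L)"
    then show "map1 (hom_lie_mor_of L L' (hl_mor_of L L' F)) g = map1 F g"
      using L'.mor_decomp[of "map1 F g"] by (simp add: hom_lie_mor_of_def hl_mor_of_def)
  next
    fix x y assume "x \<in> carrier (Ob L)" "y \<in> carrier (Ob L)"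
    then show "map2 (hom_lie_mor_of L L' (hl_mor_of L L' F)) x y = map2 F x y"
      using L'.mor_decomp[of "map2 F x y"] by (simp add: hom_lie_mor_of_def hl_mor_of_def)
  qed (simp add: hom_lie_mor_of_def hl_mor_of_def)
qed

lemma hl_mor_of_hom_lie_mor_of:
  assumes "hl_mor_hom_lie R L L' f"
  shows "hl_mor_of L L' (hom_lie_mor_of L L' f) = f"
proof -
  interpret hl_mor_hom_lie R L L' f by fact
  show ?thesis
  proof (rule mor2_eqI[OF _ mor2_extensional])
    show "extensional_mor2 (carrier (V0 (hl_of L))) (carrier (V1 (hl_of L)))
        (hl_mor_of L L' (hom_lie_mor_of L L' f))"
      using mor2_extensional by (simp add: extensional_mor2_def hom_lie_mor_of_def hl_mor_of_def)
  qed (simp_all add: hl_mor_of_def F_simps L.ap_ker L'.ap_ker)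
qed

lemma hom_lie_2_ident_eq:
  assumes "hom_lie_2_algebra R L"
  shows "hom_lie_2_ident L = hom_lie_mor_of L L (hl_ident (hl_of L))"
proof -
  interpret hom_lie_2_algebra R L by fact
  show ?thesis
    by (rule mor2_eqI[of L0 L1])
      (simp_all add: extensional_mor2_def hom_lie_2_ident_def hom_lie_mor_of_def hl_ident_def mor_decomp)
qed

text \<open>The arrow part of G_2 followed by G_1(F_2) is the sum of the arrow parts, which is the
  formula in \<open>hl_comp\<close>. This provides \<open>Comp_D\<close>, from which the category
  laws are transported.\<close>

lemma hom_lie_2_comp_eq:
  assumes "hom_lie_mor R L L' F" "hom_lie_mor R L' L'' G"
  shows "hom_lie_2_comp L L' L'' G F =
    hom_lie_mor_of L L'' (hl_comp (hl_of L) (hl_of L') (hl_of L'') (hl_mor_of L' L'' G) (hl_mor_of L L' F))"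
    (is "_ = ?rhs")
proof -
  interpret F: hom_lie_mor R L L' F by fact
  interpret G: hom_lie_mor R L' L'' G by fact
  show ?thesis
  proof (rule mor2_eqI[of "carrier (Ob L)" "carrier (Mor L)"])
    fix g assume g: "g \<in> carrier (Mor L)"
    have "map1 G (map1 F g) =
        idt L'' (map0 G (map0 F (src L g))) \<oplus>\<^bsub>Mor L''\<^esub> map1 G (map1 F (F.L.ap g))"
      using g G.L'.mor_decomp[of "map1 G (map1 F g)"] by simp
    then show "map1 (hom_lie_2_comp L L' L'' G F) g = map1 ?rhs g"
      using g by (simp add: hom_lie_2_comp_def hom_lie_mor_of_def hl_comp_def hl_mor_of_def)
  next
    fix x y assume xy: "x \<in> carrier (Ob L)" "y \<in> carrier (Ob L)"
    let ?h = "map2 G (map0 F x) (map0 F y) \<star>\<^bsub>L''\<^esub> map1 G (map2 F x y)"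
    have "?h = idt L'' (src L'' ?h) \<oplus>\<^bsub>Mor L''\<^esub> G.L'.ap ?h"
      using xy by (subst G.L'.mor_decomp) simp_all
    then show "map2 (hom_lie_2_comp L L' L'' G F) x y = map2 ?rhs x y"
      using xy by (simp add: hom_lie_2_comp_def hom_lie_mor_of_def hl_comp_def hl_mor_of_def)
  qed (simp_all add: extensional_mor2_def hom_lie_2_comp_def hom_lie_mor_of_def hl_comp_def hl_mor_of_def)
qed

section \<open>Essential surjectivity\<close>

text \<open>
  The morphisms of the 2-vector space attached to \<open>V\<close> are codes \<open>pr x m\<close> of pairs in
  \<open>V\<^sub>0 \<times> V\<^sub>1\<close>, read as the arrow \<open>x \<rightarrow> x + d m\<close> with arrow part \<open>m\<close>.
\<close>

definition coded_sum ::
  "('u \<Rightarrow> 'u \<Rightarrow> 'u) \<Rightarrow> ('u \<Rightarrow> 'u) \<Rightarrow> ('u \<Rightarrow> 'u) \<Rightarrow> ('k, 'u) module \<Rightarrow> ('k, 'u) module \<Rightarrow> ('k, 'u) module"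
  where
  "coded_sum pr p0 p1 M N =
    \<lparr>carrier = (\<lambda>(x, m). pr x m) ` (carrier M \<times> carrier N), monoid.mult = undefined, one = undefined,
     ring.zero = pr \<zero>\<^bsub>M\<^esub> \<zero>\<^bsub>N\<^esub>,
     add = (\<lambda>f g. pr (p0 f \<oplus>\<^bsub>M\<^esub> p0 g) (p1 f \<oplus>\<^bsub>N\<^esub> p1 g)),
     smult = (\<lambda>a f. pr (a \<odot>\<^bsub>M\<^esub> p0 f) (a \<odot>\<^bsub>N\<^esub> p1 f))\<rparr>"

text \<open>The second component of \<open>br1\<close> is the first formula of
  \<open>ap_bilinear_functor\<close>: the target of f bracketed with the arrow part of g, plus the
  arrow part of f bracketed with the source of g. The Jacobiator has the prescribed source and arrow
  part \<open>l3\<close>.\<close>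

definition hom_lie_of ::
  "('u \<Rightarrow> 'u \<Rightarrow> 'u) \<Rightarrow> ('u \<Rightarrow> 'u) \<Rightarrow> ('u \<Rightarrow> 'u) \<Rightarrow> ('k, 'u) hl_alg \<Rightarrow> ('k, 'u) hom_lie2" where
  "hom_lie_of pr p0 p1 V =
    \<lparr>Ob = V0 V, Mor = coded_sum pr p0 p1 (V0 V) (V1 V),
     src = p0, tgt = (\<lambda>f. p0 f \<oplus>\<^bsub>V0 V\<^esub> diff V (p1 f)),
     idt = (\<lambda>x. pr x \<zero>\<^bsub>V1 V\<^esub>), vcomp = (\<lambda>f g. pr (p0 f) (p1 f \<oplus>\<^bsub>V1 V\<^esub> p1 g)),
     br0 = l00 V,
     br1 = (\<lambda>f g. pr (l00 V (p0 f) (p0 g))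
       (l01 V (p0 f \<oplus>\<^bsub>V0 V\<^esub> diff V (p1 f)) (p1 g) \<oplus>\<^bsub>V1 V\<^esub> l10 V (p1 f) (p0 g))),
     jac = (\<lambda>x y z. pr (l00 V (l00 V x y) (phi0 V z)) (l3 V x y z)),
     Phi0 = phi0 V, Phi1 = (\<lambda>f. pr (phi0 V (p0 f)) (phi1 V (p1 f)))\<rparr>"

locale coded_hl_algebra = hl_algebra R V for R :: "('k, 'r) ring_scheme" and V :: "('k, 'u) hl_alg" +
  fixes pr :: "'u \<Rightarrow> 'u \<Rightarrow> 'u" and p0 p1 :: "'u \<Rightarrow> 'u"
  assumes p0_pr [simp]: "\<lbrakk>x \<in> C0; m \<in> C1\<rbrakk> \<Longrightarrow> p0 (pr x m) = x"
    and p1_pr [simp]: "\<lbrakk>x \<in> C0; m \<in> C1\<rbrakk> \<Longrightarrow> p1 (pr x m) = m"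
begin

abbreviation M where "M \<equiv> coded_sum pr p0 p1 (V0 V) (V1 V)"

lemma pr_closed [simp]: "\<lbrakk>x \<in> C0; m \<in> C1\<rbrakk> \<Longrightarrow> pr x m \<in> carrier M"
  by (auto simp: coded_sum_def)

lemma p_closed [simp]: "f \<in> carrier M \<Longrightarrow> p0 f \<in> C0" "f \<in> carrier M \<Longrightarrow> p1 f \<in> C1"
  by (auto simp: coded_sum_def)

lemma coded_eqI: "\<lbrakk>f \<in> carrier M; g \<in> carrier M; p0 f = p0 g; p1 f = p1 g\<rbrakk> \<Longrightarrow> f = g"
  by (auto simp: coded_sum_def)

lemma coded_ops [simp]:
  "\<zero>\<^bsub>M\<^esub> = pr \<zero>\<^bsub>V0 V\<^esub> \<zero>\<^bsub>V1 V\<^esub>"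
  "f \<oplus>\<^bsub>M\<^esub> g = pr (p0 f \<oplus>\<^bsub>V0 V\<^esub> p0 g) (p1 f \<oplus>\<^bsub>V1 V\<^esub> p1 g)"
  "a \<odot>\<^bsub>M\<^esub> f = pr (a \<odot>\<^bsub>V0 V\<^esub> p0 f) (a \<odot>\<^bsub>V1 V\<^esub> p1 f)"
  by (simp_all add: coded_sum_def)

lemma pr_p [simp]: "f \<in> carrier M \<Longrightarrow> pr (p0 f) (p1 f) = f"
  by (auto simp: coded_sum_def)

lemma coded_module: "module R M"
proof (rule moduleI)
  show "cring R" by (rule V0_module[unfolded module_def, THEN conjunct1])
  show "abelian_group M"
  proof (rule abelian_groupI)
    fix f assume "f \<in> carrier M"
    then show "\<exists>g \<in> carrier M. g \<oplus>\<^bsub>M\<^esub> f = \<zero>\<^bsub>M\<^esub>"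
      by (intro bexI[of _ "pr (\<ominus>\<^bsub>V0 V\<^esub> p0 f) (\<ominus>\<^bsub>V1 V\<^esub> p1 f)"]) (simp_all add: A0.l_neg A1.l_neg)
  qed (simp_all add: A0.a_ac A1.a_ac)
qed (simp_all add: A0.smult_l_distr A0.smult_r_distr A0.smult_assoc1
      A1.smult_l_distr A1.smult_r_distr A1.smult_assoc1)

sublocale M: module R M by (rule coded_module)

lemma M_neg [simp]:
  "f \<in> carrier M \<Longrightarrow> \<ominus>\<^bsub>M\<^esub> f = pr (\<ominus>\<^bsub>V0 V\<^esub> p0 f) (\<ominus>\<^bsub>V1 V\<^esub> p1 f)"
  by (rule M.minus_equality) (simp_all add: A0.l_neg A1.l_neg)

abbreviation L where "L \<equiv> hom_lie_of pr p0 p1 V"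

lemma L_simps [simp]:
  "Ob L = V0 V" "Mor L = M" "src L = p0" "tgt L f = p0 f \<oplus>\<^bsub>V0 V\<^esub> d (p1 f)"
  "idt L x = pr x \<zero>\<^bsub>V1 V\<^esub>" "vcomp L f g = pr (p0 f) (p1 f \<oplus>\<^bsub>V1 V\<^esub> p1 g)" "br0 L = l\<^sub>0\<^sub>0"
  "br1 L f g = pr (l\<^sub>0\<^sub>0 (p0 f) (p0 g))
     (l\<^sub>0\<^sub>1 (p0 f \<oplus>\<^bsub>V0 V\<^esub> d (p1 f)) (p1 g) \<oplus>\<^bsub>V1 V\<^esub> l\<^sub>1\<^sub>0 (p1 f) (p0 g))"
  "jac L x y z = pr (l\<^sub>0\<^sub>0 (l\<^sub>0\<^sub>0 x y) (\<phi>\<^sub>0 z)) (l\<^sub>3 x y z)"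
  "Phi0 L = \<phi>\<^sub>0" "Phi1 L f = pr (\<phi>\<^sub>0 (p0 f)) (\<phi>\<^sub>1 (p1 f))"
  by (simp_all add: hom_lie_of_def)

lemma two_vector_space_coded: "two_vector_space R L"
proof (rule two_vector_space.intro)
  show "module R (Ob L)" "module R (Mor L)"
    using V0_module coded_module by simp_all
  show "src L \<in> linear_maps R (Mor L) (Ob L)" "tgt L \<in> linear_maps R (Mor L) (Ob L)"
    "idt L \<in> linear_maps R (Ob L) (Mor L)"
    by (rule linear_mapsI; simp add: A0.a_ac A0.smult_r_distr)+
next
  fix f g assume "f \<in> carrier (Mor L)" "g \<in> carrier (Mor L)" "tgt L f = src L g"
  then show "tgt L (f \<star>\<^bsub>L\<^esub> g) = tgt L g"
    \<comment> \<open>Regrouping exposes the target of f, which composability replaces by the source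
      of g.\<close>
    by (simp flip: A0.a_assoc)
qed (simp_all add: ground_field A0.a_ac A1.a_ac A1.smult_r_distr)

lemma d_l10: "\<lbrakk>x \<in> C0; m \<in> C1\<rbrakk> \<Longrightarrow> d (l\<^sub>1\<^sub>0 m x) = l\<^sub>0\<^sub>0 (d m) x"
  using l00_skew[of "d m" x] by (simp add: l10_skew d_l01)

lemma phi1_l10: "\<lbrakk>x \<in> C0; m \<in> C1\<rbrakk> \<Longrightarrow> \<phi>\<^sub>1 (l\<^sub>1\<^sub>0 m x) = l\<^sub>1\<^sub>0 (\<phi>\<^sub>1 m) (\<phi>\<^sub>0 x)"
  by (simp add: l10_skew phi1_l01)

text \<open>
  Axiom (i) and its two cyclic rotations, rearranged so that no minus sign occurs.
\<close>

lemma l3_d_3: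
  assumes "x \<in> C0" "y \<in> C0" "m \<in> C1"
  shows "l\<^sub>0\<^sub>1 (l\<^sub>0\<^sub>0 x y) (\<phi>\<^sub>1 m) \<oplus>\<^bsub>V1 V\<^esub> l\<^sub>3 x y (d m) =
    l\<^sub>0\<^sub>1 (\<phi>\<^sub>0 x) (l\<^sub>0\<^sub>1 y m) \<oplus>\<^bsub>V1 V\<^esub> l\<^sub>1\<^sub>0 (l\<^sub>0\<^sub>1 x m) (\<phi>\<^sub>0 y)"
  using assms by (simp add: l3_d l10_skew A1.a_ac A1.r_neg1 A1.r_neg2 A1.r_neg
      A1.neg_cancel)

lemma l3_d_2:
  assumes "x \<in> C0" "y \<in> C0" "m \<in> C1"
  shows "l\<^sub>1\<^sub>0 (l\<^sub>0\<^sub>1 x m) (\<phi>\<^sub>0 y) \<oplus>\<^bsub>V1 V\<^esub> l\<^sub>3 x (d m) y =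
    l\<^sub>0\<^sub>1 (l\<^sub>0\<^sub>0 x y) (\<phi>\<^sub>1 m) \<oplus>\<^bsub>V1 V\<^esub> l\<^sub>0\<^sub>1 (\<phi>\<^sub>0 x) (l\<^sub>1\<^sub>0 m y)"
proof -
  have "l\<^sub>3 x (d m) y = \<ominus>\<^bsub>V1 V\<^esub> l\<^sub>3 x y (d m)"
    using l3_skew assms df.closed unfolding skew3_def by blast
  then show ?thesis
    using assms by (simp add: l3_d l10_skew A1.minus_add A1.a_ac A1.r_neg1 A1.r_neg2 A1.r_neg
      A1.neg_cancel)
qed

lemma l3_d_1:
  assumes "x \<in> C0" "y \<in> C0" "m \<in> C1"
  shows "l\<^sub>1\<^sub>0 (l\<^sub>1\<^sub>0 m x) (\<phi>\<^sub>0 y) \<oplus>\<^bsub>V1 V\<^esub> l\<^sub>3 (d m) x y =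
    l\<^sub>1\<^sub>0 (\<phi>\<^sub>1 m) (l\<^sub>0\<^sub>0 x y) \<oplus>\<^bsub>V1 V\<^esub> l\<^sub>1\<^sub>0 (l\<^sub>1\<^sub>0 m y) (\<phi>\<^sub>0 x)"
proof -
  have "l\<^sub>3 (d m) x y = \<ominus>\<^bsub>V1 V\<^esub> l\<^sub>3 x (d m) y" "l\<^sub>3 x (d m) y = \<ominus>\<^bsub>V1 V\<^esub> l\<^sub>3 x y (d m)"
    using l3_skew assms df.closed unfolding skew3_def by blast+
  then show ?thesis
    using assms by (simp add: l3_d l10_skew A1.minus_add A1.a_ac A1.r_neg1 A1.r_neg2 A1.r_neg
      A1.neg_cancel)
qed

text \<open>Axiom (e) for [x,m] and phi1 n. It identifies the two forms of the term with two arrow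
  parts in the naturality of the Jacobiator.\<close>

lemma l01_l10_exchange:
  "\<lbrakk>x \<in> C0; m \<in> C1; n \<in> C1\<rbrakk>
    \<Longrightarrow> l\<^sub>1\<^sub>0 (l\<^sub>0\<^sub>1 x m) (\<phi>\<^sub>0 (d n)) = l\<^sub>0\<^sub>1 (l\<^sub>0\<^sub>0 x (d m)) (\<phi>\<^sub>1 n)"
  using l01_d[of "l\<^sub>0\<^sub>1 x m" "\<phi>\<^sub>1 n"] by (simp add: d_l01 phi_d)

lemma tgt_br1:
  assumes "f \<in> carrier M" "g \<in> carrier M"
  shows "l\<^sub>0\<^sub>0 (p0 f) (p0 g) \<oplus>\<^bsub>V0 V\<^esub> d (l\<^sub>0\<^sub>1 (p0 f \<oplus>\<^bsub>V0 V\<^esub> d (p1 f)) (p1 g) \<oplus>\<^bsub>V1 V\<^esub> l\<^sub>1\<^sub>0 (p1 f) (p0 g)) =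
    l\<^sub>0\<^sub>0 (p0 f \<oplus>\<^bsub>V0 V\<^esub> d (p1 f)) (p0 g \<oplus>\<^bsub>V0 V\<^esub> d (p1 g))"
  using assms by (simp add: d_l01 d_l10 A0.a_ac)

lemma bilinear_functor_coded: "bilinear_functor R L (br0 L) (br1 L)"
  unfolding bilinear_functor_def
proof (intro conjI ballI impI)
  show "br0 L \<in> bilinear_maps R (Ob L) (Ob L) (Ob L)"
    using l00_bilinear by simp
  show "br1 L \<in> bilinear_maps R (Mor L) (Mor L) (Mor L)"
    by (rule bilinear_mapsI; simp add: A1.a_ac A1.smult_r_distr)
next
  fix f g assume "f \<in> carrier (Mor L)" "g \<in> carrier (Mor L)"
  then show "tgt L (br1 L f g) = br0 L (tgt L f) (tgt L g)"
    using tgt_br1[of f g] by simp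
next
  fix f f' g g'
  assume fg: "f \<in> carrier (Mor L)" "f' \<in> carrier (Mor L)" "g \<in> carrier (Mor L)" "g' \<in> carrier (Mor L)"
    and eq: "tgt L f = src L f'" "tgt L g = src L g'"
  \<comment> \<open>After eliminating the sources of f' and g', the two sides differ only in the
    cross term of the arrow parts of f' and g, which \<open>l01_d\<close> matches.\<close>
  have eq': "p0 f' = p0 f \<oplus>\<^bsub>V0 V\<^esub> d (p1 f)" "p0 g' = p0 g \<oplus>\<^bsub>V0 V\<^esub> d (p1 g)"
    using eq by simp_all
  show "br1 L (f \<star>\<^bsub>L\<^esub> f') (g \<star>\<^bsub>L\<^esub> g') = br1 L f g \<star>\<^bsub>L\<^esub> br1 L f' g'"
    using fg by (simp add: eq' A0.a_ac A1.a_ac l01_d)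
qed simp_all

lemma linear_functor_coded: "linear_functor R L L (Phi0 L) (Phi1 L)"
  unfolding linear_functor_def
proof (intro conjI ballI impI)
  show "Phi0 L \<in> linear_maps R (Ob L) (Ob L)"
    using phi0_linear by simp
  show "Phi1 L \<in> linear_maps R (Mor L) (Mor L)"
    by (rule linear_mapsI) simp_all
qed (simp_all add: phi_d)

text \<open>Only arrow parts need work. The triple moves from (x,y,z) to the targets (x',y',z') one
  coordinate at a time, and each move is one of the forms \<open>l3_d_1\<close>,
  \<open>l3_d_2\<close>, \<open>l3_d_3\<close> of axiom (i).\<close>

lemma jac_natural_coded:
  assumes f: "f \<in> carrier M" and g: "g \<in> carrier M" and h: "h \<in> carrier M"
  shows "br1 L (br1 L f g) (Phi1 L h) \<star>\<^bsub>L\<^esub> jac L (tgt L f) (tgt L g) (tgt L h) =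
    jac L (src L f) (src L g) (src L h) \<star>\<^bsub>L\<^esub>
      (br1 L (Phi1 L f) (br1 L g h) \<oplus>\<^bsub>Mor L\<^esub> br1 L (br1 L f h) (Phi1 L g))"
proof (rule coded_eqI)
  define x y z a b c where "x = p0 f" and "y = p0 g" and "z = p0 h" and "a = p1 f" and "b = p1 g" and "c = p1 h"
  note xyz_def = this
  have C0 [simp]: "x \<in> C0" "y \<in> C0" "z \<in> C0" and C1 [simp]: "a \<in> C1" "b \<in> C1" "c \<in> C1"
    using f g h by (simp_all add: xyz_def)
  define x' y' z' where "x' = x \<oplus>\<^bsub>V0 V\<^esub> d a" and "y' = y \<oplus>\<^bsub>V0 V\<^esub> d b" and "z' = z \<oplus>\<^bsub>V0 V\<^esub> d c"
  note XYZ = this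
  have C0' [simp]: "x' \<in> C0" "y' \<in> C0" "z' \<in> C0"
    by (simp_all add: XYZ)
  have "l\<^sub>3 x' y' z' = l\<^sub>3 x' y' z \<oplus>\<^bsub>V1 V\<^esub> l\<^sub>3 x' y' (d c)"
    by (simp only: XYZ(3) tr.add_3 C0 C1 C0' df.closed)
  also have "l\<^sub>3 x' y' z = l\<^sub>3 x' y z \<oplus>\<^bsub>V1 V\<^esub> l\<^sub>3 x' (d b) z"
    by (simp only: XYZ(2) tr.add_2 C0 C1 C0' df.closed)
  also have "l\<^sub>3 x' y z = l\<^sub>3 x y z \<oplus>\<^bsub>V1 V\<^esub> l\<^sub>3 (d a) y z"
    by (simp only: XYZ(1) tr.add_1 C0 C1 C0' df.closed)
  finally have l3: "l\<^sub>3 x' y' z' =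
    l\<^sub>3 x y z \<oplus>\<^bsub>V1 V\<^esub> l\<^sub>3 (d a) y z \<oplus>\<^bsub>V1 V\<^esub> l\<^sub>3 x' (d b) z \<oplus>\<^bsub>V1 V\<^esub> l\<^sub>3 x' y' (d c)" .
  \<comment> \<open>The moves produce a term with z where the claim has z', and one with y' where
    the claim has y. Both discrepancies are the same term in the arrow parts b and c.\<close>
  have split_z: "l\<^sub>0\<^sub>1 (l\<^sub>0\<^sub>0 x' z') (\<phi>\<^sub>1 b) = l\<^sub>0\<^sub>1 (l\<^sub>0\<^sub>0 x' z) (\<phi>\<^sub>1 b) \<oplus>\<^bsub>V1 V\<^esub> l\<^sub>0\<^sub>1 (l\<^sub>0\<^sub>0 x' (d c)) (\<phi>\<^sub>1 b)"
    by (simp add: XYZ(3))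
  have split_y: "l\<^sub>1\<^sub>0 (l\<^sub>0\<^sub>1 x' c) (\<phi>\<^sub>0 y') = l\<^sub>1\<^sub>0 (l\<^sub>0\<^sub>1 x' c) (\<phi>\<^sub>0 y) \<oplus>\<^bsub>V1 V\<^esub> l\<^sub>0\<^sub>1 (l\<^sub>0\<^sub>0 x' (d c)) (\<phi>\<^sub>1 b)"
    by (simp add: XYZ(2) flip: l01_l10_exchange)
  have main: "l\<^sub>0\<^sub>1 (l\<^sub>0\<^sub>0 x' y') (\<phi>\<^sub>1 c) \<oplus>\<^bsub>V1 V\<^esub> (l\<^sub>1\<^sub>0 (l\<^sub>0\<^sub>1 x' b) (\<phi>\<^sub>0 z) \<oplus>\<^bsub>V1 V\<^esub> l\<^sub>1\<^sub>0 (l\<^sub>1\<^sub>0 a y) (\<phi>\<^sub>0 z))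
      \<oplus>\<^bsub>V1 V\<^esub> l\<^sub>3 x' y' z' =
    l\<^sub>3 x y z \<oplus>\<^bsub>V1 V\<^esub>
      ((l\<^sub>0\<^sub>1 (\<phi>\<^sub>0 x') (l\<^sub>0\<^sub>1 y' c) \<oplus>\<^bsub>V1 V\<^esub> l\<^sub>0\<^sub>1 (\<phi>\<^sub>0 x') (l\<^sub>1\<^sub>0 b z) \<oplus>\<^bsub>V1 V\<^esub> l\<^sub>1\<^sub>0 (\<phi>\<^sub>1 a) (l\<^sub>0\<^sub>0 y z)) \<oplus>\<^bsub>V1 V\<^esub>
      (l\<^sub>0\<^sub>1 (l\<^sub>0\<^sub>0 x' z') (\<phi>\<^sub>1 b) \<oplus>\<^bsub>V1 V\<^esub> (l\<^sub>1\<^sub>0 (l\<^sub>0\<^sub>1 x' c) (\<phi>\<^sub>0 y) \<oplus>\<^bsub>V1 V\<^esub> l\<^sub>1\<^sub>0 (l\<^sub>1\<^sub>0 a z) (\<phi>\<^sub>0 y))))"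
    (is "?lhs = ?rhs")
  proof -
    have "?lhs = l\<^sub>3 x y z \<oplus>\<^bsub>V1 V\<^esub> (l\<^sub>1\<^sub>0 (l\<^sub>1\<^sub>0 a y) (\<phi>\<^sub>0 z) \<oplus>\<^bsub>V1 V\<^esub> l\<^sub>3 (d a) y z) \<oplus>\<^bsub>V1 V\<^esub>
        (l\<^sub>1\<^sub>0 (l\<^sub>0\<^sub>1 x' b) (\<phi>\<^sub>0 z) \<oplus>\<^bsub>V1 V\<^esub> l\<^sub>3 x' (d b) z) \<oplus>\<^bsub>V1 V\<^esub>
        (l\<^sub>0\<^sub>1 (l\<^sub>0\<^sub>0 x' y') (\<phi>\<^sub>1 c) \<oplus>\<^bsub>V1 V\<^esub> l\<^sub>3 x' y' (d c))"
      by (simp add: l3 A1.a_ac)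
    also have "\<dots> = ?rhs"
      by (simp only: split_z l3_d_1 l3_d_2 l3_d_3 split_y C0 C1 C0') (simp add: A1.a_ac)
    finally show ?thesis .
  qed
  have tgt: "tgt L f = x'" "tgt L g = y'" "tgt L h = z'" "p0 f = x" "p0 g = y" "p0 h = z"
    "p1 f = a" "p1 g = b" "p1 h = c"
    by (simp_all add: XYZ xyz_def)
  have br: "l\<^sub>0\<^sub>0 x y \<oplus>\<^bsub>V0 V\<^esub> d (l\<^sub>0\<^sub>1 x' b \<oplus>\<^bsub>V1 V\<^esub> l\<^sub>1\<^sub>0 a y) = l\<^sub>0\<^sub>0 x' y'"
    "l\<^sub>0\<^sub>0 x z \<oplus>\<^bsub>V0 V\<^esub> d (l\<^sub>0\<^sub>1 x' c \<oplus>\<^bsub>V1 V\<^esub> l\<^sub>1\<^sub>0 a z) = l\<^sub>0\<^sub>0 x' z'"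
    using tgt_br1[OF f g] tgt_br1[OF f h] by (simp_all only: XYZ xyz_def)
  have phi: "\<phi>\<^sub>0 x \<oplus>\<^bsub>V0 V\<^esub> d (\<phi>\<^sub>1 a) = \<phi>\<^sub>0 x'"
    by (simp add: XYZ(1) flip: phi_d)
  show "p1 (br1 L (br1 L f g) (Phi1 L h) \<star>\<^bsub>L\<^esub> jac L (tgt L f) (tgt L g) (tgt L h)) =
    p1 (jac L (src L f) (src L g) (src L h) \<star>\<^bsub>L\<^esub>
      (br1 L (Phi1 L f) (br1 L g h) \<oplus>\<^bsub>Mor L\<^esub> br1 L (br1 L f h) (Phi1 L g)))"
    \<comment> \<open>The additivity rules are switched off so that x', y', z' stay folded as in
      \<open>main\<close>.\<close>
    using main
    by (simp add: tgt(4-) phi br XYZ(1,2,3)[symmetric] del: df.add b00.add_left b00.add_right)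
qed (use f g h in simp_all)

lemma hom_lie_2_algebra_coded: "hom_lie_2_algebra R L"
proof (intro hom_lie_2_algebra.intro hom_lie_2_algebra_axioms.intro)
  show "two_vector_space R L"
    by (rule two_vector_space_coded)
  show "bilinear_functor R L (br0 L) (br1 L)"
    by (rule bilinear_functor_coded)
  show "linear_functor R L L (Phi0 L) (Phi1 L)"
    by (rule linear_functor_coded)
  show "skew2 (Ob L) (Ob L) (br0 L)"
    unfolding skew2_def L_simps using l00_skew by blast
  show "skew2 (Mor L) (Mor L) (br1 L)"
    unfolding skew2_def
  proof (intro ballI)
    fix f g assume fg: "f \<in> carrier (Mor L)" "g \<in> carrier (Mor L)"
    then have 0: "l\<^sub>0\<^sub>0 (p0 f) (p0 g) = \<ominus>\<^bsub>V0 V\<^esub> l\<^sub>0\<^sub>0 (p0 g) (p0 f)"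
      by (intro l00_skew) simp_all
    \<comment> \<open>The formula for \<open>br1\<close> treats f and g asymmetrically; it is skew
      because axiom (e) makes its term in two arrow parts skew.\<close>
    have 1: "l\<^sub>0\<^sub>1 (d (p1 f)) (p1 g) = \<ominus>\<^bsub>V1 V\<^esub> l\<^sub>0\<^sub>1 (d (p1 g)) (p1 f)"
      using fg by (simp add: l01_d[of "p1 f" "p1 g"] l10_skew)
    show "br1 L f g = \<ominus>\<^bsub>Mor L\<^esub> br1 L g f"
      by (rule coded_eqI; use fg 0 1 in \<open>simp add: l10_skew A1.minus_add A1.a_ac\<close>)
  qed
  show "jac L \<in> trilinear_maps R (Ob L) (Mor L)"
    by (rule trilinear_mapsI) simp_all
  show "skew3 (Ob L) (Mor L) (\<lambda>x y z. arrow_part L (jac L x y z))"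
    unfolding skew3_def
  proof (intro ballI)
    fix x y z assume xyz: "x \<in> carrier (Ob L)" "y \<in> carrier (Ob L)" "z \<in> carrier (Ob L)"
    then have 1: "l\<^sub>3 x y z = \<ominus>\<^bsub>V1 V\<^esub> l\<^sub>3 y x z" "l\<^sub>3 x y z = \<ominus>\<^bsub>V1 V\<^esub> l\<^sub>3 x z y"
      using l3_skew unfolding skew3_def L_simps by blast+
    have ap: "arrow_part L (jac L u v w) = pr \<zero>\<^bsub>V0 V\<^esub> (l\<^sub>3 u v w)" if "u \<in> C0" "v \<in> C0" "w \<in> C0" for u v w
      using that by (simp add: arrow_part_def M.minus_eq A0.r_neg)
    show "arrow_part L (jac L x y z) = \<ominus>\<^bsub>Mor L\<^esub> arrow_part L (jac L y x z) \<and>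
        arrow_part L (jac L x y z) = \<ominus>\<^bsub>Mor L\<^esub> arrow_part L (jac L x z y)"
      using xyz 1 by (simp add: ap del: L_simps(9))
  qed
next
  fix x y z assume xyz: "x \<in> carrier (Ob L)" "y \<in> carrier (Ob L)" "z \<in> carrier (Ob L)"
  interpret L: two_vector_space R L by (rule two_vector_space_coded)
  show "vinvertible L (jac L x y z)"
    by (rule L.vinvertible_mor) (use xyz in simp)
  have "l\<^sub>0\<^sub>0 (\<phi>\<^sub>0 y) (l\<^sub>0\<^sub>0 z x) = l\<^sub>0\<^sub>0 (l\<^sub>0\<^sub>0 x z) (\<phi>\<^sub>0 y)"
    "l\<^sub>0\<^sub>0 (\<phi>\<^sub>0 z) (l\<^sub>0\<^sub>0 x y) = \<ominus>\<^bsub>V0 V\<^esub> l\<^sub>0\<^sub>0 (l\<^sub>0\<^sub>0 x y) (\<phi>\<^sub>0 z)"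
    using l00_skew[of "\<phi>\<^sub>0 y" "l\<^sub>0\<^sub>0 z x"] l00_skew[of "\<phi>\<^sub>0 z" "l\<^sub>0\<^sub>0 x y"] l00_skew[of z x] xyz by simp_all
  then show "tgt L (jac L x y z) = br0 L (Phi0 L x) (br0 L y z) \<oplus>\<^bsub>Ob L\<^esub> br0 L (br0 L x z) (Phi0 L y)"
    using xyz by (simp add: d_l3 A0.neg_cancel)
next
  fix f g h assume "f \<in> carrier (Mor L)" "g \<in> carrier (Mor L)" "h \<in> carrier (Mor L)"
  then show "br1 L (br1 L f g) (Phi1 L h) \<star>\<^bsub>L\<^esub> jac L (tgt L f) (tgt L g) (tgt L h) =
      jac L (src L f) (src L g) (src L h) \<star>\<^bsub>L\<^esub>
        (br1 L (Phi1 L f) (br1 L g h) \<oplus>\<^bsub>Mor L\<^esub> br1 L (br1 L f h) (Phi1 L g))"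
    by (intro jac_natural_coded) simp_all
next
  fix f g assume "f \<in> carrier (Mor L)" "g \<in> carrier (Mor L)"
  then show "Phi1 L (br1 L f g) = br1 L (Phi1 L f) (Phi1 L g)"
    by (simp add: phi0_l00 phi1_l01 phi1_l10 phi_d)
next
  fix w x y z
  assume wxyz: "w \<in> carrier (Ob L)" "x \<in> carrier (Ob L)" "y \<in> carrier (Ob L)" "z \<in> carrier (Ob L)"
  show "jac L (br0 L w x) (Phi0 L y) (Phi0 L z)
        \<star>\<^bsub>L\<^esub> (br1 L (jac L w x z) (idt L (Phi0 L (Phi0 L y)))
          \<oplus>\<^bsub>Mor L\<^esub> idt L (br0 L (Phi0 L (br0 L w x)) (br0 L (Phi0 L y) (Phi0 L z))))
        \<star>\<^bsub>L\<^esub> (jac L (Phi0 L w) (br0 L x z) (Phi0 L y)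
          \<oplus>\<^bsub>Mor L\<^esub> jac L (br0 L w z) (Phi0 L x) (Phi0 L y)
          \<oplus>\<^bsub>Mor L\<^esub> idt L (br0 L (Phi0 L (br0 L w x)) (br0 L (Phi0 L y) (Phi0 L z))))
      = br1 L (jac L w x y) (idt L (Phi0 L (Phi0 L z)))
        \<star>\<^bsub>L\<^esub> (jac L (br0 L w y) (Phi0 L x) (Phi0 L z)
          \<oplus>\<^bsub>Mor L\<^esub> jac L (Phi0 L w) (br0 L x y) (Phi0 L z))
        \<star>\<^bsub>L\<^esub> (br1 L (idt L (Phi0 L (Phi0 L w))) (jac L x y z)
          \<oplus>\<^bsub>Mor L\<^esub> br1 L (jac L w y z) (idt L (Phi0 L (Phi0 L x)))
          \<oplus>\<^bsub>Mor L\<^esub> idt L (br0 L (Phi0 L (br0 L w y)) (br0 L (Phi0 L x) (Phi0 L z))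
            \<oplus>\<^bsub>Ob L\<^esub> br0 L (br0 L (Phi0 L w) (Phi0 L z)) (Phi0 L (br0 L x y))))
        \<star>\<^bsub>L\<^esub> (idt L (br0 L (Phi0 L (Phi0 L w)) (br0 L (Phi0 L x) (br0 L y z))
            \<oplus>\<^bsub>Ob L\<^esub> br0 L (Phi0 L (Phi0 L w)) (br0 L (br0 L x z) (Phi0 L y))
            \<oplus>\<^bsub>Ob L\<^esub> br0 L (br0 L (br0 L w z) (Phi0 L y)) (Phi0 L (Phi0 L x))
            \<oplus>\<^bsub>Ob L\<^esub> br0 L (Phi0 L (br0 L w y)) (br0 L (Phi0 L x) (Phi0 L z))
            \<oplus>\<^bsub>Ob L\<^esub> br0 L (br0 L (Phi0 L w) (Phi0 L z)) (Phi0 L (br0 L x y)))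
          \<oplus>\<^bsub>Mor L\<^esub> jac L (Phi0 L w) (br0 L y z) (Phi0 L x))"
  proof -
    \<comment> \<open>Identities have second component 0, so the second components of the pasting
      equation are exactly \<open>l3_identity\<close>.\<close>
    note eq = l3_identity[of w x y z]
    show ?thesis
      by (rule coded_eqI; use wxyz eq in \<open>simp add: A1.a_ac\<close>)
  qed
qed (simp_all add: phi0_l00 l3_phi)

sublocale L: hom_lie_2_algebra R L by (rule hom_lie_2_algebra_coded)

section \<open>The isomorphism between a 2-term algebra and the kernel of its coded
  2-algebra\<close>

definition decode :: "'u mor2" where
  "decode = \<lparr>map0 = (\<lambda>x \<in> C0. x), map1 = (\<lambda>m \<in> carrier (src_kernel L). p1 m),
     map2 = (\<lambda>x \<in> C0. \<lambda>y \<in> C0. \<zero>\<^bsub>V1 V\<^esub>)\<rparr>"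

text \<open>The kernel of the source consists of the codes \<open>pr\<close> 0 m. The third
  component is again zero, since \<open>pr\<close> 0 0 is the zero of the coded sum.\<close>

definition encode :: "'u mor2" where
  "encode = \<lparr>map0 = (\<lambda>x \<in> C0. x), map1 = (\<lambda>m \<in> C1. pr \<zero>\<^bsub>V0 V\<^esub> m),
     map2 = (\<lambda>x \<in> C0. \<lambda>y \<in> C0. pr \<zero>\<^bsub>V0 V\<^esub> \<zero>\<^bsub>V1 V\<^esub>)\<rparr>"

lemma ap_coded: "f \<in> carrier M \<Longrightarrow> arrow_part L f = pr \<zero>\<^bsub>V0 V\<^esub> (p1 f)"
  by (simp add: arrow_part_def M.minus_eq A0.r_neg)

lemma hl_morphism_decode: "hl_morphism R (hl_of L) V decode"
proof (rule hl_morphism.intro)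
  show "extensional_mor2 (carrier (V0 (hl_of L))) (carrier (V1 (hl_of L))) decode"
    by (simp add: extensional_mor2_def decode_def)
  show "map0 decode \<in> linear_maps R (V0 (hl_of L)) (V0 V)"
    by (rule linear_mapsI) (simp_all add: decode_def)
  show "map1 decode \<in> linear_maps R (V1 (hl_of L)) (V1 V)"
    by (rule linear_mapsI) (simp_all add: decode_def)
  show "map2 decode \<in> bilinear_maps R (V0 (hl_of L)) (V0 (hl_of L)) (V1 V)"
    by (rule bilinear_mapsI) (simp_all add: decode_def)
qed (simp_all add: decode_def skew2_def ap_coded A0.eq_diff_iff A1.eq_diff_iff)

lemma hl_morphism_encode: "hl_morphism R V (hl_of L) encode"
proof (rule hl_morphism.intro)
  show "extensional_mor2 (carrier (V0 V)) (carrier (V1 V)) encode"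
    by (simp add: extensional_mor2_def encode_def)
  show "map0 encode \<in> linear_maps R (V0 V) (V0 (hl_of L))"
    by (rule linear_mapsI) (simp_all add: encode_def)
  show "map1 encode \<in> linear_maps R (V1 V) (V1 (hl_of L))"
    by (rule linear_mapsI) (simp_all add: encode_def)
  show "map2 encode \<in> bilinear_maps R (V0 V) (V0 V) (V1 (hl_of L))"
    by (rule bilinear_mapsI) (simp_all add: encode_def)
qed (simp_all add: encode_def skew2_def ap_coded A0.eq_diff_iff L.ker.eq_diff_iff)

lemma is_iso_decode: "is_iso (TwoHL R) (hl_of L) V decode"
proof -
  have "hl_comp (hl_of L) V (hl_of L) encode decode = hl_ident (hl_of L)"
  proof (rule mor2_eqI[of C0 "carrier (src_kernel L)"])
    fix m assume m: "m \<in> carrier (src_kernel L)"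
    then have "pr \<zero>\<^bsub>V0 V\<^esub> (p1 m) = m"
      using pr_p[of m] by simp
    then show "map1 (hl_comp (hl_of L) V (hl_of L) encode decode) m = map1 (hl_ident (hl_of L)) m"
      using m by (simp add: hl_comp_def hl_ident_def encode_def decode_def)
  qed (simp_all add: extensional_mor2_def hl_comp_def hl_ident_def encode_def decode_def)
  moreover have "hl_comp V (hl_of L) V decode encode = hl_ident V"
    by (rule mor2_eqI[of C0 C1])
      (simp_all add: extensional_mor2_def hl_comp_def hl_ident_def encode_def decode_def)
  ultimately show ?thesis
    using hl_morphism_decode hl_morphism_encode by (auto simp: is_iso_def TwoHL_def)
qed

end

text \<open>Characteristic zero enters the equivalence here, through the pairing chosen for the two
  spaces of \<open>V\<close>.\<close>

lemma TwoHL_essentially_surjective: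
  fixes R :: "('k, 'r) ring_scheme" and V :: "('k, 'u) hl_alg"
  assumes "field R" "\<And>n :: nat. n > 0 \<Longrightarrow> [n] \<cdot>\<^bsub>R\<^esub> \<one>\<^bsub>R\<^esub> \<noteq> \<zero>\<^bsub>R\<^esub>"
    and V: "hl_algebra R V"
  shows "\<exists>L. hom_lie_2_algebra R L \<and> (\<exists>f. is_iso (TwoHL R) (hl_of L) V f)"
proof (rule pairing_exists[OF assms(1) _ hl_algebra.V0_module[OF V] hl_algebra.V1_module[OF V]])
  show "[n] \<cdot>\<^bsub>R\<^esub> \<one>\<^bsub>R\<^esub> \<noteq> \<zero>\<^bsub>R\<^esub>" if "n > 0" for n :: nat
    using that by (rule assms(2))
next
  fix pr :: "'u \<Rightarrow> 'u \<Rightarrow> 'u" and p0 p1 :: "'u \<Rightarrow> 'u"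
  assume "\<And>x m. \<lbrakk>x \<in> carrier (V0 V); m \<in> carrier (V1 V)\<rbrakk> \<Longrightarrow> p0 (pr x m) = x"
    "\<And>x m. \<lbrakk>x \<in> carrier (V0 V); m \<in> carrier (V1 V)\<rbrakk> \<Longrightarrow> p1 (pr x m) = m"
  then interpret coded_hl_algebra R V pr p0 p1
    using V by (simp add: coded_hl_algebra_def coded_hl_algebra_axioms_def)
  show ?thesis
    using hom_lie_2_algebra_coded is_iso_decode by blast
qed

theorem theorem3p9:
  fixes R :: "('k, 'r) ring_scheme"
  assumes "field R"
    and "\<And>n :: nat. n > 0 \<Longrightarrow> [n] \<cdot>\<^bsub>R\<^esub> \<one>\<^bsub>R\<^esub> \<noteq> \<zero>\<^bsub>R\<^esub>"
  shows "equivalent_categories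
    (TwoHL R :: (('k, 'u) hl_alg, 'u mor2) category)
    (HLie2 R :: (('k, 'u) hom_lie2, 'u mor2) category)"
proof -
  interpret category "TwoHL R :: (('k, 'u) hl_alg, 'u mor2) category"
    by (rule category_TwoHL)
  \<comment> \<open>The category laws are verified by hand only for \<open>TwoHL\<close>; those of
    \<open>HLie2\<close> come out of the locale.\<close>
  interpret ff_ess_surj "TwoHL R :: (('k, 'u) hl_alg, 'u mor2) category"
    "HLie2 R :: (('k, 'u) hom_lie2, 'u mor2) category" hl_of hl_mor_of hom_lie_mor_of
  proof
    fix V assume "V \<in> Obj (TwoHL R :: (('k, 'u) hl_alg, 'u mor2) category)"
    then show "\<exists>L \<in> Obj (HLie2 R). \<exists>f. is_iso (TwoHL R) (hl_of L) V f"
      using TwoHL_essentially_surjective[OF assms, of V] by (auto simp: TwoHL_def HLie2_def)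
  qed (simp_all add: TwoHL_def HLie2_def hom_lie_2_algebra.hl_algebra_hl_of
      hom_lie_mor.hl_morphism_hl_mor_of hl_mor_hom_lie.hom_lie_2_morphism_hom_lie_mor_of
      hom_lie_mor_of_hl_mor_of hl_mor_of_hom_lie_mor_of hom_lie_2_ident_eq hom_lie_2_comp_eq
      hom_lie_mor_def hl_mor_hom_lie_def)
  show ?thesis
    by (rule equivalence)
qed

end
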